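(* Let $q\ge 2$ be a fixed integer. Then, as $d\to\infty$, $$\mathrm{BH}^{\mathrm{int}}_{d,q}\le \exp\left(c_q\sqrt{d\log d}+O_q\left(\sqrt{\frac{d}{\log d}}\,\log\log d\right)\right).$$
   Context: Let $C_q=\{1,\omega,\dots,\omega^{q-1}\}\subset\mathbb C$, $\omega=e^{2\pi i/q}$. Every $f:C_q^N\to\mathbb C$ has a unique Fourier expansion $f(x)=\sum_{\alpha\in\{0,\dots,q-1\}^N}\widehat f(\alpha)x^\alpha$, where $x^\alpha=x_1^{\alpha_1}\cdots x_N^{\alpha_N}$ and $\widehat f(\alpha)=q^{-N}\sum_{x\in C_q^N}f(x)\overline{x^\alpha}$. Put $\|f\|_\infty=\max_{x\in C_q^N}|f(x)|$. For a Fourier index $\alpha$, the interaction order is $s(\alpha)=|\{j\in\{1,\dots,N\}:\alpha_j\ne0\}|$. For an integer $d\ge1$ let $p_d=\frac{2d}{d+1}$. $\mathrm{BH}^{\mathrm{int}}_{d,q}$ denotes the least constant, independent of $N$, such that $\left(\sum_{s(\alpha)\le d}|\widehat f(\alpha)|^{p_d}\right)^{1/p_d}\le \mathrm{BH}^{\mathrm{int}}_{d,q}\|f\|_\infty$ for every $N\ge1$ and every $f:C_q^N\to\mathbb C$ with $\widehat f(\alpha)=0$ whenever $s(\alpha)>d$. Constants: $\gamma_2=\frac12$, $\gamma_q=\frac{q\log(q-1)}{4(q-2)}$ for $q\ge3$, and $c_q=2\sqrt{2\gamma_q}$. $O_q(\cdot)$ means that the implied constant may depend on $q$ only. *)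

theory Defs
  imports Complex_Main "HOL-Library.FuncSet" "HOL-Library.Extended_Real"
    "HOL-Library.Landau_Symbols"
begin

definition root_q :: "nat \<Rightarrow> complex" where
  "root_q q = exp (2 * of_real pi * \<i> / of_nat q)"

definition cyc :: "nat \<Rightarrow> complex set" where
  "cyc q = (\<lambda>k. root_q q ^ k) ` {..<q}"

(* C_q^N and {0,...,q-1}^N, as extensional functions on the coordinates 1,...,N.
   A function f : C_q^N -> C is any f of type (nat => complex) => complex;
   only its values on cyc_pow q N are ever used. *)
definition cyc_pow :: "nat \<Rightarrow> nat \<Rightarrow> (nat \<Rightarrow> complex) set" where
  "cyc_pow q N = {1..N} \<rightarrow>\<^sub>E cyc q"

definition freqs :: "nat \<Rightarrow> nat \<Rightarrow> (nat \<Rightarrow> nat) set" where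
  "freqs q N = {1..N} \<rightarrow>\<^sub>E {..<q}"

definition char_q :: "nat \<Rightarrow> (nat \<Rightarrow> nat) \<Rightarrow> (nat \<Rightarrow> complex) \<Rightarrow> complex" where
  "char_q N \<alpha> x = (\<Prod>j\<in>{1..N}. x j ^ \<alpha> j)"

definition fourier_coeff ::
    "nat \<Rightarrow> nat \<Rightarrow> ((nat \<Rightarrow> complex) \<Rightarrow> complex) \<Rightarrow> (nat \<Rightarrow> nat) \<Rightarrow> complex" where
  "fourier_coeff q N f \<alpha> =
     (\<Sum>x\<in>cyc_pow q N. f x * cnj (char_q N \<alpha> x)) / of_nat q ^ N"

definition sup_norm :: "nat \<Rightarrow> nat \<Rightarrow> ((nat \<Rightarrow> complex) \<Rightarrow> complex) \<Rightarrow> real" where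
  "sup_norm q N f = Max ((\<lambda>x. cmod (f x)) ` cyc_pow q N)"

definition int_order :: "nat \<Rightarrow> (nat \<Rightarrow> nat) \<Rightarrow> nat" where
  "int_order N \<alpha> = card {j\<in>{1..N}. \<alpha> j \<noteq> 0}"

definition bh_exponent :: "nat \<Rightarrow> real" where
  "bh_exponent d = 2 * real d / (real d + 1)"

definition BH_int_bound :: "nat \<Rightarrow> nat \<Rightarrow> real \<Rightarrow> bool" where
  "BH_int_bound d q C \<longleftrightarrow>
     (\<forall>N\<ge>1. \<forall>f :: (nat \<Rightarrow> complex) \<Rightarrow> complex.
        (\<forall>\<alpha>\<in>freqs q N. int_order N \<alpha> > d \<longrightarrow> fourier_coeff q N f \<alpha> = 0) \<longrightarrow>
        (\<Sum>\<alpha>\<in>{\<alpha>\<in>freqs q N. int_order N \<alpha> \<le> d}.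
            cmod (fourier_coeff q N f \<alpha>) powr bh_exponent d) powr (1 / bh_exponent d)
          \<le> C * sup_norm q N f)"

(* The least admissible constant, taken in the extended reals: it is \<infinity> if no
   admissible constant exists, so an upper bound for it also asserts finiteness. *)
definition BH_int :: "nat \<Rightarrow> nat \<Rightarrow> ereal" where
  "BH_int d q = (INF C\<in>{C. BH_int_bound d q C}. ereal C)"

definition gamma_q :: "nat \<Rightarrow> real" where
  "gamma_q q =
     (if q = 2 then 1 / 2 else real q * ln (real q - 1) / (4 * (real q - 2)))"

definition c_q :: "nat \<Rightarrow> real" where
  "c_q q = 2 * sqrt (2 * gamma_q q)"

end

theory Submission
  imports Defs "HOL-Analysis.Analysis" "HOL-Real_Asymp.Real_Asymp"
begin

text \<open>
  Write \<open>f\<close> as a polynomial and let \<open>D\<^sub>T f\<close> collect the terms divisible by the monomial \<open>x\<^sup>T\<close>, divided by it.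
  For \<open>m \<ge> k\<close> an unordered form of Blei's inequality bounds the \<open>p\<^sub>m\<close>-norm of the order-\<open>m\<close> coefficients
  by the \<open>p\<^sub>k\<close>-norm of \<open>T \<mapsto> \<parallel>D\<^sub>T f\<parallel>\<^sub>2\<close> over frequencies \<open>T\<close> of order \<open>k\<close>. Hypercontractivity, obtained
  from the sharp logarithmic Sobolev inequality of the complete graph on \<open>q\<close> points, replaces the
  \<open>L\<^sup>2\<close> norm by the \<open>p\<^sub>k\<close>-norm at the price \<open>exp (2 \<gamma>\<^sub>q d / k)\<close>. For fixed \<open>y\<close> the numbers \<open>D\<^sub>T f(y)\<close> are the
  leading coefficients of a polynomial in \<open>x\<close> of order \<open>k\<close>, namely the \<open>s\<^sup>k\<close>-coefficient of the mean of \<open>f\<close> when each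
  coordinate is taken from \<open>x\<close> with probability \<open>s\<close> and from \<open>y\<close> otherwise; a Markov-type estimate
  bounds it by about \<open>(d / k)\<^bsup>2k\<^esup> \<parallel>f\<parallel>\<^sub>\<infinity>\<close>. Hence \<open>BH\<^sub>d\<close> is at most \<open>exp (2 \<gamma>\<^sub>q d / k + 2 k ln (d / k) + O(k))\<close>
  times \<open>BH\<^sub>k\<close>, up to polynomial factors in \<open>d\<close>. Taking \<open>k = d / 2\<close> repeatedly gives \<open>BH\<^sub>k \<le> exp (O(k))\<close>, and then
  \<open>k \<approx> sqrt (2 \<gamma>\<^sub>q d / ln d)\<close> gives the theorem.
\<close>

subsection \<open>The logarithmic Sobolev inequality of the complete graph\<close>

text \<open>Classical polarization evaluates the function at sums of points and so leaves C_q^N.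
  What stays available are convex combinations of monomial values, because they are expectations of
  f over points of C_q^N. Such mixtures are bounded only for s in [0, 1], and extracting a
  coefficient at an end point of an interval costs the square of what it would cost inside a disc;
  hence (d/k)^(2k). The constant c_q comes from balancing the two losses. For k of size sqrt(d / ln
  d), ln(d/k) is about (ln d)/2, so the exponent is about 2 \<gamma> d/k + k ln d, whose minimum
  over k is 2 sqrt(2 \<gamma> d ln d). The neglected (ln ln d)/2 in ln(d/k) produces the error term.
  The preliminary bound exp(O(k)) for the constant of order k is essential: its exponent then
  disappears in the error term, whereas an exponent of size k ln k would alter c_q. The proof uses K
  = 4 \<gamma>. It is determined by equality in the two-point logarithmic Sobolev inequality when
  the masses 1/q and 1 - 1/q are exchanged; for q = 2 this condition is empty and K = 2.\<close>

lemma ln_ge_two_diff_over_sum: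
  fixes y :: real
  assumes "y \<ge> 1"
  shows "ln y \<ge> 2 * (y - 1) / (y + 1)"
proof -
  have "(\<lambda>x. ln x - 2 * (x - 1) / (x + 1)) 1 \<le> (\<lambda>x::real. ln x - 2 * (x - 1) / (x + 1)) y"
  proof (rule DERIV_nonneg_imp_nondecreasing[OF assms])
    fix x :: real assume x: "1 \<le> x" "x \<le> y"
    have "((\<lambda>x. ln x - 2 * (x - 1) / (x + 1)) has_real_derivative 1/x - (2 * (x + 1) - 2 * (x - 1)) / ((x + 1) * (x + 1))) (at x)"
      using x by (auto intro!: derivative_eq_intros)
    moreover have "1/x - (2 * (x + 1) - 2 * (x - 1)) / ((x + 1) * (x + 1)) = (x - 1)^2 / (x * (x + 1)^2)"
      using x by (simp add: divide_simps power2_eq_square) (simp add: algebra_simps)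
    ultimately have "((\<lambda>x. ln x - 2 * (x - 1) / (x + 1)) has_real_derivative (x - 1)^2 / (x * (x + 1)^2)) (at x)"
      by simp
    moreover have "(x - 1)^2 / (x * (x + 1)^2) \<ge> 0" using x by simp
    ultimately show "\<exists>z. ((\<lambda>x. ln x - 2 * (x - 1) / (x + 1)) has_real_derivative z) (at x) \<and> 0 \<le> z" by blast
  qed
  then show ?thesis by simp
qed

text \<open>Both sides concern the density of masses \<open>p\<close>, \<open>1 - p\<close> with
  respect to masses \<open>\<theta>\<close>, \<open>1 - \<theta>\<close>: relative entropy on the
  left, \<open>K\<close> times the variance of the square root of the density on the right. Their
  difference \<open>h\<close> has double zeros at \<open>\<theta>\<close> and
  \<open>1 - \<theta>\<close>, is convex near both ends of the interval and concave in the middle.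
  On the convex pieces it lies above its zero tangents; on the concave piece it lies above the
  chord.\<close>

lemma two_point_log_sobolev:
  fixes \<theta> K p :: real
  assumes th: "0 < \<theta>" "\<theta> \<le> 1/2" and K: "K \<ge> 2" "(1 - 2*\<theta>) * K = ln ((1-\<theta>)/\<theta>)"
    and p: "0 < p" "p < 1"
  shows "p * ln (p/\<theta>) + (1-p) * ln ((1-p)/(1-\<theta>))
           \<le> K * (1 - (sqrt (p*\<theta>) + sqrt ((1-p)*(1-\<theta>)))^2)"
proof -
  define c where "c = sqrt (\<theta>*(1-\<theta>))"
  have cpos: "c > 0" and c2: "c^2 = \<theta>*(1-\<theta>)" using th by (auto simp: c_def)
  define \<sigma> where "\<sigma> = K*c/2"
  define h where "h = (\<lambda>p. K*(\<theta>+p-2*p*\<theta> - 2*c * sqrt (p*(1-p))) - p*(ln p - ln \<theta>) - (1-p)*(ln (1-p) - ln (1-\<theta>)))"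
  define h' where "h' = (\<lambda>p. K*(1-2*\<theta> - c*(1-2*p)/sqrt (p*(1-p))) - (ln p - ln \<theta>) + (ln (1-p) - ln (1-\<theta>)))"
  define h'' where "h'' = (\<lambda>p. (\<sigma> - sqrt (p*(1-p))) / (sqrt (p*(1-p)))^3)"
  have d1: "(h has_real_derivative h' x) (at x)" if "0 < x" "x < 1" for x
  proof -
    have pos: "x*(1-x) > 0" using that by simp
    have S: "((\<lambda>p. sqrt (p*(1-p))) has_real_derivative (inverse (sqrt (x*(1-x))) / 2) * (1 - 2*x)) (at x)"
      by (rule DERIV_chain2[where f = sqrt and g = "\<lambda>p. p*(1-p)"], rule DERIV_real_sqrt[OF pos])
        (auto intro!: derivative_eq_intros)
    have L1: "((\<lambda>p. p*(ln p - ln \<theta>)) has_real_derivative ln x - ln \<theta> + 1) (at x)"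
      using that by (auto intro!: derivative_eq_intros)
    have L2: "((\<lambda>p. (1-p)*(ln (1-p) - ln (1-\<theta>))) has_real_derivative - (ln (1-x) - ln (1-\<theta>)) - 1) (at x)"
      using that by (auto intro!: derivative_eq_intros)
    have L3: "((\<lambda>p. \<theta>+p-2*p*\<theta>) has_real_derivative 1 - 2*\<theta>) (at x)"
      by (auto intro!: derivative_eq_intros)
    have "(h has_real_derivative K*((1 - 2*\<theta>) - (2*c)*((inverse (sqrt (x*(1-x))) / 2) * (1 - 2*x)))
        - (ln x - ln \<theta> + 1) - (- (ln (1-x) - ln (1-\<theta>)) - 1)) (at x)"
      unfolding h_def
      by (rule DERIV_diff[OF DERIV_diff[OF DERIV_cmult[OF DERIV_diff[OF L3 DERIV_cmult[OF S]]] L1] L2])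
    moreover have E: "(2*c)*((inverse (sqrt (x*(1-x))) / 2) * (1 - 2*x)) = c*(1-2*x)/sqrt (x*(1-x))"
    proof -
      have "(2*c)*((r / 2) * y) = c*y*r" for r y by simp
      then show ?thesis by (simp only: divide_inverse[of "c*(1-2*x)"])
    qed
    have "K*((1 - 2*\<theta>) - (2*c)*((inverse (sqrt (x*(1-x))) / 2) * (1 - 2*x)))
        - (ln x - ln \<theta> + 1) - (- (ln (1-x) - ln (1-\<theta>)) - 1) = h' x"
      unfolding h'_def E by linarith
    ultimately show ?thesis by simp
  qed
  have d2: "(h' has_real_derivative h'' x) (at x)" if "0 < x" "x < 1" for x
  proof -
    define s where "s = sqrt (x*(1-x))"
    have pos: "x*(1-x) > 0" using that by simp
    have s: "s > 0" "s * s = x*(1-x)" using pos by (auto simp: s_def)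
    have S: "((\<lambda>p. sqrt (p*(1-p))) has_real_derivative (inverse s / 2) * (1 - 2*x)) (at x)"
      unfolding s_def by (rule DERIV_chain2[where f = sqrt and g = "\<lambda>p. p*(1-p)"], rule DERIV_real_sqrt[OF pos])
        (auto intro!: derivative_eq_intros)
    have L0: "((\<lambda>p. 1-2*p) has_real_derivative - 2) (at x)"
      by (auto intro!: derivative_eq_intros)
    have D: "((\<lambda>p. (1-2*p)/sqrt (p*(1-p))) has_real_derivative (- 1 / (2 * s^3))) (at x)"
    proof -
      have "((\<lambda>p. (1-2*p)/sqrt (p*(1-p))) has_real_derivative
          ((-2) * s - (1-2*x) * ((inverse s / 2) * (1-2*x))) / (s * s)) (at x)"
        using DERIV_divide[OF L0 S] s(1) unfolding s_def[symmetric] by blast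
      moreover have "((-2) * s - (1-2*x) * ((inverse s / 2) * (1-2*x))) / (s * s) = - (4*(s * s) + (1-2*x)^2) / (2 * s^3)"
        using s(1) by (simp add: field_simps power2_eq_square power3_eq_cube)
      moreover have "4*(s * s) + (1-2*x)^2 = 1" unfolding s(2) by (simp add: power2_eq_square algebra_simps)
      ultimately show ?thesis by simp
    qed
    have L4: "((\<lambda>p. ln p - ln \<theta>) has_real_derivative 1/x) (at x)"
      using that by (auto intro!: derivative_eq_intros)
    have L5: "((\<lambda>p. ln (1-p) - ln (1-\<theta>)) has_real_derivative -1/(1-x)) (at x)"
      using that by (auto intro!: derivative_eq_intros)
    have h'eq: "h' = (\<lambda>p. K*(1-2*\<theta> - c*((1-2*p)/sqrt (p*(1-p)))) - (ln p - ln \<theta>) + (ln (1-p) - ln (1-\<theta>)))"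
      unfolding h'_def by (auto simp: algebra_simps)
    have e1: "1/x + 1/(1-x) = s/s^3"
    proof -
      have "1/x + 1/(1-x) = 1/(x*(1-x))" using that by (simp add: field_simps)
      also have "\<dots> = s/s^3" using s(1) unfolding power3_eq_cube s(2) by simp
      finally show ?thesis .
    qed
    have e2: "h'' x = \<sigma>/s^3 - s/s^3" unfolding h''_def s_def by (simp add: diff_divide_distrib)
    have e3: "\<sigma>/s^3 = K*c*(1/(2 * s^3))" unfolding \<sigma>_def by simp
    have "(h' has_real_derivative K*(0 - c*(- 1 / (2 * s^3))) - 1/x + -1/(1-x)) (at x)"
      unfolding h'eq
      by (rule DERIV_add[OF DERIV_diff[OF DERIV_cmult[OF DERIV_diff[OF DERIV_const DERIV_cmult[OF D]]] L4] L5])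
    moreover have "K*(0 - c*(- 1 / (2 * s^3))) - 1/x + -1/(1-x) = h'' x" using e1 e2 e3 by simp
    ultimately show ?thesis by simp
  qed
  \<comment> \<open>The zero at \<open>\<theta>\<close> is automatic; the one at
    \<open>1 - \<theta>\<close> is exactly the equation for \<open>K\<close>.\<close>
  have h0: "h \<theta> = 0" "h' \<theta> = 0" "h (1-\<theta>) = 0" "h' (1-\<theta>) = 0"
  proof -
    have e: "sqrt (\<theta>*(1-\<theta>)) = c" "sqrt ((1-\<theta>)*(1-(1-\<theta>))) = c" by (auto simp: c_def mult.commute)
    have K2: "K*(1-2*\<theta>) = ln (1-\<theta>) - ln \<theta>" using K(2) th by (simp add: ln_div mult.commute)
    have cc: "2*c*c = 2*(\<theta>*(1-\<theta>))" using c2 by (simp add: power2_eq_square)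
    show "h \<theta> = 0" unfolding h_def e using cc by (simp add: algebra_simps)
    have "c * (1-2*\<theta>) / c = 1 - 2*\<theta>" using cpos by simp
    then show "h' \<theta> = 0" unfolding h'_def e(1) by (simp only: diff_self mult_zero_right)
    have "h (1-\<theta>) = K*((1-2*\<theta>)*(1-2*\<theta>)) - (1-2*\<theta>)*(ln (1-\<theta>) - ln \<theta>)"
      unfolding h_def e cc by (simp add: algebra_simps)
    also have "\<dots> = (1-2*\<theta>)*(K*(1-2*\<theta>) - (ln (1-\<theta>) - ln \<theta>))" by (simp add: algebra_simps)
    also have "\<dots> = 0" using K2 by simp
    finally show "h (1-\<theta>) = 0" .
    have "c * (1-2*(1-\<theta>)) / c = 1-2*(1-\<theta>)" using cpos by simp
    then have "h' (1-\<theta>) = K*(1-2*\<theta> - (1-2*(1-\<theta>))) - (ln (1-\<theta>) - ln \<theta>) + (ln (1-(1-\<theta>)) - ln (1-\<theta>))"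
      unfolding h'_def e by (simp only:)
    also have "\<dots> = 2*(K*(1-2*\<theta>)) - 2*(ln (1-\<theta>) - ln \<theta>)" by (simp add: algebra_simps)
    finally have "h' (1-\<theta>) = 2*(K*(1-2*\<theta>)) - 2*(ln (1-\<theta>) - ln \<theta>)" .
    then show "h' (1-\<theta>) = 0" using K2 by simp
  qed
  \<comment> \<open>\<open>h''\<close> has the sign of \<open>\<sigma> - sqrt (p*(1-p))\<close>, and
    \<open>c\<close> is the value of this root at \<open>\<theta>\<close>. So
    \<open>K \<ge> 2\<close> places \<open>\<theta>\<close> and \<open>1 - \<theta>\<close> in the
    convex region.\<close>
  have \<sigma>c: "c \<le> \<sigma>" using K(1) cpos unfolding \<sigma>_def by simp
  \<comment> \<open>The left inflection point, the smaller root of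
    \<open>x*(1-x) = \<sigma>^2\<close>; if there is no sign change, \<open>h\<close> is convex
    throughout and the two outer pieces meet at \<open>1/2\<close>.\<close>
  define p1 where "p1 = (if \<sigma> \<ge> 1/2 then 1/2 else (1 - sqrt (1-4*\<sigma>^2))/2)"
  have \<sigma>pos: "\<sigma> > 0" using \<sigma>c cpos by simp
  have sq: "4*\<sigma>^2 < 1" if "\<sigma> < 1/2"
  proof -
    have "\<sigma>^2 < (1/2)^2" using that \<sigma>pos by (intro power_strict_mono) auto
    then show ?thesis by (simp add: power2_eq_square)
  qed
  have p1: "0 < p1" "p1 \<le> 1/2"
    unfolding p1_def using sq \<sigma>pos by auto
  have fac: "x*(1-x) - \<sigma>^2 = (x-p1)*(1-p1-x)" if "\<sigma> < 1/2" for x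
  proof -
    have "p1*(1-p1) = \<sigma>^2" unfolding p1_def using that sq[OF that]
      by (simp add: field_simps power2_eq_square)
    then show ?thesis by (simp add: algebra_simps)
  qed
  have out: "sqrt (x*(1-x)) \<le> \<sigma>" if "0 < x" "x < 1" "x \<le> p1 \<or> x \<ge> 1-p1" for x
  proof (cases "\<sigma> < 1/2")
    case True
    have "(x-p1)*(1-p1-x) \<le> 0" using that p1 by (auto simp: mult_le_0_iff)
    then have "x*(1-x) \<le> \<sigma>^2" using fac[OF True, of x] by simp
    then show ?thesis using \<sigma>pos real_le_lsqrt by simp
  next
    case False
    have "x*(1-x) \<le> (1/2)^2" using sum_squares_ge_zero[of "x-1/2" 0] by (simp add: power2_eq_square algebra_simps)
    then have "sqrt (x*(1-x)) \<le> 1/2" using real_sqrt_le_mono by (intro real_le_lsqrt) auto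
    then show ?thesis using False by simp
  qed
  have inn: "sqrt (x*(1-x)) \<ge> \<sigma>" if "p1 \<le> x" "x \<le> 1-p1" "\<sigma> < 1/2" for x
  proof -
    have "(x-p1)*(1-p1-x) \<ge> 0" using that by simp
    then have "x*(1-x) \<ge> \<sigma>^2" using fac[OF that(3), of x] by simp
    then show ?thesis using \<sigma>pos real_le_rsqrt by simp
  qed
  have thp1: "\<theta> \<le> p1"
  proof (rule ccontr)
    assume "\<not> \<theta> \<le> p1"
    then have a: "p1 < \<theta>" by simp
    then have s: "\<sigma> < 1/2" using th p1 unfolding p1_def by (auto split: if_splits)
    have "0 < (\<theta>-p1)*(1-p1-\<theta>)" using a th by (intro mult_pos_pos) auto
    then have "\<sigma>^2 < c^2" using fac[OF s, of \<theta>] c2 by simp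
    then show False using \<sigma>c \<sigma>pos cpos by (meson not_less power_mono less_imp_le)
  qed
  have h2pos: "h'' x \<ge> 0" if "0 < x" "x < 1" "x \<le> p1 \<or> x \<ge> 1-p1" for x
    unfolding h''_def using out[OF that] that by (simp add: field_simps)
  have left: "h x \<ge> 0" if "0 < x" "x \<le> p1" for x
  proof -
    have "h' \<theta> * (x-\<theta>) \<le> h x - h \<theta>"
      by (rule f''_imp_f'[of "{0<..p1}" h h' h'']) (use that th thp1 p1 d1 d2 h2pos in auto)
    then show ?thesis using h0 by simp
  qed
  have right: "h x \<ge> 0" if "1-p1 \<le> x" "x < 1" for x
  proof -
    have "h' (1-\<theta>) * (x-(1-\<theta>)) \<le> h x - h (1-\<theta>)"
      by (rule f''_imp_f'[of "{1-p1..<1}" h h' h'']) (use that th thp1 p1 d1 d2 h2pos in auto)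
    then show ?thesis using h0 by simp
  qed
  have "h p \<ge> 0"
  proof (cases "p1 \<le> p \<and> p \<le> 1-p1 \<and> \<sigma> < 1/2")
    case True
    have h2neg: "h'' x \<le> 0" if "p1 \<le> x" "x \<le> 1-p1" for x
    proof -
      have "sqrt (x*(1-x)) \<ge> 0" using that p1 by simp
      then show ?thesis unfolding h''_def using inn[OF that] True by (simp add: divide_nonpos_nonneg)
    qed
    have conc: "concave_on {p1..1-p1} h"
      by (rule f''_le0_imp_concave[of _ h h' h'']) (use p1 d1 d2 h2neg in auto)
    have e: "h p1 \<ge> 0" "h (1-p1) \<ge> 0" using left[of p1] right[of "1-p1"] p1 by auto
    have "p \<in> closed_segment p1 (1-p1)" using True p1 by (auto simp: closed_segment_eq_real_ivl)
    then obtain u where u: "0 \<le> u" "u \<le> 1" "p = (1-u) *\<^sub>R p1 + u *\<^sub>R (1-p1)"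
      unfolding closed_segment_def by auto
    have "h p \<ge> (1-u) * h p1 + u * h (1-p1)"
      unfolding u(3) using conc u p1 by (intro concave_onD) auto
    moreover have "(1-u) * h p1 + u * h (1-p1) \<ge> 0" using e u by simp
    ultimately show ?thesis by linarith
  next
    case False
    then have "p \<le> p1 \<or> 1-p1 \<le> p" unfolding p1_def by (auto split: if_splits)
    then show ?thesis using left right p by blast
  qed
  moreover have "(sqrt (p*\<theta>) + sqrt ((1-p)*(1-\<theta>)))^2 = p*\<theta> + (1-p)*(1-\<theta>) + 2*c * sqrt (p*(1-p))"
  proof -
    have "sqrt (p*\<theta>) * sqrt ((1-p)*(1-\<theta>)) = c * sqrt (p*(1-p))"
      unfolding c_def by (simp add: real_sqrt_mult)
    then show ?thesis using p th by (simp add: power2_sum)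
  qed
  then have "1 - (sqrt (p*\<theta>) + sqrt ((1-p)*(1-\<theta>)))^2 = \<theta>+p-2*p*\<theta> - 2*c * sqrt (p*(1-p))"
    by (simp add: algebra_simps)
  moreover have "ln (p/\<theta>) = ln p - ln \<theta>" "ln ((1-p)/(1-\<theta>)) = ln (1-p) - ln (1-\<theta>)"
    using p th by (simp_all add: ln_div)
  ultimately show ?thesis using \<open>h p \<ge> 0\<close> unfolding h_def by simp
qed

text \<open>The limiting case \<open>p = 1\<close> of the two-point inequality. It occurs when the
  extremal function vanishes at all points but one.\<close>

lemma two_point_log_sobolev_boundary:
  fixes \<theta> K :: real
  assumes th: "0 < \<theta>" "\<theta> \<le> 1/2" and K: "K \<ge> 2" "(1 - 2*\<theta>) * K = ln ((1-\<theta>)/\<theta>)"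
  shows "ln (1/\<theta>) \<le> K * (1 - \<theta>)"
proof -
  have "ln (1/(1-\<theta>)) \<le> 1/(1-\<theta>) - 1" by (rule ln_le_minus_one) (use th in simp)
  also have "\<dots> \<le> 2 * \<theta>"
  proof -
    have "\<theta> * (1 - 2*\<theta>) \<ge> 0" using th by simp
    then show ?thesis using th by (simp add: divide_le_eq algebra_simps)
  qed
  also have "\<dots> \<le> K * \<theta>" using K(1) th by simp
  finally have "ln (1/(1-\<theta>)) \<le> K * \<theta>" .
  moreover have "ln (1/\<theta>) = ln ((1-\<theta>)/\<theta>) + ln (1/(1-\<theta>))"
    using th by (simp add: ln_div)
  ultimately have "ln (1/\<theta>) \<le> (1 - 2*\<theta>) * K + K * \<theta>" using K(2) by simp
  then show ?thesis by (simp add: algebra_simps)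
qed

text \<open>The touching point is normalized to 1, where \<open>2*(t-1)\<close> is the tangent.
  After subtracting it, the quotient by \<open>(t-1)^2\<close> increases for \<open>t > 1\<close>,
  so its value at \<open>\<tau>\<close> suffices up to \<open>\<tau>\<close>. That value is at least
  3, half the second derivative at 1, and 3 suffices for \<open>t \<le> 1\<close> because the third
  derivative is positive.\<close>

lemma entropy_quadratic_majorant_one:
  fixes t \<tau> :: real
  assumes "0 < t" "t \<le> \<tau>" "1 < \<tau>"
  shows "t^2 * ln (t^2) \<le> 2*(t-1) + (\<tau>^2 * ln (\<tau>^2) - 2*(\<tau>-1))/(\<tau>-1)^2 * (t-1)^2"
proof -
  define N where "N = (\<lambda>t::real. 2*t^2*ln t - 2*(t-1))"
  have lnsq: "x^2 * ln (x^2) = 2*x^2*ln x" if "x > 0" for x :: real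
    using that by (simp add: ln_realpow)
  define E where "E = (\<lambda>t::real. N t - 3*(t-1)^2)"
  have dN: "(N has_real_derivative 4*x*ln x + 2*x - 2) (at x)" if "x > 0" for x
    unfolding N_def using that
    by (auto intro!: derivative_eq_intros simp: power2_eq_square)
  have E_mono: "E x \<le> E y" if "0 < x" "x \<le> y" for x y
  proof (rule DERIV_nonneg_imp_nondecreasing[OF that(2)])
    fix z assume z: "x \<le> z" "z \<le> y"
    then have "z > 0" using that by simp
    have "(E has_real_derivative (4*z*ln z + 2*z - 2) - 6*(z-1)) (at z)"
      unfolding E_def by (rule DERIV_diff[OF dN[OF \<open>z>0\<close>]]) (auto intro!: derivative_eq_intros)
    moreover have "(4*z*ln z + 2*z - 2) - 6*(z-1) \<ge> 0"
    proof -
      have "ln (1/z) \<le> 1/z - 1" by (rule ln_le_minus_one) (use \<open>z>0\<close> in simp)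
      then have "z * (- ln z) \<le> z * (1/z - 1)" using \<open>z>0\<close> by (intro mult_left_mono) (auto simp: ln_div)
      then show ?thesis using \<open>z>0\<close> by (simp add: algebra_simps)
    qed
    ultimately show "\<exists>d. (E has_real_derivative d) (at z) \<and> 0 \<le> d" by blast
  qed
  have E1: "E 1 = 0" by (simp add: E_def N_def)
  define c where "c = N \<tau> / (\<tau>-1)^2"
  have c3: "c \<ge> 3" unfolding c_def using E_mono[of 1 \<tau>] assms E1 by (simp add: E_def le_divide_eq)
  have main: "N t \<le> c * (t-1)^2"
  proof (cases "t \<le> 1")
    case True
    then have "N t \<le> 3*(t-1)^2" using E_mono[of t 1] E1 assms by (simp add: E_def)
    also have "\<dots> \<le> c*(t-1)^2" using c3 by (intro mult_right_mono) auto
    finally show ?thesis .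
  next
    case False
    have "N t / (t-1)^2 \<le> N \<tau> / (\<tau>-1)^2"
    proof (rule DERIV_nonneg_imp_nondecreasing[OF assms(2)])
      fix z assume z: "t \<le> z" "z \<le> \<tau>"
      then have z1: "z > 1" using False by simp
      have d: "((\<lambda>x. (x-1)^2) has_real_derivative 2*(z-1)) (at z)"
        by (auto intro!: derivative_eq_intros)
      have D: "((\<lambda>x. N x / (x-1)^2) has_real_derivative
          ((4*z*ln z + 2*z - 2) * (z-1)^2 - N z * (2*(z-1))) / ((z-1)^2 * (z-1)^2)) (at z)"
        by (rule DERIV_divide[OF dN d]) (use z1 in auto)
      have G: "z^2 - 1 - 2*z*ln z \<ge> 0"
      proof -
        have "1^2 - 1 - 2*1*ln 1 \<le> z^2 - 1 - 2*z*ln (z::real)"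
        proof (rule DERIV_nonneg_imp_nondecreasing[of 1 z "\<lambda>z. z^2 - 1 - 2*z*ln z"])
          fix y assume y: "1 \<le> y" "y \<le> z"
          have "((\<lambda>z. z^2 - 1 - 2*z*ln z) has_real_derivative 2*y - 2 - 2*ln y) (at y)"
            using y by (auto intro!: derivative_eq_intros simp: field_simps)
          moreover have "2*y - 2 - 2*ln y \<ge> 0" using ln_le_minus_one[of y] y by simp
          ultimately show "\<exists>d. ((\<lambda>z. z^2 - 1 - 2*z*ln z) has_real_derivative d) (at y) \<and> 0 \<le> d" by blast
        qed (use z1 in simp)
        then show ?thesis by simp
      qed
      have "(4*z*ln z + 2*z - 2) * (z-1)^2 - N z * (2*(z-1)) = 2*(z-1)*(z^2 - 1 - 2*z*ln z)"
        unfolding N_def by (simp add: power2_eq_square algebra_simps)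
      also have "\<dots> \<ge> 0" using G z1 by simp
      finally have "((4*z*ln z + 2*z - 2) * (z-1)^2 - N z * (2*(z-1))) / ((z-1)^2 * (z-1)^2) \<ge> 0"
        by simp
      then show "\<exists>d. ((\<lambda>x. N x / (x-1)^2) has_real_derivative d) (at z) \<and> 0 \<le> d"
        using D by blast
    qed
    then show ?thesis using False by (simp add: c_def divide_le_eq)
  qed
  have "t^2 * ln (t^2) = 2*(t-1) + N t" using assms by (simp add: lnsq N_def)
  moreover have "c = (\<tau>^2 * ln (\<tau>^2) - 2*(\<tau>-1))/(\<tau>-1)^2" unfolding c_def N_def using assms by (simp add: lnsq)
  ultimately show ?thesis using main by simp
qed

text \<open>Hermite interpolation of \<open>x\<^sup>2 ln x\<^sup>2\<close>: a parabola touching it at \<open>b\<close> and meeting it at \<open>a\<close>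
  stays above it on \<open>[0, a]\<close>, because the third derivative is positive.\<close>

lemma entropy_quadratic_majorant:
  fixes a b :: real
  assumes "0 \<le> b" "b < a"
  obtains A B C where "\<And>x. 0 \<le> x \<Longrightarrow> x \<le> a \<Longrightarrow> x^2 * ln (x^2) \<le> A + B*x + C*x^2"
    "a^2 * ln (a^2) = A + B*a + C*a^2" "b^2 * ln (b^2) = A + B*b + C*b^2"
proof (cases "b = 0")
  case True
  have "x^2 * ln (x^2) \<le> 0 + 0*x + ln (a^2) * x^2" if "0 \<le> x" "x \<le> a" for x
  proof (cases "x = 0")
    case False
    then have "ln (x^2) \<le> ln (a^2)" using that by (intro ln_mono power_mono) auto
    then show ?thesis by (simp add: mult.commute mult_left_mono)
  qed simp
  then show ?thesis using that[of 0 0 "ln (a^2)"] True by simp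
next
  case False
  then have b: "b > 0" using assms by simp
  define \<tau> where "\<tau> = a/b"
  have \<tau>: "\<tau> > 1" "a = b*\<tau>" unfolding \<tau>_def using b assms by auto
  define c where "c = (\<tau>^2 * ln (\<tau>^2) - 2*(\<tau>-1))/(\<tau>-1)^2"
  define A where "A = c*b^2 - 2*b^2"
  define B where "B = 2*b - 2*c*b"
  define C where "C = c + ln (b^2)"
  have scale: "(b*t)^2 * ln ((b*t)^2) = b^2 * (t^2 * ln (t^2)) + (b*t)^2 * ln (b^2)" if "t > 0" for t
    using that b by (simp add: power_mult_distrib ln_mult algebra_simps)
  have quad: "A + B*(b*t) + C*(b*t)^2 = b^2 * (2*(t-1) + c*(t-1)^2) + (b*t)^2 * ln (b^2)" for t
    unfolding A_def B_def C_def by (simp add: power2_eq_square algebra_simps)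
  have "x^2 * ln (x^2) \<le> A + B*x + C*x^2" if "0 \<le> x" "x \<le> a" for x
  proof -
    define t where "t = x/b"
    have t: "x = b*t" "t \<ge> 0" "t \<le> \<tau>" unfolding t_def \<tau>_def using b that by (auto intro: divide_right_mono)
    have "x^2 * ln (x^2) \<le> b^2 * (2*(t-1) + c*(t-1)^2) + (b*t)^2 * ln (b^2)"
    proof (cases "t = 0")
      case True
      \<comment> \<open>At \<open>t = 0\<close> the entropy term is 0 and the parabola has the value
        \<open>b^2 * (c - 2)\<close>.\<close>
      have "c \<ge> 2"
      proof -
        have "ln (1/\<tau>) \<le> 1/\<tau> - 1" by (rule ln_le_minus_one) (use \<tau> in simp)
        then have "ln \<tau> \<ge> 1 - 1/\<tau>" using \<tau> by (simp add: ln_div)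
        then have "2*\<tau>^2 * ln \<tau> \<ge> 2*\<tau>^2 * (1 - 1/\<tau>)" by (intro mult_left_mono) auto
        also have "2*\<tau>^2 * (1 - 1/\<tau>) = 2*\<tau>^2 - 2*\<tau>" using \<tau> by (simp add: power2_eq_square algebra_simps)
        finally have "\<tau>^2 * ln (\<tau>^2) - 2*(\<tau>-1) \<ge> 2 * (\<tau>-1)^2"
          unfolding ln_realpow
          by (simp add: power2_eq_square algebra_simps)
        then show ?thesis unfolding c_def using \<tau> by (simp add: le_divide_eq)
      qed
      then show ?thesis using True t by simp
    next
      case False
      then have "t > 0" using t by simp
      have "b^2 * (t^2 * ln (t^2)) \<le> b^2 * (2*(t-1) + c*(t-1)^2)"
        unfolding c_def using entropy_quadratic_majorant_one[OF \<open>t>0\<close> t(3) \<tau>(1)] by (intro mult_left_mono) auto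
      then show ?thesis unfolding t(1) scale[OF \<open>t>0\<close>] by simp
    qed
    then show ?thesis using quad[of t] t(1) by simp
  qed
  moreover have "a^2 * ln (a^2) = A + B*a + C*a^2"
    unfolding \<tau>(2) quad using scale[of \<tau>] \<tau>(1) by (simp add: c_def)
  moreover have "b^2 * ln (b^2) = A + B*b + C*b^2"
    using quad[of 1] by simp
  ultimately show ?thesis using that by blast
qed

text \<open>Among functions with given mean and mean square, the worst takes one value
  \<open>a\<close> once and a smaller value \<open>b\<close> at the other points. A quadratic
  majorant of \<open>x^2 * ln (x^2)\<close> that is exact at \<open>a\<close> and \<open>b\<close>
  has a sum depending only on the two moments, so this sum may be evaluated at the extremal
  function. What remains is the two-point inequality with \<open>\<theta> = 1/q\<close>, where
  \<open>p = a^2/q\<close> is the mass of the exceptional point.\<close>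

lemma log_sobolev_complete_graph_normalized:
  fixes u :: "'a \<Rightarrow> real" and K :: real and q :: nat
  assumes \<Omega>: "finite \<Omega>" "card \<Omega> = q" "q \<ge> 2" and u: "\<And>\<omega>. \<omega> \<in> \<Omega> \<Longrightarrow> u \<omega> \<ge> 0"
    and K: "K \<ge> 2" "(1 - 2 / real q) * K = ln (real q - 1)"
    and norm: "(\<Sum>\<omega>\<in>\<Omega>. (u \<omega>)^2) = real q"
  shows "(\<Sum>\<omega>\<in>\<Omega>. (u \<omega>)^2 * ln ((u \<omega>)^2)) / real q \<le> K * (1 - ((\<Sum>\<omega>\<in>\<Omega>. u \<omega>) / real q)^2)"
proof -
  define Q where "Q = real q"
  have Q: "Q \<ge> 2" using \<Omega> by (simp add: Q_def)
  define m where "m = (\<Sum>\<omega>\<in>\<Omega>. u \<omega>) / Q"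
  define v where "v = 1 - m^2"
  have sumu: "(\<Sum>\<omega>\<in>\<Omega>. u \<omega>) = Q*m" using Q by (simp add: m_def)
  have m0: "m \<ge> 0" unfolding m_def using Q u by (simp add: sum_nonneg)
  have var: "(\<Sum>\<omega>\<in>\<Omega>. (u \<omega> - m)^2) = Q * v"
  proof -
    have "(\<Sum>\<omega>\<in>\<Omega>. (u \<omega> - m)^2) = (\<Sum>\<omega>\<in>\<Omega>. (u \<omega>)^2 - 2*m*u \<omega> + m^2)"
      by (intro sum.cong) (auto simp: power2_eq_square algebra_simps)
    also have "\<dots> = Q - 2*m*(Q*m) + Q*m^2"
      using \<Omega> norm by (simp add: sum.distrib sum_subtractf sumu flip: sum_distrib_left Q_def)
    finally show ?thesis by (simp add: v_def power2_eq_square algebra_simps)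
  qed
  have v0: "v \<ge> 0" 
  proof -
    have "Q * v \<ge> 0" unfolding var[symmetric] by (simp add: sum_nonneg)
    then show ?thesis using Q by (simp add: zero_le_mult_iff)
  qed
  have "(\<Sum>\<omega>\<in>\<Omega>. (u \<omega>)^2 * ln ((u \<omega>)^2)) / Q \<le> K * v"
  proof (cases "v = 0")
    case True
    then have "(\<Sum>\<omega>\<in>\<Omega>. (u \<omega> - m)^2) = 0" using var by simp
    then have "\<forall>\<omega>\<in>\<Omega>. (u \<omega> - m)^2 = 0" using \<Omega> by (subst (asm) sum_nonneg_eq_0_iff) auto
    then have "\<forall>\<omega>\<in>\<Omega>. u \<omega> = m" by simp
    moreover have "m^2 = 1" using True by (simp add: v_def)
    ultimately show ?thesis using True by simp
  next
    case False
    then have vpos: "v > 0" using v0 by simp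
    \<comment> \<open>Chosen so that the values \<open>a\<close> (once) and \<open>b\<close>
      (\<open>Q - 1\<close> times) have mean \<open>m\<close> and mean square 1, like
      \<open>u\<close>.\<close>
    define e where "e = sqrt (v/(Q-1))"
    have e: "e > 0" "(Q-1)*e^2 = v" unfolding e_def using vpos Q by auto
    define a where "a = m + (Q-1)*e"
    define b where "b = m - e"
    \<comment> \<open>The majorant is valid only up to \<open>a\<close>. Cauchy-Schwarz on the other
      \<open>Q - 1\<close> points shows that no deviation from the mean exceeds
      \<open>(Q-1)*e\<close>.\<close>
    have ub: "u \<omega> \<le> a" if "\<omega> \<in> \<Omega>" for \<omega>
    proof -
      define x where "x = u \<omega> - m"
      have s0: "(\<Sum>\<eta>\<in>\<Omega>. u \<eta> - m) = 0" using \<Omega> by (simp add: sum_subtractf sumu Q_def)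
      have "(\<Sum>\<eta>\<in>\<Omega>-{\<omega>}. u \<eta> - m) = - x"
        using s0 sum.remove[OF \<Omega>(1) that, of "\<lambda>\<eta>. u \<eta> - m"] by (simp add: x_def)
      moreover have "(\<Sum>\<eta>\<in>\<Omega>-{\<omega>}. (u \<eta> - m)^2) = Q * v - x^2"
        using var sum.remove[OF \<Omega>(1) that, of "\<lambda>\<eta>. (u \<eta> - m)^2"] by (simp add: x_def)
      moreover have "real (card (\<Omega>-{\<omega>})) = Q - 1" using that \<Omega> by (simp add: Q_def of_nat_diff)
      ultimately have "(-x)^2 \<le> (Q * v - x^2) * (Q - 1)"
        using sum_squared_le_sum_of_squares[of "\<lambda>\<eta>. u \<eta> - m" "\<Omega>-{\<omega>}"] \<Omega>(1) by simp
      then have "Q * x^2 \<le> Q * ((Q-1) * v)" by (simp add: algebra_simps)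
      then have "x^2 \<le> (Q-1) * v" using Q by simp
      also have "\<dots> = ((Q-1)*e)^2" unfolding e(2)[symmetric] by (simp add: power2_eq_square)
      finally have "x \<le> (Q-1)*e" by (rule power2_le_imp_le) (use e Q in simp)
      then show ?thesis by (simp add: x_def a_def)
    qed
    \<comment> \<open>For nonnegative \<open>u\<close> the sum of the squares is at most the square
      of the sum, which amounts to \<open>e \<le> m\<close>.\<close>
    have b0: "b \<ge> 0"
    proof -
      have "(\<Sum>\<omega>\<in>\<Omega>. (u \<omega>)^2) \<le> (\<Sum>\<omega>\<in>\<Omega>. u \<omega> * (\<Sum>\<omega>\<in>\<Omega>. u \<omega>))"
        unfolding power2_eq_square using u \<Omega> by (intro sum_mono mult_left_mono member_le_sum) auto
      also have "\<dots> = (Q*m)*(Q*m)" by (simp add: sumu flip: sum_distrib_right)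
      finally have "Q * 1 \<le> Q * (Q * m^2)" using norm by (simp add: Q_def power2_eq_square algebra_simps)
      then have "1 \<le> Q*m^2" using Q by (subst (asm) mult_le_cancel_left_pos) auto
      then have "(Q-1)*e^2 \<le> (Q-1)*m^2" unfolding e(2) v_def by (simp add: algebra_simps)
      then have "e^2 \<le> m^2" using Q by simp
      then have "e \<le> m" using m0 by (rule power2_le_imp_le)
      then show ?thesis by (simp add: b_def)
    qed
    have ab: "b < a" unfolding a_def b_def using mult_pos_pos[of "Q-1" e] e(1) Q by linarith
    have sab: "a + (Q-1)*b = Q*m" unfolding a_def b_def by (simp add: algebra_simps)
    have "a^2 + (Q-1)*b^2 = Q*m^2 + Q*((Q-1)*e^2)" unfolding a_def b_def by (simp add: power2_eq_square algebra_simps)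
    also have "\<dots> = Q" unfolding e(2) v_def by (simp add: algebra_simps)
    finally have sab2: "a^2 + (Q-1)*b^2 = Q" .
    obtain A B C where ABC: "\<And>x. 0 \<le> x \<Longrightarrow> x \<le> a \<Longrightarrow> x^2 * ln (x^2) \<le> A + B*x + C*x^2"
      "a^2 * ln (a^2) = A + B*a + C*a^2" "b^2 * ln (b^2) = A + B*b + C*b^2"
      by (rule entropy_quadratic_majorant[OF b0 ab]) blast
    have "(\<Sum>\<omega>\<in>\<Omega>. (u \<omega>)^2 * ln ((u \<omega>)^2)) \<le> (\<Sum>\<omega>\<in>\<Omega>. A + B*u \<omega> + C*(u \<omega>)^2)"
      using u ub by (intro sum_mono ABC(1)) auto
    also have "\<dots> = Q*A + B*(Q*m) + C*Q"
      using \<Omega> norm by (simp add: sum.distrib sumu flip: sum_distrib_left Q_def)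
    also have "\<dots> = Q*A + B*(a + (Q-1)*b) + C*(a^2 + (Q-1)*b^2)" by (simp add: sab sab2)
    also have "\<dots> = a^2 * ln (a^2) + (Q-1)*(b^2 * ln (b^2))"
      unfolding ABC(2,3) by (simp add: algebra_simps)
    finally have 1: "(\<Sum>\<omega>\<in>\<Omega>. (u \<omega>)^2 * ln ((u \<omega>)^2)) \<le> a^2 * ln (a^2) + (Q-1)*(b^2 * ln (b^2))" .
    define \<theta> where "\<theta> = 1/Q"
    have th: "0 < \<theta>" "\<theta> \<le> 1/2" "(1-\<theta>)/\<theta> = Q-1" using Q by (auto simp: \<theta>_def field_simps)
    have K': "(1 - 2*\<theta>) * K = ln ((1-\<theta>)/\<theta>)" using K(2) unfolding th(3) by (simp add: \<theta>_def Q_def)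
    have apos: "a > 0" using ab b0 by simp
    have 2: "a^2 * ln (a^2) + (Q-1)*(b^2 * ln (b^2)) \<le> Q*(K * v)"
    proof (cases "b = 0")
      case True
      then have a2: "a^2 = Q" using sab2 by simp
      have "m = a/Q" using sab True Q by (simp add: field_simps)
      then have "m^2 = \<theta>" using a2 Q by (simp add: power_divide \<theta>_def power2_eq_square)
      then have "v = 1-\<theta>" by (simp add: v_def)
      moreover have "ln Q = ln (1/\<theta>)" by (simp add: \<theta>_def)
      ultimately show ?thesis using True a2 Q two_point_log_sobolev_boundary[OF th(1,2) K(1) K']
        by (simp add: mult_left_mono)
    next
      case False
      then have bpos: "b > 0" using b0 by simp
      define p where "p = a^2/Q"
      have p1: "1-p = (Q-1)*b^2/Q" unfolding p_def using sab2 Q by (simp add: field_simps)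
      have p: "0 < p" "p < 1"
      proof -
        show "0 < p" unfolding p_def using apos Q by simp
        have "1-p > 0" unfolding p1 using bpos Q by simp
        then show "p < 1" by simp
      qed
      have r1: "p/\<theta> = a^2" unfolding p_def \<theta>_def using Q by simp
      have r2: "(1-p)/(1-\<theta>) = b^2" unfolding p1 \<theta>_def using Q by (simp add: field_simps)
      have r3: "sqrt (p*\<theta>) = a/Q" unfolding p_def \<theta>_def using Q apos by (simp add: real_sqrt_divide real_sqrt_mult)
      have r4: "sqrt ((1-p)*(1-\<theta>)) = (Q-1)*b/Q"
      proof -
        have "(1-p)*(1-\<theta>) = ((Q-1)*b/Q)^2" unfolding p1 \<theta>_def using Q by (simp add: field_simps power2_eq_square)
        then show ?thesis using Q bpos by simp
      qed
      have r5: "a/Q + (Q-1)*b/Q = m" using sab Q by (simp add: field_simps)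
      have "p * ln (a^2) + (1-p) * ln (b^2) \<le> K * (1 - m^2)"
        using two_point_log_sobolev[OF th(1,2) K(1) K' p] unfolding r1 r2 r3 r4 r5 .
      then have "Q * (p * ln (a^2) + (1-p) * ln (b^2)) \<le> Q * (K * v)"
        using Q by (simp add: v_def)
      moreover have "Q * (p * ln (a^2) + (1-p) * ln (b^2)) = (Q*p) * ln (a^2) + (Q*(1-p)) * ln (b^2)" by (simp add: algebra_simps)
      moreover have "Q*p = a^2" "Q*(1-p) = (Q-1)*b^2" unfolding p1 unfolding p_def using Q by auto
      ultimately show ?thesis by simp
    qed
    show ?thesis using 1 2 Q by (simp add: divide_le_eq mult.commute)
  qed
  then show ?thesis unfolding v_def m_def Q_def .
qed

lemma log_sobolev_complete_graph:
  fixes u :: "'a \<Rightarrow> real" and K :: real and q :: nat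
  assumes \<Omega>: "finite \<Omega>" "card \<Omega> = q" "q \<ge> 2" and u: "\<And>\<omega>. \<omega> \<in> \<Omega> \<Longrightarrow> u \<omega> \<ge> 0"
    and K: "K \<ge> 2" "(1 - 2 / real q) * K = ln (real q - 1)"
  shows "(\<Sum>\<omega>\<in>\<Omega>. (u \<omega>)^2 * ln ((u \<omega>)^2)) / real q
     \<le> (\<Sum>\<omega>\<in>\<Omega>. (u \<omega>)^2) / real q * ln ((\<Sum>\<omega>\<in>\<Omega>. (u \<omega>)^2) / real q)
       + K * ((\<Sum>\<omega>\<in>\<Omega>. (u \<omega>)^2) / real q - ((\<Sum>\<omega>\<in>\<Omega>. u \<omega>) / real q)^2)"
proof (cases "\<forall>\<omega>\<in>\<Omega>. u \<omega> = 0")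
  case True
  then show ?thesis by simp
next
  case False
  define S where "S = (\<Sum>\<omega>\<in>\<Omega>. (u \<omega>)^2) / real q"
  have S0: "S > 0" unfolding S_def using False \<Omega> by (auto intro!: divide_pos_pos sum_pos2)
  define s where "s = sqrt S"
  have s: "s > 0" "s^2 = S" using S0 by (auto simp: s_def)
  define w where "w = (\<lambda>\<omega>. u \<omega> / s)"
  have w: "u \<omega> = s * w \<omega>" for \<omega> using s by (simp add: w_def)
  have "(\<Sum>\<omega>\<in>\<Omega>. (u \<omega>)^2) = real q * S" using \<Omega> by (simp add: S_def)
  then have normw: "(\<Sum>\<omega>\<in>\<Omega>. (w \<omega>)^2) = real q"
    unfolding w_def power_divide s(2) using S0 by (simp flip: sum_divide_distrib)
  have "(\<Sum>\<omega>\<in>\<Omega>. (w \<omega>)^2 * ln ((w \<omega>)^2)) / real q \<le> K * (1 - ((\<Sum>\<omega>\<in>\<Omega>. w \<omega>) / real q)^2)"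
    by (rule log_sobolev_complete_graph_normalized[OF \<Omega> _ K normw]) (use u s in \<open>simp add: w_def\<close>)
  then have "S * ((\<Sum>\<omega>\<in>\<Omega>. (w \<omega>)^2 * ln ((w \<omega>)^2)) / real q) \<le> S * (K * (1 - ((\<Sum>\<omega>\<in>\<Omega>. w \<omega>) / real q)^2))"
    using S0 by (intro mult_left_mono) auto
  moreover have "(u \<omega>)^2 * ln ((u \<omega>)^2) = S * ((w \<omega>)^2 * ln ((w \<omega>)^2)) + S * ln S * (w \<omega>)^2" for \<omega>
    unfolding w power_mult_distrib s(2) using S0 by (cases "w \<omega> = 0") (simp_all add: ln_mult algebra_simps)
  then have "(\<Sum>\<omega>\<in>\<Omega>. (u \<omega>)^2 * ln ((u \<omega>)^2))
      = S * (\<Sum>\<omega>\<in>\<Omega>. (w \<omega>)^2 * ln ((w \<omega>)^2)) + S * ln S * real q"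
    by (simp add: sum.distrib normw flip: sum_distrib_left)
  moreover have "(\<Sum>\<omega>\<in>\<Omega>. u \<omega>) = s * (\<Sum>\<omega>\<in>\<Omega>. w \<omega>)" by (simp add: w sum_distrib_left)
  ultimately show ?thesis unfolding S_def[symmetric] using \<Omega> s(2)
    by (simp add: add_divide_distrib power_mult_distrib power_divide algebra_simps)
qed

subsection \<open>Blei's inequality for unordered index sets\<close>

lemma Hoelder_sum:
  fixes X Y :: "'a \<Rightarrow> real"
  assumes A: "finite A" and X: "\<And>i. i \<in> A \<Longrightarrow> X i \<ge> 0" and Y: "\<And>i. i \<in> A \<Longrightarrow> Y i \<ge> 0"
    and ab: "0 < \<alpha>" "0 < \<beta>" "\<alpha> + \<beta> = 1"
  shows "(\<Sum>i\<in>A. X i powr \<alpha> * Y i powr \<beta>) \<le> (\<Sum>i\<in>A. X i) powr \<alpha> * (\<Sum>i\<in>A. Y i) powr \<beta>"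
proof (cases "(\<Sum>i\<in>A. X i) = 0 \<or> (\<Sum>i\<in>A. Y i) = 0")
  case True
  then have "(\<forall>i\<in>A. X i = 0) \<or> (\<forall>i\<in>A. Y i = 0)"
    using A X Y by (simp add: sum_nonneg_eq_0_iff)
  then have "(\<Sum>i\<in>A. X i powr \<alpha> * Y i powr \<beta>) = 0" by (intro sum.neutral) auto
  then show ?thesis by simp
next
  case False
  define SX where "SX = (\<Sum>i\<in>A. X i)"
  define SY where "SY = (\<Sum>i\<in>A. Y i)"
  have pos: "SX > 0" "SY > 0" using False X Y unfolding SX_def SY_def by (simp_all add: less_le sum_nonneg)
  have "X i powr \<alpha> * Y i powr \<beta> \<le> SX powr \<alpha> * SY powr \<beta> * (\<alpha> * (X i / SX) + \<beta> * (Y i / SY))" if i: "i \<in> A" for i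
  proof (cases "X i = 0 \<or> Y i = 0")
    case True
    then show ?thesis using X[OF i] Y[OF i] pos ab by (auto intro!: mult_nonneg_nonneg add_nonneg_nonneg)
  next
    case False
    then have p: "X i > 0" "Y i > 0" using X[OF i] Y[OF i] by auto
    have "(X i / SX) powr \<alpha> * (Y i / SY) powr \<beta> \<le> \<alpha> * (X i / SX) + \<beta> * (Y i / SY)"
      using Youngs_inequality_0[of \<alpha> \<beta> "X i / SX" "Y i / SY"] ab p pos by simp
    then have "SX powr \<alpha> * SY powr \<beta> * ((X i / SX) powr \<alpha> * (Y i / SY) powr \<beta>)
        \<le> SX powr \<alpha> * SY powr \<beta> * (\<alpha> * (X i / SX) + \<beta> * (Y i / SY))"
      by (intro mult_left_mono) auto
    moreover have "SX powr \<alpha> * SY powr \<beta> * ((X i / SX) powr \<alpha> * (Y i / SY) powr \<beta>) = X i powr \<alpha> * Y i powr \<beta>"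
      using p pos by (simp add: powr_divide)
    ultimately show ?thesis by simp
  qed
  then have "(\<Sum>i\<in>A. X i powr \<alpha> * Y i powr \<beta>)
      \<le> (\<Sum>i\<in>A. SX powr \<alpha> * SY powr \<beta> * (\<alpha> * (X i / SX) + \<beta> * (Y i / SY)))"
    by (rule sum_mono)
  also have "\<dots> = SX powr \<alpha> * SY powr \<beta> * (\<alpha> * ((\<Sum>i\<in>A. X i) / SX) + \<beta> * ((\<Sum>i\<in>A. Y i) / SY))"
    by (simp add: sum.distrib flip: sum_distrib_left sum_divide_distrib)
  also have "\<dots> = SX powr \<alpha> * SY powr \<beta>" using pos ab unfolding SX_def[symmetric] SY_def[symmetric] by simp
  finally show ?thesis unfolding SX_def SY_def .
qed

definition ksubsets :: "'a set \<Rightarrow> nat \<Rightarrow> 'a set set" where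
  "ksubsets V n = {T. T \<subseteq> V \<and> card T = n}"

lemma finite_ksubsets [simp]: "finite V \<Longrightarrow> finite (ksubsets V n)"
  unfolding ksubsets_def by simp

lemma ksubsetsD:
  "finite V \<Longrightarrow> T \<in> ksubsets V n \<Longrightarrow> finite T" "T \<in> ksubsets V n \<Longrightarrow> T \<subseteq> V" "T \<in> ksubsets V n \<Longrightarrow> card T = n"
  unfolding ksubsets_def by (auto intro: finite_subset)

lemma sum_ksubsets_insert:
  fixes F :: "'a set \<Rightarrow> 'b::comm_monoid_add"
  assumes "finite V" "t \<notin> V"
  shows "(\<Sum>T\<in>ksubsets (insert t V) (Suc n). F T) = (\<Sum>T\<in>ksubsets V (Suc n). F T) + (\<Sum>T\<in>ksubsets V n. F (insert t T))"
proof -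
  have "ksubsets (insert t V) (Suc n) = ksubsets V (Suc n) \<union> insert t ` ksubsets V n"
  proof (intro equalityI subsetI)
    fix T assume T: "T \<in> ksubsets (insert t V) (Suc n)"
    show "T \<in> ksubsets V (Suc n) \<union> insert t ` ksubsets V n"
    proof (cases "t \<in> T")
      case True
      then have "T = insert t (T - {t})" "T - {t} \<in> ksubsets V n"
        using T by (auto simp: ksubsets_def)
      then show ?thesis by blast
    next
      case False
      then show ?thesis using T by (auto simp: ksubsets_def)
    qed
  next
    fix T assume "T \<in> ksubsets V (Suc n) \<union> insert t ` ksubsets V n"
    then show "T \<in> ksubsets (insert t V) (Suc n)"
      using assms by (auto simp: ksubsets_def card_insert_if finite_subset)
  qed
  moreover have "ksubsets V (Suc n) \<inter> insert t ` ksubsets V n = {}"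
    using assms by (auto simp: ksubsets_def)
  moreover have "inj_on (insert t) (ksubsets V n)"
    using assms by (intro inj_onI) (auto simp: ksubsets_def)
  ultimately show ?thesis using assms by (simp add: sum.union_disjoint sum.reindex)
qed

text \<open>Induction on the ground set for fixed \<open>n\<close>. Sets avoiding the new point
  \<open>t\<close> fall under the induction hypothesis, sets containing it under assumption
  \<open>B\<close>; both bounds carry the factor \<open>H powr (1/n)\<close>, so they add up to at
  most \<open>(H + A) powr (1 + 1/n)\<close>.\<close>

lemma loomis_whitney_ksubsets_step:
  fixes h :: "'a set \<Rightarrow> real"
  assumes V: "finite V" and n: "n \<ge> 1" and h: "\<And>R. h R \<ge> 0"
    and B: "\<And>V t. finite V \<Longrightarrow> t \<notin> V \<Longrightarrow> (\<Sum>T\<in>ksubsets V n. h T * (\<Prod>l\<in>T. h (insert t (T - {l}))))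
        \<le> (\<Sum>R\<in>ksubsets V n. h R ^ n) powr (1 / real n) * (\<Sum>R\<in>ksubsets V (n-1). h (insert t R) ^ n)"
  shows "(\<Sum>T\<in>ksubsets V (Suc n). \<Prod>l\<in>T. h (T - {l})) \<le> (\<Sum>R\<in>ksubsets V n. h R ^ n) powr ((real n + 1) / real n)"
  using V
proof (induction V rule: finite_induct)
  case empty
  have "ksubsets {} (Suc n) = ({} :: 'a set set)" by (auto simp: ksubsets_def)
  then show ?case by simp
next
  case (insert t V)
  note V = \<open>finite V\<close> \<open>t \<notin> V\<close>
  define H where "H = (\<Sum>R\<in>ksubsets V n. h R ^ n)"
  define A where "A = (\<Sum>R\<in>ksubsets V (n-1). h (insert t R) ^ n)"
  have HA: "H \<ge> 0" "A \<ge> 0" unfolding H_def A_def using h by (auto intro!: sum_nonneg)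
  have e: "(\<Prod>l\<in>insert t T. h (insert t T - {l})) = h T * (\<Prod>l\<in>T. h (insert t (T - {l})))" if "T \<in> ksubsets V n" for T
  proof -
    have T: "finite T" "t \<notin> T" using that V by (auto simp: ksubsets_def finite_subset)
    have "insert t T - {l} = insert t (T - {l})" if "l \<in> T" for l using that T by auto
    then have "(\<Prod>l\<in>T. h (insert t T - {l})) = (\<Prod>l\<in>T. h (insert t (T - {l})))" by (intro prod.cong) auto
    moreover have "insert t T - {t} = T" using T by auto
    ultimately show ?thesis using T by simp
  qed
  have pw: "x powr ((real n + 1) / real n) = x powr (1 / real n) * x" if "x \<ge> 0" for x
  proof -
    have "(real n + 1) / real n = 1 / real n + 1" using n by (simp add: field_simps)
    then show ?thesis using that by (simp only: powr_add) simp
  qed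
  have "(\<Sum>T\<in>ksubsets (insert t V) (Suc n). \<Prod>l\<in>T. h (T - {l}))
    = (\<Sum>T\<in>ksubsets V (Suc n). \<Prod>l\<in>T. h (T - {l})) + (\<Sum>T\<in>ksubsets V n. h T * (\<Prod>l\<in>T. h (insert t (T - {l}))))"
    unfolding sum_ksubsets_insert[OF V] by (simp add: e)
  also have "\<dots> \<le> H powr (1 / real n) * H + H powr (1 / real n) * A"
    using insert.IH B[OF V] unfolding H_def[symmetric] A_def[symmetric] pw[OF HA(1)] by simp
  also have "\<dots> = H powr (1 / real n) * (H + A)" by (simp add: algebra_simps)
  also have "\<dots> \<le> (H + A) powr (1 / real n) * (H + A)"
    using HA by (intro mult_right_mono powr_mono2) auto
  also have "\<dots> = (H + A) powr ((real n + 1) / real n)" using HA by (simp add: pw)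
  also have "H + A = (\<Sum>R\<in>ksubsets (insert t V) n. h R ^ n)"
    using sum_ksubsets_insert[OF V, of "\<lambda>R. h R ^ n" "n-1"] n unfolding H_def A_def by simp
  finally show ?case .
qed

lemma ksubsets_0: "finite V \<Longrightarrow> ksubsets V 0 = {{}}"
  by (auto simp: ksubsets_def finite_subset)

text \<open>An unordered discrete Loomis-Whitney inequality, by an outer induction on
  \<open>n\<close> and an inner one on \<open>V\<close>. For the sets containing the new point,
  Hoelder with weights \<open>1/(n+1)\<close> and \<open>n/(n+1)\<close> (here for the step from
  \<open>n\<close> to \<open>Suc n\<close>) separates \<open>h T\<close> from the other factors;
  these form an instance of level \<open>n\<close> for a power of
  \<open>h (insert t R)\<close>.\<close>

lemma loomis_whitney_ksubsets:
  fixes h :: "'a set \<Rightarrow> real"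
  assumes "n \<ge> 1" "finite V" "\<And>R. h R \<ge> 0"
  shows "(\<Sum>T\<in>ksubsets V (Suc n). \<Prod>l\<in>T. h (T - {l})) \<le> (\<Sum>R\<in>ksubsets V n. h R ^ n) powr ((real n + 1) / real n)"
  using assms
proof (induction n arbitrary: V h rule: nat_induct_at_least)
  case (base V h)
  show ?case
  proof (rule loomis_whitney_ksubsets_step[OF base(1) _ base(2)])
    fix V :: "'a set" and t assume V: "finite V" "t \<notin> V"
    have "(\<Sum>T\<in>ksubsets V 1. h T * (\<Prod>l\<in>T. h (insert t (T - {l})))) = (\<Sum>T\<in>ksubsets V 1. h T * h {t})"
    proof (intro sum.cong refl)
      fix T assume "T \<in> ksubsets V 1"
      then obtain l where "T = {l}" by (auto simp: ksubsets_def card_1_singleton_iff)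
      then show "h T * (\<Prod>l\<in>T. h (insert t (T - {l}))) = h T * h {t}" by simp
    qed
    then show "(\<Sum>T\<in>ksubsets V 1. h T * (\<Prod>l\<in>T. h (insert t (T - {l}))))
        \<le> (\<Sum>R\<in>ksubsets V 1. h R ^ 1) powr (1 / real 1) * (\<Sum>R\<in>ksubsets V (1-1). h (insert t R) ^ 1)"
      using V base(2) by (simp add: ksubsets_0 sum_nonneg flip: sum_distrib_right)
  qed simp
next
  case (Suc n V h)
  show ?case
  proof (rule loomis_whitney_ksubsets_step[OF Suc.prems(1) _ Suc.prems(2)])
    fix V :: "'a set" and t assume V: "finite V" "t \<notin> V"
    have n: "n \<ge> 1" by fact
    define N where "N = real n"
    have N: "N \<ge> 1" using n by (simp add: N_def)
    define P where "P = (\<lambda>T. \<Prod>l\<in>T. h (insert t (T - {l})))"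
    have P0: "P T \<ge> 0" for T unfolding P_def using Suc.prems(2) by (intro prod_nonneg) auto
    define k where "k = (\<lambda>R. h (insert t R) powr ((N+1)/N))"
    have k0: "k R \<ge> 0" for R by (simp add: k_def)
    have kpow: "k R ^ n = h (insert t R) ^ Suc n" for R
    proof (cases "h (insert t R) = 0")
      case True
      then show ?thesis using n by (simp add: k_def)
    next
      case False
      then have "h (insert t R) > 0" using Suc.prems(2) by (simp add: less_le)
      then have "k R ^ n = (h (insert t R) powr ((N+1)/N)) powr real n" by (simp add: k_def powr_realpow)
      also have "\<dots> = h (insert t R) powr real (Suc n)" using N by (simp add: powr_powr N_def add.commute)
      also have "\<dots> = h (insert t R) ^ Suc n" by (rule powr_realpow) fact
      finally show ?thesis .
    qed
    have Pk: "P T powr ((N+1)/N) = (\<Prod>l\<in>T. k (T - {l}))" if "T \<in> ksubsets V (Suc n)" for T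
      unfolding P_def k_def by (rule prod_powr_distrib)
    define A where "A = (\<Sum>R\<in>ksubsets V n. h (insert t R) ^ Suc n)"
    have A0: "A \<ge> 0" unfolding A_def using Suc.prems(2) by (intro sum_nonneg) auto
    have "(\<Sum>T\<in>ksubsets V (Suc n). h T * P T)
      = (\<Sum>T\<in>ksubsets V (Suc n). (h T ^ Suc n) powr (1/(N+1)) * (P T powr ((N+1)/N)) powr (N/(N+1)))"
    proof (intro sum.cong refl arg_cong2[where f = "(*)"])
      fix T
      show "h T = (h T ^ Suc n) powr (1/(N+1))"
      proof (cases "h T = 0")
        case False
        then have "h T > 0" using Suc.prems(2) by (simp add: less_le)
        then have "h T ^ Suc n = h T powr (N+1)" by (simp add: powr_add N_def powr_realpow)
        then show ?thesis using \<open>h T > 0\<close> N by (simp add: powr_powr)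
      qed simp
      show "P T = (P T powr ((N+1)/N)) powr (N/(N+1))"
        using P0 N by (simp add: powr_powr)
    qed
    also have "\<dots> \<le> (\<Sum>T\<in>ksubsets V (Suc n). h T ^ Suc n) powr (1/(N+1))
        * (\<Sum>T\<in>ksubsets V (Suc n). P T powr ((N+1)/N)) powr (N/(N+1))"
      by (rule Hoelder_sum) (use V N Suc.prems(2) in \<open>auto simp: field_simps\<close>)
    also have "(\<Sum>T\<in>ksubsets V (Suc n). P T powr ((N+1)/N)) powr (N/(N+1)) \<le> A"
    proof -
      have "(\<Sum>T\<in>ksubsets V (Suc n). P T powr ((N+1)/N)) = (\<Sum>T\<in>ksubsets V (Suc n). \<Prod>l\<in>T. k (T - {l}))"
        by (intro sum.cong refl Pk)
      also have "\<dots> \<le> (\<Sum>R\<in>ksubsets V n. k R ^ n) powr ((real n + 1) / real n)"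
        by (rule Suc.IH[OF V(1) k0])
      also have "\<dots> = A powr ((N+1)/N)" by (simp only: kpow A_def N_def)
      finally have "(\<Sum>T\<in>ksubsets V (Suc n). P T powr ((N+1)/N)) powr (N/(N+1)) \<le> (A powr ((N+1)/N)) powr (N/(N+1))"
        using N by (intro powr_mono2) (auto intro!: sum_nonneg)
      also have "\<dots> = A" using A0 N by (simp add: powr_powr)
      finally show ?thesis .
    qed
    finally show "(\<Sum>T\<in>ksubsets V (Suc n). h T * (\<Prod>l\<in>T. h (insert t (T - {l}))))
        \<le> (\<Sum>R\<in>ksubsets V (Suc n). h R ^ Suc n) powr (1 / real (Suc n)) * (\<Sum>R\<in>ksubsets V (Suc n - 1). h (insert t R) ^ Suc n)"
      unfolding P_def A_def N_def by (simp add: mult_left_mono add.commute)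
  qed simp
qed

lemma sum_ksubsets_Suc_pairs:
  fixes F :: "'a \<Rightarrow> 'a set \<Rightarrow> 'b::comm_monoid_add"
  assumes "finite V"
  shows "(\<Sum>T\<in>ksubsets V (Suc n). \<Sum>l\<in>T. F l (T - {l})) = (\<Sum>R\<in>ksubsets V n. \<Sum>t\<in>V - R. F t R)"
proof -
  have "(\<Sum>T\<in>ksubsets V (Suc n). \<Sum>l\<in>T. F l (T - {l})) = (\<Sum>(T,l)\<in>(SIGMA T:ksubsets V (Suc n). T). F l (T - {l}))"
    by (rule sum.Sigma) (use assms ksubsetsD in auto)
  also have "\<dots> = (\<Sum>(R,t)\<in>(SIGMA R:ksubsets V n. V - R). F t R)"
    by (rule sum.reindex_bij_witness[where j = "\<lambda>(T,l). (T - {l}, l)" and i = "\<lambda>(R,t). (insert t R, t)"])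
      (use assms in \<open>auto simp: ksubsets_def card_insert_if finite_subset insert_absorb\<close>)
  also have "\<dots> = (\<Sum>R\<in>ksubsets V n. \<Sum>t\<in>V - R. F t R)"
    by (rule sum.Sigma[symmetric]) (use assms in auto)
  finally show ?thesis .
qed

lemma bh_exponent_pos: "d \<ge> 1 \<Longrightarrow> bh_exponent d > 0"
  by (simp add: bh_exponent_def)

text \<open>Hoelder with weights \<open>g(T - l)\<close>; the second factor is handled by the discrete Loomis--Whitney inequality,
  and averaging over the \<open>n + 1\<close> elements of \<open>T\<close> produces the gain \<open>1 / sqrt (n + 1)\<close>.\<close>

lemma blei_one_step:
  fixes b :: "'a set \<Rightarrow> real"
  assumes V: "finite V" and n: "n \<ge> 1" and b: "\<And>T. b T \<ge> 0"
    and g: "\<And>R. g R = sqrt (\<Sum>t\<in>V - R. (b (insert t R))^2)"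
    and L: "L \<ge> 0" and G: "(\<Sum>R\<in>ksubsets V n. g R powr bh_exponent n) \<le> L powr bh_exponent n"
  shows "(\<Sum>T\<in>ksubsets V (Suc n). b T powr bh_exponent (Suc n)) \<le> (L / sqrt (real (Suc n))) powr bh_exponent (Suc n)"
proof -
  define m where "m = real n + 1"
  have m: "m \<ge> 2" "real n = m - 1" "real (Suc n) = m" using n by (auto simp: m_def)
  \<comment> \<open>With this weight \<open>2 - \<theta>\<close> and \<open>n * \<theta>\<close> are
    both equal to \<open>bh_exponent n\<close>, so the two Hoelder factors reduce to the same sum
    \<open>S\<close>.\<close>
  define \<theta> where "\<theta> = 2/m"
  have pm: "bh_exponent (Suc n) = 2*m/(m+1)" and pn: "bh_exponent n = 2*(m-1)/m"
    unfolding bh_exponent_def m by (auto simp: m_def)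
  have g0: "g R \<ge> 0" for R unfolding g by (simp add: sum_nonneg)
  have g2: "(g R)^2 = (\<Sum>t\<in>V - R. (b (insert t R))^2)" for R unfolding g by (simp add: sum_nonneg)
  define X where "X = (\<lambda>T. (\<Sum>l\<in>T. (b T)^2 * g (T - {l}) powr (-\<theta>)) / m)"
  define Y where "Y = (\<lambda>T. \<Prod>l\<in>T. g (T - {l}) powr \<theta>)"
  have X0: "X T \<ge> 0" for T unfolding X_def using m by (auto intro!: divide_nonneg_nonneg sum_nonneg)
  have Y0: "Y T \<ge> 0" for T unfolding Y_def by (auto intro!: prod_nonneg)
  have pointwise: "b T powr bh_exponent (Suc n) \<le> X T powr (m/(m+1)) * Y T powr (1/(m+1))"
    if T: "T \<in> ksubsets V (Suc n)" for T
  proof (cases "b T = 0")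
    case True
    then show ?thesis using X0 Y0 by simp
  next
    case False
    then have bpos: "b T > 0" using b by (simp add: less_le)
    have fT: "finite T" "T \<subseteq> V" "real (card T) = m" "T \<noteq> {}"
      using T V m by (auto simp: ksubsets_def finite_subset)
    have gpos: "g (T - {l}) > 0" if l: "l \<in> T" for l
    proof -
      have "(b (insert l (T - {l})))^2 \<le> (\<Sum>t\<in>V - (T - {l}). (b (insert t (T - {l})))^2)"
        using V l fT by (intro member_le_sum) auto
      then have "(b T)^2 \<le> (g (T - {l}))^2" unfolding g2 using l by (simp add: insert_absorb)
      moreover have "0 < (b T)^2" using bpos by simp
      ultimately have "0 < (g (T - {l}))^2" by linarith
      then show ?thesis using g0 by (simp add: zero_less_power2 less_le)
    qed
    have Ypos: "Y T > 0" unfolding Y_def by (intro prod_pos) (metis gpos powr_gt_zero less_irrefl)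
    \<comment> \<open>The arithmetic-geometric mean inequality over the \<open>m\<close> elements of
      \<open>T\<close>; the division by \<open>m\<close> in the mean is the source of the
      gain.\<close>
    have "(\<Prod>l\<in>T. (b T)^2 * g (T - {l}) powr (-\<theta>)) powr (1/m) \<le> (\<Sum>l\<in>T. (b T)^2 * g (T - {l}) powr (-\<theta>) / m)"
      using arith_geom_mean[of T "\<lambda>l. (b T)^2 * g (T - {l}) powr (-\<theta>)"] fT by simp
    also have "\<dots> = X T" by (simp add: X_def sum_divide_distrib)
    also have "(\<Prod>l\<in>T. (b T)^2 * g (T - {l}) powr (-\<theta>)) = ((b T)^2) powr m * inverse (Y T)"
    proof -
      have "(\<Prod>l\<in>T. g (T - {l}) powr (-\<theta>)) = inverse (Y T)"
        unfolding Y_def by (simp add: powr_minus prod_inversef[unfolded o_def])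
      moreover have "((b T)^2) powr m = ((b T)^2) ^ card T"
        unfolding fT(3)[symmetric] by (rule powr_realpow) (use bpos in simp)
      ultimately show ?thesis by (simp add: prod.distrib)
    qed
    also have "(((b T)^2) powr m * inverse (Y T)) powr (1/m) = (b T)^2 * Y T powr (-1/m)"
    proof -
      have "(inverse (Y T)) powr (1/m) = Y T powr (-1/m)"
        using powr_minus[of "Y T" "1/m"] Ypos by (simp add: inverse_powr)
      moreover have "(((b T)^2) powr m) powr (1/m) = (b T)^2" using m bpos by (simp add: powr_powr)
      moreover have "(((b T)^2) powr m * inverse (Y T)) powr (1/m) = (((b T)^2) powr m) powr (1/m) * (inverse (Y T)) powr (1/m)"
        by (rule powr_mult)
      ultimately show ?thesis by simp
    qed
    finally have "((b T)^2 * Y T powr (-1/m)) powr (m/(m+1)) \<le> X T powr (m/(m+1))"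
      using m by (intro powr_mono2) auto
    moreover have "((b T)^2 * Y T powr (-1/m)) powr (m/(m+1)) = b T powr (2*m/(m+1)) * Y T powr (-1/(m+1))"
    proof -
      have "(b T)^2 = b T powr 2" using bpos by simp
      then have "((b T)^2) powr (m/(m+1)) = b T powr (2*m/(m+1))" by (simp only: powr_powr times_divide_eq_right)
      then show ?thesis using Ypos bpos m by (simp add: powr_mult powr_powr)
    qed
    ultimately have "b T powr (2*m/(m+1)) * Y T powr (-1/(m+1)) * Y T powr (1/(m+1)) \<le> X T powr (m/(m+1)) * Y T powr (1/(m+1))"
      by (intro mult_right_mono) auto
    moreover have "Y T powr (-1/(m+1)) * Y T powr (1/(m+1)) = 1"
      using Ypos by (simp flip: powr_add)
    ultimately show ?thesis unfolding pm by (simp add: mult.assoc)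
  qed
  define S where "S = (\<Sum>R\<in>ksubsets V n. g R powr bh_exponent n)"
  have S0: "S \<ge> 0" unfolding S_def by (intro sum_nonneg) auto
  have SX: "(\<Sum>T\<in>ksubsets V (Suc n). X T) = S / m"
  proof -
    have "(\<Sum>T\<in>ksubsets V (Suc n). \<Sum>l\<in>T. (b T)^2 * g (T - {l}) powr (-\<theta>))
        = (\<Sum>T\<in>ksubsets V (Suc n). \<Sum>l\<in>T. (b (insert l (T - {l})))^2 * g (T - {l}) powr (-\<theta>))"
      by (intro sum.cong refl) (simp add: insert_absorb)
    also have "\<dots> = (\<Sum>R\<in>ksubsets V n. \<Sum>t\<in>V - R. (b (insert t R))^2 * g R powr (-\<theta>))"
      by (rule sum_ksubsets_Suc_pairs[OF V])
    also have "\<dots> = (\<Sum>R\<in>ksubsets V n. (g R)^2 * g R powr (-\<theta>))"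
      by (simp add: g2 sum_distrib_right)
    also have "\<dots> = S" unfolding S_def
    proof (intro sum.cong refl)
      fix R
      have "2 - \<theta> = bh_exponent n" unfolding pn \<theta>_def using m by (simp add: field_simps)
      moreover have "(g R)^2 * g R powr (-\<theta>) = g R powr (2 - \<theta>)"
        using g0[of R] by (cases "g R = 0") (auto simp: powr_diff powr_minus divide_inverse)
      ultimately show "(g R)^2 * g R powr (-\<theta>) = g R powr bh_exponent n" by simp
    qed
    finally show ?thesis unfolding X_def by (simp flip: sum_divide_distrib)
  qed
  have SY: "(\<Sum>T\<in>ksubsets V (Suc n). Y T) \<le> S powr (m/(m-1))"
  proof -
    have "(\<Sum>T\<in>ksubsets V (Suc n). Y T) \<le> (\<Sum>R\<in>ksubsets V n. (g R powr \<theta>) ^ n) powr ((real n + 1) / real n)"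
      unfolding Y_def by (rule loomis_whitney_ksubsets[OF n V, of "\<lambda>R. g R powr \<theta>"]) simp
    also have "(\<Sum>R\<in>ksubsets V n. (g R powr \<theta>) ^ n) = S" unfolding S_def
    proof (intro sum.cong refl)
      fix R
      show "(g R powr \<theta>) ^ n = g R powr bh_exponent n"
      proof (cases "g R = 0")
        case False
        then have "(g R powr \<theta>) ^ n = (g R powr \<theta>) powr real n" by (intro powr_realpow[symmetric]) (use g0[of R] in simp)
        also have "\<dots> = g R powr bh_exponent n" unfolding pn m(2) by (simp add: powr_powr \<theta>_def)
        finally show ?thesis .
      qed (use n in simp)
    qed
    finally show ?thesis unfolding m(2) by simp
  qed
  have "(\<Sum>T\<in>ksubsets V (Suc n). b T powr bh_exponent (Suc n))
      \<le> (\<Sum>T\<in>ksubsets V (Suc n). X T powr (m/(m+1)) * Y T powr (1/(m+1)))"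
    by (intro sum_mono pointwise)
  also have "\<dots> \<le> (\<Sum>T\<in>ksubsets V (Suc n). X T) powr (m/(m+1)) * (\<Sum>T\<in>ksubsets V (Suc n). Y T) powr (1/(m+1))"
    by (rule Hoelder_sum) (use V X0 Y0 m in \<open>auto simp: field_simps\<close>)
  also have "\<dots> \<le> (S/m) powr (m/(m+1)) * (S powr (m/(m-1))) powr (1/(m+1))"
    unfolding SX using SY m Y0 by (intro mult_left_mono powr_mono2) (auto intro!: sum_nonneg)
  also have "\<dots> = S powr (m/(m+1)*(m/(m-1))) * m powr (-(m/(m+1)))"
  proof -
    have "m/(m+1)*(m/(m-1)) = m/(m+1) + m/(m-1)*(1/(m+1))"
      using m(1) by (simp add: divide_simps) (simp add: algebra_simps)
    then have "S powr (m/(m+1)*(m/(m-1))) = S powr (m/(m+1)) * (S powr (m/(m-1))) powr (1/(m+1))"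
      by (simp only: powr_add powr_powr)
    then show ?thesis using S0 m by (simp add: powr_divide powr_minus_divide)
  qed
  also have "S powr (m/(m+1)*(m/(m-1))) \<le> (L powr bh_exponent n) powr (m/(m+1)*(m/(m-1)))"
    using G S0 m unfolding S_def by (intro powr_mono2) auto
  also have "(L powr bh_exponent n) powr (m/(m+1)*(m/(m-1))) = L powr (2*m/(m+1))"
  proof -
    have "2*(m-1)/m * (m/(m+1)*(m/(m-1))) = 2*m/(m+1)" using m(1) by (simp add: divide_simps)
    then show ?thesis unfolding powr_powr pn by simp
  qed
  also have "L powr (2*m/(m+1)) * m powr (-(m/(m+1))) = (L / sqrt m) powr (2*m/(m+1))"
  proof -
    have "sqrt m powr (2*m/(m+1)) = m powr (m/(m+1))"
      using m by (simp add: powr_half_sqrt[symmetric] powr_powr)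
    then show ?thesis using L m by (simp add: powr_divide powr_minus_divide)
  qed
  finally show ?thesis unfolding pm m(3) by (simp add: mult_right_mono)
qed

text \<open>With the weights \<open>1 / (m choose j)\<close> the gain in the one-step inequality compensates the
  overcounting exactly, so the iteration loses nothing.\<close>

lemma blei_ksubsets:
  fixes a :: "'a set \<Rightarrow> real"
  assumes V: "finite V" and km: "1 \<le> k" "k \<le> m" and a: "\<And>T. a T \<ge> 0" and L: "L \<ge> 0"
    and k: "(\<Sum>T\<in>ksubsets V k. sqrt (\<Sum>A\<in>{A\<in>ksubsets V m. T \<subseteq> A}. (a A)^2) powr bh_exponent k) \<le> L powr bh_exponent k"
  shows "(\<Sum>A\<in>ksubsets V m. a A powr bh_exponent m) \<le> L powr bh_exponent m"
proof -
  define s where "s = (\<lambda>T. \<Sum>A\<in>{A\<in>ksubsets V m. T \<subseteq> A}. (a A)^2)"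
  have s0: "s T \<ge> 0" for T unfolding s_def by (simp add: sum_nonneg)
  define b where "b = (\<lambda>j T. sqrt (s T / real (m choose j)))"
  have b0: "b j T \<ge> 0" for j T unfolding b_def using s0 by simp
  have "(\<Sum>T\<in>ksubsets V j. b j T powr bh_exponent j) \<le> L powr bh_exponent j" if "k \<le> j" "j \<le> m" for j
    using that
  proof (induction j rule: dec_induct)
    case base
    have "(\<Sum>T\<in>ksubsets V k. b k T powr bh_exponent k) \<le> (\<Sum>T\<in>ksubsets V k. sqrt (s T) powr bh_exponent k)"
    proof (intro sum_mono powr_mono2)
      fix T
      \<comment> \<open>At the starting level the weight is simply discarded; exactness matters only
        at the last level, where \<open>m choose m = 1\<close>.\<close>
      have "real (m choose k) \<ge> 1" using km by (simp add: Suc_leI)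
      moreover have "x / c \<le> x" if "c \<ge> 1" "x \<ge> 0" for x c :: real
        using divide_left_mono[of 1 c x] that by simp
      ultimately have "s T / real (m choose k) \<le> s T" using s0 by blast
      then show "b k T \<le> sqrt (s T)" unfolding b_def by simp
    qed (use b0 km bh_exponent_pos[of k] in auto)
    then show ?case using k unfolding s_def by linarith
  next
    case (step j)
    have j: "1 \<le> j" "j < m" using step km by auto
    have g: "sqrt (real (Suc j)) * b j R = sqrt (\<Sum>t\<in>V - R. (b (Suc j) (insert t R))^2)" if R: "R \<in> ksubsets V j" for R
    proof -
      have "(\<Sum>t\<in>V - R. s (insert t R)) = (\<Sum>t\<in>V - R. \<Sum>A\<in>ksubsets V m. if insert t R \<subseteq> A then (a A)^2 else 0)"
        unfolding s_def using V by (simp add: sum.inter_filter)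
      also have "\<dots> = (\<Sum>A\<in>ksubsets V m. \<Sum>t\<in>V - R. if insert t R \<subseteq> A then (a A)^2 else 0)"
        by (rule sum.swap)
      also have "\<dots> = (\<Sum>A\<in>ksubsets V m. if R \<subseteq> A then real (m - j) * (a A)^2 else 0)"
      proof (intro sum.cong refl)
        fix A assume A: "A \<in> ksubsets V m"
        show "(\<Sum>t\<in>V - R. if insert t R \<subseteq> A then (a A)^2 else 0) = (if R \<subseteq> A then real (m - j) * (a A)^2 else 0)"
        proof (cases "R \<subseteq> A")
          case True
          have "{t \<in> V - R. insert t R \<subseteq> A} = A - R" using True A by (auto simp: ksubsets_def)
          moreover have "card (A - R) = m - j" using True A R V by (subst card_Diff_subset) (auto simp: ksubsets_def finite_subset)
          ultimately show ?thesis using True V by (simp add: sum.inter_filter[symmetric])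
        qed simp
      qed
      also have "\<dots> = real (m - j) * s R"
        unfolding s_def using V by (simp add: sum.inter_filter[symmetric] sum_distrib_left)
      finally have 1: "(\<Sum>t\<in>V - R. s (insert t R)) = real (m - j) * s R" .
      have "(\<Sum>t\<in>V - R. (b (Suc j) (insert t R))^2) = (\<Sum>t\<in>V - R. s (insert t R)) / real (m choose Suc j)"
        unfolding b_def using s0 by (simp add: sum_divide_distrib)
      also have "\<dots> = real (m - j) / real (m choose Suc j) * s R" unfolding 1 by simp
      also have "real (m - j) / real (m choose Suc j) = real (Suc j) / real (m choose j)"
      proof -
        have "Suc j * (m choose Suc j) = (m - j) * (m choose j)"
          by (simp only: binomial_absorption binomial_absorb_comp)
        then have "real (Suc j) * real (m choose Suc j) = real (m - j) * real (m choose j)"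
          by (metis of_nat_mult)
        then show ?thesis using j by (simp add: field_simps)
      qed
      finally show ?thesis unfolding b_def by (simp add: real_sqrt_mult real_sqrt_divide)
    qed
    have "(\<Sum>T\<in>ksubsets V (Suc j). b (Suc j) T powr bh_exponent (Suc j))
      \<le> (sqrt (real (Suc j)) * L / sqrt (real (Suc j))) powr bh_exponent (Suc j)"
    proof (rule blei_one_step[OF V j(1) b0 refl])
      have "(\<Sum>R\<in>ksubsets V j. sqrt (\<Sum>t\<in>V - R. (b (Suc j) (insert t R))^2) powr bh_exponent j)
        = (\<Sum>R\<in>ksubsets V j. sqrt (real (Suc j)) powr bh_exponent j * b j R powr bh_exponent j)"
        using b0 by (intro sum.cong refl) (simp add: powr_mult flip: g)
      also have "\<dots> \<le> sqrt (real (Suc j)) powr bh_exponent j * L powr bh_exponent j"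
        using step j by (simp add: mult_left_mono flip: sum_distrib_left)
      also have "\<dots> = (sqrt (real (Suc j)) * L) powr bh_exponent j" using L by (simp add: powr_mult)
      finally show "(\<Sum>R\<in>ksubsets V j. sqrt (\<Sum>t\<in>V - R. (b (Suc j) (insert t R))^2) powr bh_exponent j)
        \<le> (sqrt (real (Suc j)) * L) powr bh_exponent j" .
    qed (use L in simp)
    then show ?case by simp
  qed
  from this[of m] have "(\<Sum>T\<in>ksubsets V m. b m T powr bh_exponent m) \<le> L powr bh_exponent m"
    using km by simp
  moreover have "b m A = a A" if "A \<in> ksubsets V m" for A
  proof -
    have "{B\<in>ksubsets V m. A \<subseteq> B} = {A}"
      using that V by (auto simp: ksubsets_def dest: card_subset_eq[OF finite_subset])
    then show ?thesis unfolding b_def s_def using a by simp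
  qed
  ultimately show ?thesis by simp
qed

subsection \<open>A Markov-type coefficient estimate\<close>

lemma root_q_power_eq_1_iff:
  assumes "n \<ge> 1"
  shows "root_q n ^ m = 1 \<longleftrightarrow> n dvd m"
proof -
  have "root_q n ^ m = exp (2 * of_real pi * \<i> * of_nat m / of_nat n)"
    unfolding root_q_def by (simp flip: exp_of_nat_mult) (simp add: mult_ac)
  then show ?thesis using complex_root_unity_eq_1[OF assms, of m] by simp
qed

lemma norm_root_q [simp]: "cmod (root_q n) = 1"
proof -
  have "2 * of_real pi * \<i> / of_nat n = \<i> * of_real (2 * pi / real n)" by simp
  then show ?thesis unfolding root_q_def by (simp only: norm_exp_i_times)
qed

lemma sum_root_q_powers:
  assumes "n \<ge> 1"
  shows "(\<Sum>l<n. (root_q n ^ m) ^ l) = (if n dvd m then of_nat n else 0)"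
proof (cases "n dvd m")
  case True
  then show ?thesis using root_q_power_eq_1_iff[OF assms, of m] by simp
next
  case False
  then have ne: "root_q n ^ m \<noteq> 1" using root_q_power_eq_1_iff[OF assms, of m] by simp
  have "(root_q n ^ m) ^ n = (root_q n ^ n) ^ m" by (simp add: mult.commute flip: power_mult)
  also have "\<dots> = 1" using root_q_power_eq_1_iff[OF assms, of n] by simp
  finally show ?thesis using False ne by (simp add: geometric_sum)
qed

text \<open>Cauchy's estimate without integration: a sum over \<open>degree p + 1\<close> roots of
  unity isolates one coefficient exactly. The exponent \<open>(n - k) * l\<close> plays the part of
  \<open>- k * l\<close>.\<close>

lemma norm_coeff_le_on_circle:
  fixes p :: "complex poly"
  assumes r: "r > 0" and B: "\<And>z. cmod z = r \<Longrightarrow> cmod (poly p z) \<le> B"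
  shows "cmod (coeff p k) \<le> B / r ^ k"
proof (cases "k \<le> degree p")
  case False
  have "cmod (poly p (of_real r)) \<le> B" using B r by simp
  then have "B \<ge> 0" using norm_ge_zero order_trans by blast
  then show ?thesis using False r by (simp add: coeff_eq_0)
next
  case True
  define n where "n = degree p + 1"
  have n: "n \<ge> 1" "k < n" using True by (auto simp: n_def)
  define \<omega> where "\<omega> = root_q n"
  have [simp]: "cmod \<omega> = 1" by (simp add: \<omega>_def)
  define S where "S = (\<Sum>l<n. poly p (of_real r * \<omega> ^ l) * \<omega> ^ ((n - k) * l))"
  have "S = (\<Sum>l<n. \<Sum>i\<le>degree p. coeff p i * of_real r ^ i * (\<omega> ^ (i + (n - k))) ^ l)"
    unfolding S_def poly_altdef sum_distrib_right
    by (intro sum.cong refl) (simp add: power_mult_distrib power_add algebra_simps flip: power_mult)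
  also have "\<dots> = (\<Sum>i\<le>degree p. coeff p i * of_real r ^ i * (\<Sum>l<n. (\<omega> ^ (i + (n - k))) ^ l))"
    by (subst sum.swap) (simp add: sum_distrib_left)
  also have "\<dots> = (\<Sum>i\<le>degree p. if i = k then coeff p k * of_real r ^ k * of_nat n else 0)"
  proof (intro sum.cong refl)
    fix i assume i: "i \<in> {..degree p}"
    have "n dvd (i + (n - k)) \<longleftrightarrow> i = k"
    proof
      assume "n dvd (i + (n - k))"
      then obtain c where c: "i + (n - k) = n * c" by (auto simp: dvd_def)
      have "c = 1"
      proof -
        have "0 < n * c" "n * c < n * 2" using c i n by (auto simp: n_def)
        then show ?thesis by auto
      qed
      then have "i + (n - k) = n" using c by (simp only: mult_1_right)
      then show "i = k" using n(2) by linarith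
    next
      assume "i = k" then show "n dvd (i + (n - k))" using n by simp
    qed
    then show "coeff p i * of_real r ^ i * (\<Sum>l<n. (\<omega> ^ (i + (n - k))) ^ l)
        = (if i = k then coeff p k * of_real r ^ k * of_nat n else 0)"
      unfolding \<omega>_def sum_root_q_powers[OF n(1)] by simp
  qed
  also have "\<dots> = coeff p k * of_real r ^ k * of_nat n" using True by simp
  finally have S: "S = coeff p k * of_real r ^ k * of_nat n" .
  have "cmod S \<le> (\<Sum>l<n. cmod (poly p (of_real r * \<omega> ^ l) * \<omega> ^ ((n - k) * l)))"
    unfolding S_def by (rule norm_sum)
  also have "\<dots> \<le> (\<Sum>l<n. B)"
    using r by (intro sum_mono) (simp add: norm_mult norm_power B)
  finally have "cmod (coeff p k) * r ^ k * real n \<le> B * real n"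
    unfolding S using r by (simp add: norm_mult norm_power mult.commute)
  then have "cmod (coeff p k) * r ^ k \<le> B" using n by simp
  then show ?thesis using r by (simp add: le_divide_eq)
qed

text \<open>The substitution \<open>s = - (w - 1)\<^sup>2 / (4 w)\<close> maps the unit circle onto \<open>[0, 1]\<close>; the resulting Laurent
  polynomial in \<open>w\<close> has coefficients bounded by \<open>M\<close>, which controls \<open>P\<close> near \<open>0\<close> in the complex plane.\<close>

lemma joukowski_poly_bound:
  fixes P :: "complex poly"
  assumes deg: "degree P \<le> d" and M: "\<And>s. 0 \<le> s \<Longrightarrow> s \<le> 1 \<Longrightarrow> cmod (poly P (of_real s)) \<le> M"
    and w: "cmod w \<ge> 1"
  shows "cmod (poly P (- ((w - 1)^2) / (4 * w))) \<le> (2 * real d + 1) * M * cmod w ^ d"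
proof -
  \<comment> \<open>The Laurent polynomial multiplied by \<open>w ^ d\<close>. It has degree at most
    \<open>2 * d\<close>, and its number of coefficients gives the factor
    \<open>2 * real d + 1\<close>.\<close>
  define R where "R = (\<Sum>i\<le>d. smult (coeff P i * (-1/4) ^ i) ([:-1, 1:] ^ (2*i) * monom 1 (d - i)))"
  have evR: "poly R w = w ^ d * poly P (- ((w - 1)^2) / (4 * w))" if "w \<noteq> 0" for w
  proof -
    have polyP: "poly P s = (\<Sum>i\<le>d. coeff P i * s ^ i)" for s
      unfolding poly_altdef by (rule sum.mono_neutral_left) (use deg in \<open>auto simp: coeff_eq_0\<close>)
    have summand: "coeff P i * (-1/4) ^ i * ((w - 1) ^ (2*i) * w ^ (d - i))
        = w ^ d * (coeff P i * (- ((w - 1)^2) / (4 * w)) ^ i)" if "i \<le> d" for i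
    proof -
      have "(- ((w - 1)^2) / (4 * w)) ^ i = ((-1/4) * ((w - 1)^2 / w)) ^ i" by simp
      also have "\<dots> = (-1/4) ^ i * ((w - 1) ^ (2*i) / w ^ i)"
        unfolding power_mult_distrib power_divide by (simp add: power_mult)
      finally show ?thesis using that \<open>w \<noteq> 0\<close> by (simp add: power_diff field_simps)
    qed
    have "poly R w = (\<Sum>i\<le>d. coeff P i * (-1/4) ^ i * ((w - 1) ^ (2*i) * w ^ (d - i)))"
      unfolding R_def poly_sum by (intro sum.cong refl) (simp add: poly_monom)
    also have "\<dots> = (\<Sum>i\<le>d. w ^ d * (coeff P i * (- ((w - 1)^2) / (4 * w)) ^ i))"
      by (intro sum.cong refl summand) simp
    also have "\<dots> = w ^ d * poly P (- ((w - 1)^2) / (4 * w))"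
      unfolding polyP sum_distrib_left ..
    finally show ?thesis .
  qed
  have degR: "degree R \<le> 2 * d" unfolding R_def
  proof (rule degree_sum_le)
    fix i assume i: "i \<in> {..d}"
    have "degree ([:-1, 1::complex:] ^ (2*i)) \<le> 2*i" using degree_power_le[of "[:-1, 1::complex:]" "2*i"] by simp
    then have "degree ([:-1, 1:] ^ (2*i) * monom (1::complex) (d - i)) \<le> 2*i + (d - i)"
      by (intro order_trans[OF degree_mult_le] add_mono degree_monom_le)
    also have "\<dots> \<le> 2*d" using i by simp
    finally show "degree (smult (coeff P i * (-1/4) ^ i) ([:-1, 1:] ^ (2*i) * monom 1 (d - i))) \<le> 2*d"
      using degree_smult_le order_trans by blast
  qed simp
  have circ: "cmod (poly R z) \<le> M" if z: "cmod z = 1" for z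
  proof -
    have z0: "z \<noteq> 0" using z by auto
    define t where "t = Arg z"
    have t: "z = cis t" using rcis_cmod_Arg[of z] z by (simp add: t_def rcis_def)
    have "z * cnj z = 1" using complex_norm_square[of z] z by simp
    then have iz: "inverse z = cnj z" by (rule inverse_unique)
    have "- ((z - 1)^2) / (4 * z) = (2 - (z + inverse z)) / 4"
      using z0 by (simp add: field_simps power2_eq_square)
    also have "z + inverse z = of_real (2 * cos t)"
      unfolding iz by (simp add: t complex_eq_iff)
    also have "(2 - complex_of_real (2 * cos t)) / 4 = of_real ((1 - cos t)/2)" by simp
    finally have "cmod (poly P (- ((z - 1)^2) / (4 * z))) = cmod (poly P (of_real ((1 - cos t)/2)))"
      by (simp only:)
    also have "\<dots> \<le> M" by (rule M) (use cos_le_one[of t] cos_ge_minus_one[of t] in auto)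
    finally show ?thesis by (simp only: evR[OF z0] norm_mult norm_power z power_one mult_1)
  qed
  have cR: "cmod (coeff R i) \<le> M" for i
    using norm_coeff_le_on_circle[of 1 R M i] circ by simp
  have M0: "M \<ge> 0" using cR[of 0] norm_ge_zero order_trans by blast
  have "cmod (poly R w) \<le> (\<Sum>i\<le>degree R. cmod (coeff R i * w ^ i))"
    unfolding poly_altdef by (rule norm_sum)
  also have "\<dots> \<le> (\<Sum>i\<le>degree R. M * cmod w ^ (2*d))"
    using cR M0 w degR by (intro sum_mono) (auto simp: norm_mult norm_power intro!: mult_mono power_increasing)
  also have "\<dots> = (real (degree R) + 1) * (M * cmod w ^ (2*d))" by simp
  also have "\<dots> \<le> (2 * real d + 1) * (M * cmod w ^ (2*d))"
    using degR M0 by (intro mult_right_mono) auto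
  finally have "cmod (poly R w) \<le> (2 * real d + 1) * (M * cmod w ^ (2*d))" .
  then have "cmod w ^ d * cmod (poly P (- ((w - 1)^2) / (4 * w))) \<le> (2 * real d + 1) * (M * cmod w ^ (2*d))"
  proof -
    have "w \<noteq> 0" using w by auto
    then have "cmod (poly R w) = cmod w ^ d * cmod (poly P (- ((w - 1)^2) / (4 * w)))"
      by (simp only: evR norm_mult norm_power simp_thms)
    then show ?thesis using \<open>cmod (poly R w) \<le> (2 * real d + 1) * (M * cmod w ^ (2*d))\<close>
      by linarith
  qed
  also have "\<dots> = cmod w ^ d * ((2 * real d + 1) * M * cmod w ^ d)"
  proof -
    have "cmod w ^ (2 * d) = cmod w ^ d * cmod w ^ d" by (simp only: mult_2 power_add)
    then show ?thesis by simp
  qed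
  finally have "cmod w ^ d * cmod (poly P (- ((w - 1)^2) / (4 * w))) \<le> cmod w ^ d * ((2 * real d + 1) * M * cmod w ^ d)" .
  moreover have "cmod w ^ d > 0" using w by (intro zero_less_power) linarith
  ultimately show ?thesis by simp
qed

text \<open>The equation is \<open>w^2 - 2*(1 - 2*s)*w + 1 = 0\<close>. Its two roots have product
  1, so one of them lies outside the open unit disc.\<close>

lemma joukowski_preimage:
  fixes s :: complex
  assumes "s \<noteq> 0"
  obtains w where "cmod w \<ge> 1" "s = - ((w - 1)^2) / (4 * w)"
proof -
  define h where "h = 1 - 2 * s"
  define D where "D = csqrt (h\<^sup>2 - 1)"
  have D2: "D\<^sup>2 = h\<^sup>2 - 1" unfolding D_def by (rule power2_csqrt)
  have "(h + D) * (h - D) = h\<^sup>2 - D\<^sup>2" by (simp add: algebra_simps power2_eq_square)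
  then have prod: "(h + D) * (h - D) = 1" by (simp add: D2)
  have sol: "s = - ((w - 1)^2) / (4 * w)" if "w = h + D \<or> w = h - D" "w \<noteq> 0" for w
  proof -
    have "(h + e)^2 - 2 * h * (h + e) + 1 = e\<^sup>2 - h\<^sup>2 + 1" for e
      by (simp add: power2_eq_square algebra_simps)
    from this[of D] this[of "- D"] have "w\<^sup>2 - 2 * h * w + 1 = D\<^sup>2 - h\<^sup>2 + 1"
      using that(1) by (elim disjE) simp_all
    then have "w\<^sup>2 - 2 * h * w + 1 = 0" by (simp add: D2)
    moreover have "4 * w * s + (w - 1)^2 = w\<^sup>2 - 2 * h * w + 1"
      by (simp add: h_def power2_eq_square algebra_simps)
    ultimately have "4 * w * s = - ((w - 1)^2)" by (simp only: eq_neg_iff_add_eq_0)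
    moreover have "s = (4 * w * s) / (4 * w)" using that(2) by simp
    ultimately show ?thesis by (simp only:)
  qed
  have "cmod (h + D) * cmod (h - D) = 1" unfolding norm_mult[symmetric] prod by simp
  then have "cmod (h + D) \<ge> 1 \<or> cmod (h - D) \<ge> 1"
    using mult_left_le[of "cmod (h - D)" "cmod (h + D)"] norm_ge_zero[of "h + D"]
    by (cases "cmod (h - D) \<le> 1") auto
  then obtain w where w: "w = h + D \<or> w = h - D" "cmod w \<ge> 1" by blast
  then have "w \<noteq> 0" by auto
  then show ?thesis using that[OF w(2) sol[OF w(1)]] by blast
qed

text \<open>Cauchy's estimate on the circle of radius \<open>(k/d)^2\<close>. With
  \<open>\<rho> = k/d\<close> the preimages satisfy \<open>cmod w \<le> 1 + 5 * \<rho>\<close>, so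
  the growth \<open>cmod w ^ d\<close> stays below \<open>exp (5 * k)\<close>, while dividing by the
  \<open>k\<close>-th power of the radius gives \<open>(d/k) ^ (2 * k)\<close>.\<close>

lemma coeff_bound_of_unit_interval:
  fixes P :: "complex poly"
  assumes deg: "degree P \<le> d" and M: "\<And>s. 0 \<le> s \<Longrightarrow> s \<le> 1 \<Longrightarrow> cmod (poly P (of_real s)) \<le> M"
    and k: "1 \<le> k" "k \<le> d"
  shows "cmod (coeff P k) \<le> (2 * real d + 1) * exp (5 * real k) * (real d / real k) ^ (2 * k) * M"
proof -
  have M0: "M \<ge> 0" using order_trans[OF norm_ge_zero M[of 0]] by simp
  define \<rho> where "\<rho> = real k / real d"
  have \<rho>: "0 < \<rho>" "\<rho> \<le> 1" using k by (auto simp: \<rho>_def)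
  have "cmod (coeff P k) \<le> ((2 * real d + 1) * M * exp (5 * real k)) / (\<rho>^2) ^ k"
  proof (rule norm_coeff_le_on_circle)
    fix s assume s: "cmod s = \<rho>^2"
    then have "s \<noteq> 0" using \<rho> by auto
    then obtain w where w: "cmod w \<ge> 1" "s = - ((w - 1)^2) / (4 * w)" by (rule joukowski_preimage)
    define z where "z = cmod (w - 1)"
    have wz: "cmod w \<le> 1 + z" using norm_triangle_ineq[of "w - 1" 1] by (simp add: z_def)
    have "w \<noteq> 0" using w by auto
    then have "(w - 1)^2 = - 4 * s * w" unfolding w(2) by simp
    then have "cmod ((w - 1)^2) = 4 * cmod s * cmod w" by (simp add: norm_mult)
    then have "z\<^sup>2 = 4 * \<rho>^2 * cmod w" by (simp add: z_def norm_power s)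
    also have "\<dots> \<le> 4 * \<rho>^2 * (1 + z)" using wz by (intro mult_left_mono) auto
    finally have zq: "z\<^sup>2 \<le> 4 * \<rho>^2 * (1 + z)" .
    \<comment> \<open>The quadratic inequality \<open>zq\<close> forces this because
      \<open>\<rho>^2 \<le> \<rho>\<close>: the square-root behaviour of the substitution at
      \<open>s = 0\<close>.\<close>
    have "z \<le> 5 * \<rho>"
    proof (rule ccontr)
      assume "\<not> z \<le> 5 * \<rho>"
      then have z5: "z > 5 * \<rho>" by simp
      have "\<rho>^2 \<le> \<rho>" using \<rho> by (simp add: power2_eq_square mult_left_le)
      then have "z - 4 * \<rho>^2 \<ge> \<rho>" using z5 by simp
      then have "5 * \<rho> * \<rho> \<le> z * (z - 4 * \<rho>^2)" using z5 \<rho> by (intro mult_mono) auto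
      also have "\<dots> \<le> 4 * \<rho>^2" using zq by (simp add: power2_eq_square algebra_simps)
      finally have "5 * \<rho>^2 \<le> 4 * \<rho>^2" by (simp add: power2_eq_square)
      then show False using \<rho> by simp
    qed
    then have "cmod w \<le> 1 + 5 * \<rho>" using wz by simp
    also have "\<dots> \<le> exp (5 * \<rho>)" by (rule exp_ge_add_one_self)
    finally have "cmod w ^ d \<le> exp (5 * \<rho>) ^ d" by (intro power_mono) auto
    also have "exp (5 * \<rho>) ^ d = exp (real d * (5 * \<rho>))" by (rule exp_of_nat_mult[symmetric])
    also have "real d * (5 * \<rho>) = 5 * real k" using k by (simp add: \<rho>_def)
    finally have "(2 * real d + 1) * M * cmod w ^ d \<le> (2 * real d + 1) * M * exp (5 * real k)"
      using M0 by (intro mult_left_mono) auto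
    moreover have "cmod (poly P s) \<le> (2 * real d + 1) * M * cmod w ^ d"
      unfolding w(2) by (rule joukowski_poly_bound[OF deg M w(1)])
    ultimately show "cmod (poly P s) \<le> (2 * real d + 1) * M * exp (5 * real k)" by linarith
  qed (use \<rho> in simp)
  also have "\<dots> = (2 * real d + 1) * exp (5 * real k) * (real d / real k) ^ (2 * k) * M"
  proof -
    have "real d / real k = inverse \<rho>" by (simp add: \<rho>_def)
    then have "(real d / real k) ^ (2 * k) = inverse ((\<rho>^2) ^ k)" by (simp only: power_inverse power_mult)
    then show ?thesis by (simp only: divide_inverse mult_ac)
  qed
  finally show ?thesis .
qed

subsection \<open>Tensorization and hypercontractivity\<close>

definition mean :: "'a set \<Rightarrow> ('a \<Rightarrow> 'b) \<Rightarrow> 'b::real_normed_field" where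
  "mean \<Omega> g = (\<Sum>\<omega>\<in>\<Omega>. g \<omega>) / of_nat (card \<Omega>)"

definition avg :: "'i set \<Rightarrow> 'a set \<Rightarrow> (('i \<Rightarrow> 'a) \<Rightarrow> 'b) \<Rightarrow> 'b::real_normed_field" where
  "avg J \<Omega> F = (\<Sum>x\<in>PiE J (\<lambda>_. \<Omega>). F x) / of_nat (card \<Omega>) ^ card J"

lemma mean_diff: "mean \<Omega> (\<lambda>\<omega>. f \<omega> - g \<omega>) = mean \<Omega> f - mean \<Omega> g"
  by (simp add: mean_def sum_subtractf diff_divide_distrib)

lemma mean_cmult: "mean \<Omega> (\<lambda>\<omega>. c * f \<omega>) = c * mean \<Omega> f"
  by (simp add: mean_def sum_distrib_left)

lemma mean_sum: "mean \<Omega> (\<lambda>\<omega>. \<Sum>i\<in>I. f i \<omega>) = (\<Sum>i\<in>I. mean \<Omega> (f i))"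
  unfolding mean_def by (subst sum.swap) (simp add: sum_divide_distrib)

lemma mean_const: "finite \<Omega> \<Longrightarrow> \<Omega> \<noteq> {} \<Longrightarrow> mean \<Omega> (\<lambda>_. c) = c"
  by (simp add: mean_def)

lemma mean_mono: "(\<And>\<omega>. \<omega> \<in> \<Omega> \<Longrightarrow> f \<omega> \<le> g \<omega>) \<Longrightarrow> mean \<Omega> f \<le> (mean \<Omega> g :: real)"
  unfolding mean_def by (intro divide_right_mono sum_mono) auto

lemma mean_nonneg: "(\<And>\<omega>. \<omega> \<in> \<Omega> \<Longrightarrow> 0 \<le> f \<omega>) \<Longrightarrow> 0 \<le> (mean \<Omega> f :: real)"
  unfolding mean_def by (intro divide_nonneg_nonneg sum_nonneg) auto

lemma norm_mean_le: "cmod (mean \<Omega> f) \<le> mean \<Omega> (\<lambda>\<omega>. cmod (f \<omega>))"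
  unfolding mean_def by (auto simp: norm_divide intro!: divide_right_mono norm_sum)

lemma avg_add: "avg J \<Omega> (\<lambda>x. f x + g x) = avg J \<Omega> f + avg J \<Omega> g"
  by (simp add: avg_def sum.distrib add_divide_distrib)

lemma avg_diff: "avg J \<Omega> (\<lambda>x. f x - g x) = avg J \<Omega> f - avg J \<Omega> g"
  by (simp add: avg_def sum_subtractf diff_divide_distrib)

lemma avg_cmult: "avg J \<Omega> (\<lambda>x. c * f x) = c * avg J \<Omega> f"
  by (simp add: avg_def sum_distrib_left)

lemma avg_sum: "avg J \<Omega> (\<lambda>x. \<Sum>i\<in>I. f i x) = (\<Sum>i\<in>I. avg J \<Omega> (f i))"
  unfolding avg_def by (subst sum.swap) (simp add: sum_divide_distrib)

lemma avg_mono: "(\<And>x. x \<in> PiE J (\<lambda>_. \<Omega>) \<Longrightarrow> f x \<le> g x) \<Longrightarrow> avg J \<Omega> f \<le> (avg J \<Omega> g :: real)"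
  unfolding avg_def by (intro divide_right_mono sum_mono) auto

lemma avg_nonneg: "(\<And>x. x \<in> PiE J (\<lambda>_. \<Omega>) \<Longrightarrow> 0 \<le> f x) \<Longrightarrow> 0 \<le> (avg J \<Omega> f :: real)"
  unfolding avg_def by (intro divide_nonneg_nonneg sum_nonneg) auto

lemma avg_const: "finite J \<Longrightarrow> finite \<Omega> \<Longrightarrow> \<Omega> \<noteq> {} \<Longrightarrow> avg J \<Omega> (\<lambda>_. c) = c"
  by (simp add: avg_def card_PiE)

lemma norm_avg_le: "cmod (avg J \<Omega> f) \<le> avg J \<Omega> (\<lambda>x. cmod (f x))"
  unfolding avg_def by (auto simp: norm_divide norm_power intro!: divide_right_mono norm_sum)

lemma avg_empty [simp]: "avg {} \<Omega> F = F (\<lambda>_. undefined)"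
  by (simp add: avg_def)

lemma avg_insert:
  assumes "finite J" "i \<notin> J"
  shows "avg (insert i J) \<Omega> F = avg J \<Omega> (\<lambda>y. mean \<Omega> (\<lambda>\<omega>. F (y(i := \<omega>))))"
proof -
  have "(\<Sum>x\<in>PiE (insert i J) (\<lambda>_. \<Omega>). F x) = (\<Sum>(\<omega>, y)\<in>\<Omega> \<times> PiE J (\<lambda>_. \<Omega>). F (y(i := \<omega>)))"
    unfolding PiE_insert_eq by (subst sum.reindex[OF inj_combinator[OF assms(2)]]) (simp add: case_prod_unfold)
  also have "\<dots> = (\<Sum>y\<in>PiE J (\<lambda>_. \<Omega>). \<Sum>\<omega>\<in>\<Omega>. F (y(i := \<omega>)))"
    unfolding sum.cartesian_product[symmetric] by (rule sum.swap)
  finally show ?thesis using assms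
    by (simp add: avg_def mean_def sum_divide_distrib mult.commute)
qed

lemma avg_resample:
  assumes "finite J" "i \<in> J" "finite \<Omega>" "\<Omega> \<noteq> {}"
  shows "avg J \<Omega> (\<lambda>x. mean \<Omega> (\<lambda>\<omega>. F (x(i := \<omega>)))) = avg J \<Omega> F"
proof -
  have J: "J = insert i (J - {i})" using assms by auto
  have "avg (insert i (J - {i})) \<Omega> (\<lambda>x. mean \<Omega> (\<lambda>\<omega>. F (x(i := \<omega>)))) = avg (insert i (J - {i})) \<Omega> F"
    using assms by (simp add: avg_insert mean_const del: insert_Diff_single)
  then show ?thesis using J by simp
qed

text \<open>Minkowski's integral inequality, squared: the \<open>L^2\<close> norm in
  \<open>\<eta>\<close> of an average over \<open>\<omega>\<close> is at most the average of the
  norms.\<close>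

lemma L2_minkowski_mean:
  fixes u :: "'a \<Rightarrow> 'a \<Rightarrow> real"
  assumes "finite \<Omega>" "\<And>\<omega> \<eta>. u \<omega> \<eta> \<ge> 0"
  shows "mean \<Omega> (\<lambda>\<eta>. (mean \<Omega> (\<lambda>\<omega>. u \<omega> \<eta>))^2) \<le> (mean \<Omega> (\<lambda>\<omega>. sqrt (mean \<Omega> (\<lambda>\<eta>. (u \<omega> \<eta>)^2))))^2"
proof -
  have tri: "L2_set (\<lambda>\<eta>. \<Sum>\<omega>\<in>S. u \<omega> \<eta>) \<Omega> \<le> (\<Sum>\<omega>\<in>S. L2_set (u \<omega>) \<Omega>)" if "finite S" for S
    using that
  proof (induction S rule: finite_induct)
    case empty
    then show ?case by (simp add: L2_set_def)
  next
    case (insert \<omega> S)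
    have "L2_set (\<lambda>\<eta>. u \<omega> \<eta> + (\<Sum>\<omega>\<in>S. u \<omega> \<eta>)) \<Omega> \<le> L2_set (u \<omega>) \<Omega> + L2_set (\<lambda>\<eta>. \<Sum>\<omega>\<in>S. u \<omega> \<eta>) \<Omega>"
      by (rule L2_set_triangle_ineq)
    then show ?case using insert by simp
  qed
  define q where "q = real (card \<Omega>)"
  have q0: "q \<ge> 0" by (simp add: q_def)
  have "mean \<Omega> (\<lambda>\<eta>. (mean \<Omega> (\<lambda>\<omega>. u \<omega> \<eta>))^2) = (L2_set (\<lambda>\<eta>. \<Sum>\<omega>\<in>\<Omega>. u \<omega> \<eta>) \<Omega>)^2 / q^3"
    unfolding mean_def L2_set_def q_def
    by (simp add: sum_nonneg power_divide power2_eq_square power3_eq_cube flip: sum_divide_distrib)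
  also have "\<dots> \<le> (\<Sum>\<omega>\<in>\<Omega>. L2_set (u \<omega>) \<Omega>)^2 / q^3"
    using tri[OF assms(1)] q0 by (intro divide_right_mono power_mono) auto
  also have "\<dots> = (mean \<Omega> (\<lambda>\<omega>. sqrt (mean \<Omega> (\<lambda>\<eta>. (u \<omega> \<eta>)^2))))^2"
  proof -
    have "mean \<Omega> (\<lambda>\<omega>. sqrt (mean \<Omega> (\<lambda>\<eta>. (u \<omega> \<eta>)^2))) = (\<Sum>\<omega>\<in>\<Omega>. L2_set (u \<omega>) \<Omega>) / (sqrt q * q)"
      unfolding mean_def L2_set_def by (simp add: real_sqrt_divide q_def flip: sum_divide_distrib)
    moreover have "(sqrt q * q)^2 = q^3" using q0 by (simp add: power_mult_distrib power2_eq_square power3_eq_cube)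
    ultimately show ?thesis by (simp add: power_divide)
  qed
  finally show ?thesis .
qed

text \<open>Tensorization by induction on the number of coordinates: the induction hypothesis is applied to the \<open>L\<^sup>2\<close> norm
  in the new coordinate, and Minkowski's inequality shows that this does not increase the remaining variances.\<close>

lemma log_sobolev_product:
  fixes u :: "('i \<Rightarrow> 'a) \<Rightarrow> real" and K :: real
  assumes \<Omega>: "finite \<Omega>" "card \<Omega> = q" "q \<ge> 2" and K: "K \<ge> 2" "(1 - 2 / real q) * K = ln (real q - 1)"
    and J: "finite J" and u: "\<And>x. u x \<ge> 0"
  shows "avg J \<Omega> (\<lambda>x. (u x)^2 * ln ((u x)^2)) \<le> avg J \<Omega> (\<lambda>x. (u x)^2) * ln (avg J \<Omega> (\<lambda>x. (u x)^2))
    + K * (\<Sum>j\<in>J. avg J \<Omega> (\<lambda>x. mean \<Omega> (\<lambda>\<omega>. (u (x(j := \<omega>)))^2) - (mean \<Omega> (\<lambda>\<omega>. u (x(j := \<omega>))))^2))"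
  using J u
proof (induction J arbitrary: u rule: finite_induct)
  case empty
  then show ?case by simp
next
  case (insert i J u)
  note i = \<open>finite J\<close> \<open>i \<notin> J\<close>
  have \<Omega>ne: "\<Omega> \<noteq> {}" using \<Omega> by auto
  define G where "G = (\<lambda>y. mean \<Omega> (\<lambda>\<omega>. (u (y(i := \<omega>)))^2))"
  have G0: "G y \<ge> 0" for y unfolding G_def by (rule mean_nonneg) simp
  define V where "V = (\<lambda>y. G y - (mean \<Omega> (\<lambda>\<omega>. u (y(i := \<omega>))))^2)"
  have one: "mean \<Omega> (\<lambda>\<omega>. (u (y(i := \<omega>)))^2 * ln ((u (y(i := \<omega>)))^2)) \<le> G y * ln (G y) + K * V y" for y
    using log_sobolev_complete_graph[OF \<Omega> _ K, of "\<lambda>\<omega>. u (y(i := \<omega>))"] insert.prems \<Omega>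
    unfolding G_def V_def mean_def by simp
  have "avg (insert i J) \<Omega> (\<lambda>x. (u x)^2 * ln ((u x)^2)) \<le> avg J \<Omega> (\<lambda>y. G y * ln (G y) + K * V y)"
    unfolding avg_insert[OF i] by (intro avg_mono one)
  also have "\<dots> = avg J \<Omega> (\<lambda>y. (sqrt (G y))^2 * ln ((sqrt (G y))^2)) + K * avg J \<Omega> V"
    using G0 by (simp add: avg_add avg_cmult)
  also have "avg J \<Omega> (\<lambda>y. (sqrt (G y))^2 * ln ((sqrt (G y))^2)) \<le> avg J \<Omega> (\<lambda>y. (sqrt (G y))^2) * ln (avg J \<Omega> (\<lambda>y. (sqrt (G y))^2))
    + K * (\<Sum>j\<in>J. avg J \<Omega> (\<lambda>x. mean \<Omega> (\<lambda>\<omega>. (sqrt (G (x(j := \<omega>))))^2) - (mean \<Omega> (\<lambda>\<omega>. sqrt (G (x(j := \<omega>)))))^2))"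
    by (rule insert.IH) (use G0 in simp)
  also have "avg J \<Omega> (\<lambda>y. (sqrt (G y))^2) = avg (insert i J) \<Omega> (\<lambda>x. (u x)^2)"
    unfolding avg_insert[OF i] using G0 by (simp add: G_def)
  also have "K * (\<Sum>j\<in>J. avg J \<Omega> (\<lambda>x. mean \<Omega> (\<lambda>\<omega>. (sqrt (G (x(j := \<omega>))))^2) - (mean \<Omega> (\<lambda>\<omega>. sqrt (G (x(j := \<omega>)))))^2))
    \<le> K * (\<Sum>j\<in>J. avg (insert i J) \<Omega> (\<lambda>x. mean \<Omega> (\<lambda>\<omega>. (u (x(j := \<omega>)))^2) - (mean \<Omega> (\<lambda>\<omega>. u (x(j := \<omega>))))^2))"
  proof (intro mult_left_mono sum_mono)
    fix j assume "j \<in> J"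
    then have ij: "i \<noteq> j" using i by auto
    show "avg J \<Omega> (\<lambda>x. mean \<Omega> (\<lambda>\<omega>. (sqrt (G (x(j := \<omega>))))^2) - (mean \<Omega> (\<lambda>\<omega>. sqrt (G (x(j := \<omega>)))))^2)
      \<le> avg (insert i J) \<Omega> (\<lambda>x. mean \<Omega> (\<lambda>\<omega>. (u (x(j := \<omega>)))^2) - (mean \<Omega> (\<lambda>\<omega>. u (x(j := \<omega>))))^2)"
      unfolding avg_insert[OF i]
    proof (rule avg_mono)
      fix y
      define w where "w = (\<lambda>\<omega> \<eta>. u ((y(j := \<omega>))(i := \<eta>)))"
      have sw: "u (y(i := \<eta>, j := \<omega>)) = w \<omega> \<eta>" for \<omega> \<eta> using ij by (simp add: w_def fun_upd_twist)
      have Gw: "G (y(j := \<omega>)) = mean \<Omega> (\<lambda>\<eta>. (w \<omega> \<eta>)^2)" for \<omega> by (simp add: G_def w_def)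
      have "mean \<Omega> (\<lambda>\<omega>. (sqrt (G (y(j := \<omega>))))^2) = mean \<Omega> (\<lambda>\<omega>. mean \<Omega> (\<lambda>\<eta>. (w \<omega> \<eta>)^2))"
        using G0 by (simp add: Gw[symmetric])
      also have "\<dots> = mean \<Omega> (\<lambda>\<eta>. mean \<Omega> (\<lambda>\<omega>. (w \<omega> \<eta>)^2))"
        unfolding mean_def sum_divide_distrib[symmetric] by (subst sum.swap) simp
      finally have 1: "mean \<Omega> (\<lambda>\<omega>. (sqrt (G (y(j := \<omega>))))^2) = mean \<Omega> (\<lambda>\<eta>. mean \<Omega> (\<lambda>\<omega>. (w \<omega> \<eta>)^2))" .
      have 2: "mean \<Omega> (\<lambda>\<eta>. (mean \<Omega> (\<lambda>\<omega>. w \<omega> \<eta>))^2) \<le> (mean \<Omega> (\<lambda>\<omega>. sqrt (G (y(j := \<omega>)))))^2"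
        unfolding Gw by (rule L2_minkowski_mean[OF \<Omega>(1)]) (simp add: w_def insert.prems)
      show "mean \<Omega> (\<lambda>\<omega>. (sqrt (G (y(j := \<omega>))))^2) - (mean \<Omega> (\<lambda>\<omega>. sqrt (G (y(j := \<omega>)))))^2
        \<le> mean \<Omega> (\<lambda>\<eta>. mean \<Omega> (\<lambda>\<omega>. (u (y(i := \<eta>, j := \<omega>)))^2) - (mean \<Omega> (\<lambda>\<omega>. u (y(i := \<eta>, j := \<omega>))))^2)"
        unfolding sw mean_diff using 1 2 by linarith
    qed
  qed (use K in simp)
  also have "avg J \<Omega> V = avg (insert i J) \<Omega> (\<lambda>x. mean \<Omega> (\<lambda>\<omega>. (u (x(i := \<omega>)))^2) - (mean \<Omega> (\<lambda>\<omega>. u (x(i := \<omega>))))^2)"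
    unfolding avg_insert[OF i] using \<Omega> \<Omega>ne by (simp add: V_def G_def mean_const)
  finally show ?case unfolding sum.insert[OF i] distrib_left by linarith
qed

text \<open>An entropy bound turns into a reverse Hoelder inequality: by Jensen's inequality for the probability
  density \<open>u\<^sup>2 / S\<close>, \<open>\<integral> u\<^sup>p = \<integral> u\<^sup>2 \<cdot> (u\<^sup>2)\<^bsup>(p-2)/2\<^esup>\<close> is at least \<open>S\<^bsup>p/2\<^esup> exp (- (2-p)/2 \<cdot> Ent / S)\<close>.\<close>

lemma reverse_Hoelder_of_entropy:
  fixes u :: "('i \<Rightarrow> 'a) \<Rightarrow> real"
  assumes u: "\<And>x. u x \<ge> 0" and S: "S = avg J \<Omega> (\<lambda>x. (u x)^2)" and p: "0 < p" "p \<le> 2"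
    and ent: "avg J \<Omega> (\<lambda>x. (u x)^2 * ln ((u x)^2)) \<le> S * ln S + c * S"
  shows "S powr (p/2) \<le> exp ((2-p)/2 * c) * avg J \<Omega> (\<lambda>x. u x powr p)"
proof (cases "S = 0")
  case True
  have "avg J \<Omega> (\<lambda>x. u x powr p) \<ge> 0" by (rule avg_nonneg) simp
  then show ?thesis using True by simp
next
  case False
  have "S \<ge> 0" unfolding S by (rule avg_nonneg) simp
  then have S0: "S > 0" using False by simp
  define k where "k = (2-p)/2"
  have k0: "k \<ge> 0" using p by (simp add: k_def)
  define C where "C = S powr (-k) * exp (- k * c)"
  have C0: "C > 0" using S0 by (simp add: C_def)
  \<comment> \<open>Jensen's inequality in pointwise form: \<open>exp\<close> is replaced by its
    tangent at \<open>- k * c\<close>, the value suggested by the entropy bound. Averaging then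
    needs only \<open>S\<close> and the entropy.\<close>
  have pt: "u x powr p \<ge> C * ((1 + k * ln S + k * c) * (u x)^2 - k * ((u x)^2 * ln ((u x)^2)))" for x
  proof (cases "u x = 0")
    case True
    then show ?thesis by simp
  next
    case False
    then have ux: "u x > 0" using u[of x] by simp
    define t where "t = - k * (ln ((u x)^2) - ln S)"
    have "u x powr p = (u x)^2 * (((u x)^2) powr (-k))"
    proof -
      have "((u x)^2) powr (-k) = u x powr (2 * (-k))"
        using ux by (simp add: powr_def ln_realpow)
      moreover have "(u x)^2 = u x powr 2" using ux by simp
      ultimately have "(u x)^2 * (((u x)^2) powr (-k)) = u x powr (2 + 2 * (-k))" by (simp only: powr_add)
      also have "2 + 2 * (-k) = p" by (simp add: k_def field_simps)
      finally show ?thesis by simp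
    qed
    also have "((u x)^2) powr (-k) = S powr (-k) * exp t"
      using ux S0 by (simp add: powr_def t_def algebra_simps flip: exp_add)
    also have "exp t = exp (- k * c) * exp (t + k * c)" by (simp flip: exp_add)
    finally have e: "u x powr p = C * ((u x)^2 * exp (t + k * c))" by (simp add: C_def)
    have "C * ((u x)^2 * (1 + (t + k * c))) \<le> C * ((u x)^2 * exp (t + k * c))"
      using C0 by (intro mult_left_mono exp_ge_add_one_self) auto
    then show ?thesis unfolding e t_def by (simp add: algebra_simps)
  qed
  have "S powr (p/2) = S powr (1 - k)" by (simp add: k_def diff_divide_distrib)
  also have "\<dots> = S powr (-k) * S" using S0 powr_add[of S "-k" 1] by simp
  also have "\<dots> = exp (k * c) * (C * S)" by (simp add: C_def exp_minus)
  also have "C * S \<le> C * ((1 + k * ln S + k * c) * S - k * avg J \<Omega> (\<lambda>x. (u x)^2 * ln ((u x)^2)))"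
  proof (intro mult_left_mono)
    have "k * avg J \<Omega> (\<lambda>x. (u x)^2 * ln ((u x)^2)) \<le> k * (S * ln S + c * S)"
      using ent k0 by (rule mult_left_mono)
    then show "S \<le> (1 + k * ln S + k * c) * S - k * avg J \<Omega> (\<lambda>x. (u x)^2 * ln ((u x)^2))"
      by (simp add: algebra_simps)
  qed (use C0 in simp)
  also have "C * ((1 + k * ln S + k * c) * S - k * avg J \<Omega> (\<lambda>x. (u x)^2 * ln ((u x)^2)))
    = avg J \<Omega> (\<lambda>x. C * ((1 + k * ln S + k * c) * (u x)^2 - k * ((u x)^2 * ln ((u x)^2))))"
    unfolding avg_cmult avg_diff S ..
  also have "\<dots> \<le> avg J \<Omega> (\<lambda>x. u x powr p)" by (intro avg_mono pt)
  finally show ?thesis by (simp add: k_def)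
qed

subsection \<open>Polynomials on cyclic groups\<close>

text \<open>A frequency \<open>\<alpha>\<close> is encoded as the set of pairs \<open>(j, \<alpha>\<^sub>j)\<close> with \<open>\<alpha>\<^sub>j \<noteq> 0\<close>, so that the interaction order
  becomes a cardinality.\<close>

definition freq_sets :: "'i set \<Rightarrow> nat \<Rightarrow> ('i \<times> nat) set set" where
  "freq_sets J q = {A. A \<subseteq> J \<times> {1..<q} \<and> inj_on fst A}"

definition monom_at :: "('i \<times> nat) set \<Rightarrow> ('i \<Rightarrow> complex) \<Rightarrow> complex" where
  "monom_at A x = (\<Prod>p\<in>A. x (fst p) ^ snd p)"

text \<open>On a member of \<open>freq_sets\<close> the sum has at most one term. It inverts the
  encoding, and the empty sum supplies the exponent 0 at coordinates that do not occur.\<close>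

definition expo :: "('i \<times> nat) set \<Rightarrow> 'i \<Rightarrow> nat" where
  "expo A j = (\<Sum>p\<in>{p\<in>A. fst p = j}. snd p)"

lemma finite_freq_sets [simp]: "finite J \<Longrightarrow> finite (freq_sets J q)"
  by (rule finite_subset[of _ "Pow (J \<times> {1..<q})"]) (auto simp: freq_sets_def)

lemma freq_sets_finite: "finite J \<Longrightarrow> A \<in> freq_sets J q \<Longrightarrow> finite A"
  by (auto simp: freq_sets_def intro: finite_subset)

lemma freq_sets_subset: "A \<in> freq_sets J q \<Longrightarrow> B \<subseteq> A \<Longrightarrow> B \<in> freq_sets J q"
  by (auto simp: freq_sets_def intro: inj_on_subset)

lemma expo_mem:
  assumes "A \<in> freq_sets J q" "(j, v) \<in> A"
  shows "expo A j = v"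
proof -
  have inj: "inj_on fst A" using assms by (simp add: freq_sets_def)
  have *: "p = (j, v)" if "p \<in> A" "fst p = j" for p
    using inj_onD[OF inj, of p "(j, v)"] that assms(2) by simp
  have "{p\<in>A. fst p = j} \<subseteq> {(j, v)}" using * by blast
  moreover have "(j, v) \<in> {p\<in>A. fst p = j}" using assms(2) by simp
  ultimately have "{p\<in>A. fst p = j} = {(j, v)}" by blast
  then show ?thesis by (simp add: expo_def)
qed

lemma expo_not_mem:
  assumes "j \<notin> fst ` A"
  shows "expo A j = 0"
proof -
  have "{p\<in>A. fst p = j} = {}" using assms by (auto simp: image_iff)
  then show ?thesis unfolding expo_def by (simp only: sum.empty)
qed

lemma expo_pos_iff: "A \<in> freq_sets J q \<Longrightarrow> (j, v) \<in> A \<longleftrightarrow> v \<noteq> 0 \<and> expo A j = v"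
proof
  assume A: "A \<in> freq_sets J q" "(j, v) \<in> A"
  then have "v \<noteq> 0" by (auto simp: freq_sets_def)
  then show "v \<noteq> 0 \<and> expo A j = v" using expo_mem[OF A] by simp
next
  assume A: "A \<in> freq_sets J q" and v: "v \<noteq> 0 \<and> expo A j = v"
  then have "j \<in> fst ` A" using expo_not_mem[of j A] by auto
  then obtain w where "(j, w) \<in> A" by auto
  then show "(j, v) \<in> A" using expo_mem[OF A] v by simp
qed

lemma expo_less: "q \<ge> 1 \<Longrightarrow> A \<in> freq_sets J q \<Longrightarrow> expo A j < q"
proof (cases "j \<in> fst ` A")
  case True
  assume A: "A \<in> freq_sets J q"
  from True obtain w where w: "(j, w) \<in> A" by auto
  then have "w < q" using A by (auto simp: freq_sets_def)
  then show ?thesis using expo_mem[OF A w] by simp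
qed (simp add: expo_not_mem)

lemma freq_sets_eqI:
  fixes A B :: "('i \<times> nat) set"
  assumes A: "A \<in> freq_sets J q" and B: "B \<in> freq_sets J q" and e: "\<And>j. j \<in> J \<Longrightarrow> expo A j = expo B j"
  shows "A = B"
proof (intro set_eqI)
  fix p :: "'i \<times> nat"
  obtain j v where p: "p = (j, v)" by (cases p)
  have "expo A j = expo B j"
  proof (cases "j \<in> J")
    case False
    then have "j \<notin> fst ` A" "j \<notin> fst ` B" using A B by (auto simp: freq_sets_def)
    then show ?thesis by (simp add: expo_not_mem)
  qed (rule e)
  then show "p \<in> A \<longleftrightarrow> p \<in> B" unfolding p expo_pos_iff[OF A] expo_pos_iff[OF B] by simp
qed

lemma monom_at_eq_prod:
  assumes "finite J" "A \<in> freq_sets J q"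
  shows "monom_at A x = (\<Prod>j\<in>J. x j ^ expo A j)"
proof -
  have "monom_at A x = (\<Prod>j\<in>J. \<Prod>p\<in>{p\<in>A. fst p = j}. x (fst p) ^ snd p)"
    unfolding monom_at_def
    by (rule prod.group[symmetric]) (use assms freq_sets_finite in \<open>auto simp: freq_sets_def\<close>)
  also have "\<dots> = (\<Prod>j\<in>J. x j ^ expo A j)"
    unfolding expo_def power_sum by (intro prod.cong refl) auto
  finally show ?thesis .
qed

section \<open>Orthogonality of the monomials and hypercontractivity on the cyclic group\<close>

lemma inj_on_root_q_power: "n \<ge> 1 \<Longrightarrow> inj_on (\<lambda>k. root_q n ^ k) {..<n}"
proof (rule linorder_inj_onI)
  fix a b assume n: "n \<ge> 1" and ab: "a < b" "a \<in> {..<n}" "b \<in> {..<n}"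
  show "root_q n ^ a \<noteq> root_q n ^ b"
  proof
    assume "root_q n ^ a = root_q n ^ b"
    moreover have "root_q n ^ b = root_q n ^ a * root_q n ^ (b - a)" using ab by (simp flip: power_add)
    ultimately have "root_q n ^ a * root_q n ^ (b - a) = root_q n ^ a * 1" by (simp only: mult_1_right)
    moreover have "root_q n \<noteq> 0" using norm_root_q[of n] by (auto simp del: norm_root_q)
    ultimately have "root_q n ^ (b - a) = 1" by (simp only: mult_cancel_left power_eq_0_iff simp_thms)
    then have "n dvd (b - a)" using root_q_power_eq_1_iff[OF n] by simp
    then show False using ab by (auto dest: dvd_imp_le)
  qed
qed auto

lemma finite_cyc [simp]: "finite (cyc q)"
  by (simp add: cyc_def)

lemma card_cyc: "q \<ge> 1 \<Longrightarrow> card (cyc q) = q"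
  unfolding cyc_def by (simp add: card_image inj_on_root_q_power)

lemma cyc_nonempty:
  assumes "q \<ge> 1"
  shows "cyc q \<noteq> {}"
proof -
  have "root_q q ^ 0 \<in> cyc q" unfolding cyc_def by (rule imageI) (use assms in simp)
  then show ?thesis by blast
qed

lemma norm_cyc: "w \<in> cyc q \<Longrightarrow> cmod w = 1"
  unfolding cyc_def by (auto simp: norm_power)

lemma mean_cyc_orthogonal:
  assumes q: "q \<ge> 1" and ab: "a < q" "b < q"
  shows "mean (cyc q) (\<lambda>w. w ^ a * cnj (w ^ b)) = (if a = b then 1 else 0)"
proof -
  define r where "r = root_q q"
  have rq: "r ^ q = 1" unfolding r_def using root_q_power_eq_1_iff[OF q, of q] by simp
  have eq: "w ^ a * cnj (w ^ b) = w ^ (a + (q - b))" if "w = r ^ k" for w k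
  proof -
    have "w ^ q = (r ^ q) ^ k" unfolding that by (simp add: mult.commute flip: power_mult)
    then have wq: "w ^ q = 1" by (simp add: rq)
    have "cmod w = 1" unfolding that by (simp add: norm_power r_def)
    then have "w ^ b * cnj (w ^ b) = 1" using complex_norm_square[of "w ^ b"] by (simp add: norm_power)
    moreover have "w ^ b * w ^ (q - b) = 1" using wq ab by (simp flip: power_add)
    ultimately have "cnj (w ^ b) = w ^ (q - b)"
      by (metis mult.assoc mult.commute mult_1)
    then show ?thesis by (simp add: power_add)
  qed
  have "(\<Sum>w\<in>cyc q. w ^ a * cnj (w ^ b)) = (\<Sum>k<q. (r ^ k) ^ a * cnj ((r ^ k) ^ b))"
    unfolding cyc_def r_def by (subst sum.reindex[OF inj_on_root_q_power[OF q]]) simp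
  also have "\<dots> = (\<Sum>k<q. (r ^ (a + (q - b))) ^ k)"
    by (intro sum.cong refl) (simp only: eq[OF refl], simp add: mult.commute flip: power_mult)
  also have "\<dots> = (if q dvd (a + (q - b)) then of_nat q else 0)"
    unfolding r_def by (rule sum_root_q_powers[OF q])
  also have "q dvd (a + (q - b)) \<longleftrightarrow> a = b"
  proof
    assume "q dvd (a + (q - b))"
    then obtain c where c: "a + (q - b) = q * c" by (auto simp: dvd_def)
    have "0 < a + (q - b)" "a + (q - b) < q * 2" using ab by auto
    then have "c = 1" unfolding c by auto
    then have "a + (q - b) = q" using c by (simp only: mult_1_right)
    then show "a = b" using ab by linarith
  next
    assume "a = b" then show "q dvd (a + (q - b))" using ab by simp
  qed
  finally show ?thesis using q by (simp add: mean_def card_cyc)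
qed

lemma avg_prod:
  fixes f :: "'i \<Rightarrow> 'a \<Rightarrow> 'b::real_normed_field"
  assumes "finite J" "finite \<Omega>"
  shows "avg J \<Omega> (\<lambda>x. \<Prod>j\<in>J. f j (x j)) = (\<Prod>j\<in>J. mean \<Omega> (f j))"
proof -
  have "(\<Sum>x\<in>PiE J (\<lambda>_. \<Omega>). \<Prod>j\<in>J. f j (x j)) = (\<Prod>j\<in>J. \<Sum>\<omega>\<in>\<Omega>. f j \<omega>)"
    using assms by (simp add: prod_sum_PiE)
  then show ?thesis by (simp add: avg_def mean_def prod_dividef)
qed

lemma avg_monom_orthogonal:
  assumes q: "q \<ge> 1" and J: "finite J" and A: "A \<in> freq_sets J q" and B: "B \<in> freq_sets J q"
  shows "avg J (cyc q) (\<lambda>x. monom_at A x * cnj (monom_at B x)) = (if A = B then 1 else 0)"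
proof -
  have "avg J (cyc q) (\<lambda>x. monom_at A x * cnj (monom_at B x))
      = avg J (cyc q) (\<lambda>x. \<Prod>j\<in>J. x j ^ expo A j * cnj (x j ^ expo B j))"
    by (simp add: monom_at_eq_prod[OF J A] monom_at_eq_prod[OF J B] prod.distrib)
  also have "\<dots> = (\<Prod>j\<in>J. mean (cyc q) (\<lambda>w. w ^ expo A j * cnj (w ^ expo B j)))"
    using avg_prod[OF J, of "cyc q" "\<lambda>j w. w ^ expo A j * cnj (w ^ expo B j)"] by simp
  also have "\<dots> = (\<Prod>j\<in>J. if expo A j = expo B j then 1 else 0)"
    by (intro prod.cong refl mean_cyc_orthogonal q expo_less[OF q A] expo_less[OF q B])
  also have "\<dots> = (if A = B then 1 else 0)"
  proof (cases "A = B")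
    case False
    then obtain j where "j \<in> J" "expo A j \<noteq> expo B j" using freq_sets_eqI[OF A B] by blast
    then show ?thesis using J False by (auto intro: prod_zero)
  qed simp
  finally show ?thesis .
qed

definition cyc_poly :: "'i set \<Rightarrow> nat \<Rightarrow> (('i \<times> nat) set \<Rightarrow> complex) \<Rightarrow> ('i \<Rightarrow> complex) \<Rightarrow> complex" where
  "cyc_poly J q c x = (\<Sum>A\<in>freq_sets J q. c A * monom_at A x)"

lemma parseval_cyc_poly:
  assumes q: "q \<ge> 1" and J: "finite J"
  shows "avg J (cyc q) (\<lambda>x. (cmod (cyc_poly J q c x))^2) = (\<Sum>A\<in>freq_sets J q. (cmod (c A))^2)"
proof -
  have "complex_of_real (avg J (cyc q) (\<lambda>x. (cmod (cyc_poly J q c x))^2))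
      = avg J (cyc q) (\<lambda>x. cyc_poly J q c x * cnj (cyc_poly J q c x))"
    unfolding avg_def of_real_divide of_real_sum complex_norm_square by simp
  also have "\<dots> = avg J (cyc q) (\<lambda>x. \<Sum>A\<in>freq_sets J q. \<Sum>B\<in>freq_sets J q. (c A * cnj (c B)) * (monom_at A x * cnj (monom_at B x)))"
    unfolding cyc_poly_def cnj_sum sum_product by (simp add: mult_ac)
  also have "\<dots> = (\<Sum>A\<in>freq_sets J q. \<Sum>B\<in>freq_sets J q. (c A * cnj (c B)) * (if A = B then 1 else 0))"
    unfolding avg_sum avg_cmult by (intro sum.cong refl) (simp add: avg_monom_orthogonal[OF q J])
  also have "\<dots> = (\<Sum>A\<in>freq_sets J q. c A * cnj (c A))"
    using J by (simp add: if_distrib cong: if_cong)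
  also have "\<dots> = complex_of_real (\<Sum>A\<in>freq_sets J q. (cmod (c A))^2)"
    by (simp only: complex_norm_square of_real_sum)
  finally show ?thesis by (simp only: of_real_eq_iff)
qed

lemma mean_monom_at:
  assumes q: "q \<ge> 2" and J: "finite J" and A: "A \<in> freq_sets J q"
  shows "mean (cyc q) (\<lambda>w. monom_at A (x(i := w))) = (if i \<in> fst ` A then 0 else monom_at A x)"
proof (cases "i \<in> fst ` A")
  case False
  then have "monom_at A (x(i := w)) = monom_at A x" for w
    unfolding monom_at_def by (intro prod.cong refl) auto
  then show ?thesis using False q cyc_nonempty[of q] by (simp add: mean_const)
next
  case True
  then obtain v where v: "(i, v) \<in> A" by auto
  have vq: "1 \<le> v" "v < q" using v A by (auto simp: freq_sets_def)
  have inj: "inj_on fst A" using A by (simp add: freq_sets_def)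
  have "monom_at A (x(i := w)) = monom_at (A - {(i, v)}) x * w ^ v" for w
  proof -
    have "monom_at A (x(i := w)) = w ^ v * (\<Prod>p\<in>A - {(i, v)}. (x(i := w)) (fst p) ^ snd p)"
      unfolding monom_at_def
      using prod.remove[OF freq_sets_finite[OF J A] v, of "\<lambda>p. (x(i := w)) (fst p) ^ snd p"]
      by (simp only: fst_conv snd_conv fun_upd_same)
    also have "(\<Prod>p\<in>A - {(i, v)}. (x(i := w)) (fst p) ^ snd p) = monom_at (A - {(i, v)}) x"
      unfolding monom_at_def
    proof (intro prod.cong refl)
      fix p assume p: "p \<in> A - {(i, v)}"
      then have "fst p \<noteq> i" using inj_onD[OF inj, of p "(i, v)"] v by auto
      then show "(x(i := w)) (fst p) ^ snd p = x (fst p) ^ snd p" by simp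
    qed
    finally show ?thesis by (simp only: mult.commute)
  qed
  then have "mean (cyc q) (\<lambda>w. monom_at A (x(i := w))) = monom_at (A - {(i, v)}) x * mean (cyc q) (\<lambda>w. w ^ v)"
    by (simp add: mean_cmult)
  also have "mean (cyc q) (\<lambda>w. w ^ v) = 0"
    using mean_cyc_orthogonal[of q v 0] q vq by simp
  finally show ?thesis by (simp only: mult_zero_right True if_True)
qed

lemma hypercontractivity_cyc_poly:
  fixes c :: "('i \<times> nat) set \<Rightarrow> complex"
  assumes q: "q \<ge> 2" and J: "finite J" and K: "K \<ge> 2" "(1 - 2 / real q) * K = ln (real q - 1)"
    and c: "\<And>A. A \<in> freq_sets J q \<Longrightarrow> c A \<noteq> 0 \<Longrightarrow> card A \<le> n" and p: "0 < p" "p \<le> 2"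
  shows "(\<Sum>A\<in>freq_sets J q. (cmod (c A))^2) powr (p/2)
    \<le> exp ((2-p)/2 * (K * real n)) * avg J (cyc q) (\<lambda>x. cmod (cyc_poly J q c x) powr p)"
proof -
  define u where "u = (\<lambda>x. cmod (cyc_poly J q c x))"
  define S where "S = (\<Sum>A\<in>freq_sets J q. (cmod (c A))^2)"
  have q1: "q \<ge> 1" using q by simp
  have S: "S = avg J (cyc q) (\<lambda>x. (u x)^2)"
    unfolding S_def u_def by (rule parseval_cyc_poly[OF q1 J, symmetric])
  have var: "avg J (cyc q) (\<lambda>x. mean (cyc q) (\<lambda>\<omega>. (u (x(j := \<omega>)))^2) - (mean (cyc q) (\<lambda>\<omega>. u (x(j := \<omega>))))^2)
      \<le> (\<Sum>A\<in>freq_sets J q. if j \<in> fst ` A then (cmod (c A))^2 else 0)" if j: "j \<in> J" for j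
  proof -
    define c' where "c' = (\<lambda>A. if j \<in> fst ` A then 0 else c A)"
    have m: "mean (cyc q) (\<lambda>\<omega>. cyc_poly J q c (x(j := \<omega>))) = cyc_poly J q c' x" for x
      unfolding cyc_poly_def mean_sum mean_cmult
      by (intro sum.cong refl) (simp add: mean_monom_at[OF q J] c'_def)
    have "(cmod (cyc_poly J q c' x))^2 \<le> (mean (cyc q) (\<lambda>\<omega>. u (x(j := \<omega>))))^2" for x
      unfolding m[symmetric] u_def by (intro power_mono norm_mean_le) auto
    then have "avg J (cyc q) (\<lambda>x. mean (cyc q) (\<lambda>\<omega>. (u (x(j := \<omega>)))^2) - (mean (cyc q) (\<lambda>\<omega>. u (x(j := \<omega>))))^2)
        \<le> avg J (cyc q) (\<lambda>x. mean (cyc q) (\<lambda>\<omega>. (u (x(j := \<omega>)))^2) - (cmod (cyc_poly J q c' x))^2)"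
      by (intro avg_mono) simp
    also have "\<dots> = S - (\<Sum>A\<in>freq_sets J q. (cmod (c' A))^2)"
      unfolding avg_diff parseval_cyc_poly[OF q1 J] S
      using avg_resample[OF J j finite_cyc cyc_nonempty[OF q1], of "\<lambda>x. (u x)^2"] by simp
    also have "\<dots> = (\<Sum>A\<in>freq_sets J q. if j \<in> fst ` A then (cmod (c A))^2 else 0)"
      unfolding S_def sum_subtractf[symmetric] by (intro sum.cong refl) (simp add: c'_def)
    finally show ?thesis .
  qed
  have "avg J (cyc q) (\<lambda>x. (u x)^2 * ln ((u x)^2)) \<le> S * ln S
    + K * (\<Sum>j\<in>J. avg J (cyc q) (\<lambda>x. mean (cyc q) (\<lambda>\<omega>. (u (x(j := \<omega>)))^2) - (mean (cyc q) (\<lambda>\<omega>. u (x(j := \<omega>))))^2))"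
    unfolding S by (rule log_sobolev_product[OF finite_cyc card_cyc[OF q1] q K J]) (simp add: u_def)
  also have "\<dots> \<le> S * ln S + K * (\<Sum>j\<in>J. \<Sum>A\<in>freq_sets J q. if j \<in> fst ` A then (cmod (c A))^2 else 0)"
    using K by (intro add_left_mono mult_left_mono sum_mono var) auto
  also have "(\<Sum>j\<in>J. \<Sum>A\<in>freq_sets J q. if j \<in> fst ` A then (cmod (c A))^2 else 0)
      = (\<Sum>A\<in>freq_sets J q. real (card A) * (cmod (c A))^2)"
  proof -
    have "(\<Sum>j\<in>J. if j \<in> fst ` A then (cmod (c A))^2 else 0) = real (card A) * (cmod (c A))^2"
      if A: "A \<in> freq_sets J q" for A
    proof -
      have "{j\<in>J. j \<in> fst ` A} = fst ` A" using A by (auto simp: freq_sets_def)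
      moreover have "card (fst ` A) = card A" using A by (auto simp: freq_sets_def intro: card_image)
      ultimately show ?thesis using J by (simp add: sum.inter_filter[symmetric])
    qed
    then show ?thesis by (subst sum.swap) simp
  qed
  also have "\<dots> \<le> (\<Sum>A\<in>freq_sets J q. real n * (cmod (c A))^2)"
  proof (rule sum_mono)
    fix A assume "A \<in> freq_sets J q"
    then show "real (card A) * (cmod (c A))^2 \<le> real n * (cmod (c A))^2"
      using c[of A] by (cases "c A = 0") (auto intro: mult_right_mono)
  qed
  also have "\<dots> = real n * S" by (simp add: S_def sum_distrib_left)
  finally have "avg J (cyc q) (\<lambda>x. (u x)^2 * ln ((u x)^2)) \<le> S * ln S + (K * real n) * S"
    using K by (simp add: mult_left_mono mult.assoc)
  from reverse_Hoelder_of_entropy[OF _ S p this] show ?thesis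
    unfolding S_def[symmetric] by (simp add: u_def)
qed

subsection \<open>The recursion for the Bohnenblust--Hille constants\<close>

definition cyc_bounded :: "'i set \<Rightarrow> nat \<Rightarrow> (('i \<times> nat) set \<Rightarrow> complex) \<Rightarrow> real \<Rightarrow> bool" where
  "cyc_bounded J q c M \<longleftrightarrow> (\<forall>x. (\<forall>j\<in>J. x j \<in> cyc q) \<longrightarrow> cmod (cyc_poly J q c x) \<le> M)"

definition BH_poly_bound :: "nat \<Rightarrow> nat \<Rightarrow> real \<Rightarrow> bool" where
  "BH_poly_bound d q C \<longleftrightarrow> (\<forall>(J::nat set) c M. finite J \<longrightarrow>
     (\<forall>A\<in>freq_sets J q. c A \<noteq> 0 \<longrightarrow> card A \<le> d) \<longrightarrow> cyc_bounded J q c M \<longrightarrow>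
     (\<Sum>A\<in>freq_sets J q. cmod (c A) powr bh_exponent d) \<le> (C * M) powr bh_exponent d)"

lemma cyc_boundedD: "cyc_bounded J q c M \<Longrightarrow> (\<And>j. j \<in> J \<Longrightarrow> x j \<in> cyc q) \<Longrightarrow> cmod (cyc_poly J q c x) \<le> M"
  by (simp add: cyc_bounded_def)

lemma BH_poly_boundD:
  fixes J :: "nat set"
  assumes "BH_poly_bound d q C" "finite J" "\<And>A. A \<in> freq_sets J q \<Longrightarrow> c A \<noteq> 0 \<Longrightarrow> card A \<le> d" "cyc_bounded J q c M"
  shows "(\<Sum>A\<in>freq_sets J q. cmod (c A) powr bh_exponent d) \<le> (C * M) powr bh_exponent d"
  using assms unfolding BH_poly_bound_def by blast

lemma cyc_bounded_nonneg:
  assumes "q \<ge> 1" "cyc_bounded J q c M"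
  shows "M \<ge> 0"
proof -
  obtain w where "w \<in> cyc q" using cyc_nonempty[OF assms(1)] by blast
  then have "cmod (cyc_poly J q c (\<lambda>_. w)) \<le> M" using assms(2) by (simp add: cyc_bounded_def)
  then show ?thesis using norm_ge_zero[of "cyc_poly J q c (\<lambda>_. w)"] by linarith
qed

text \<open>Each frequency contains a coordinate at most once, so the mixture is affine in the pair
  of monomial values at that coordinate. Mixing one coordinate is thus a convex combination of two
  sums in which it is left unmixed, and induction removes all coordinates in turn.\<close>

lemma mixture_bounded:
  fixes s :: real
  assumes J: "finite J" and b: "cyc_bounded J q c M" and s: "0 \<le> s" "s \<le> 1"
    and x: "\<And>j. j \<in> J \<Longrightarrow> x j \<in> cyc q" and y: "\<And>j. j \<in> J \<Longrightarrow> y j \<in> cyc q"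
  shows "cmod (\<Sum>A\<in>freq_sets J q. c A * (\<Prod>p\<in>A. (1 - of_real s) * y (fst p) ^ snd p + of_real s * x (fst p) ^ snd p)) \<le> M"
proof -
  \<comment> \<open>Coordinates in \<open>I\<close> are mixed, the others are evaluated at a free
    point \<open>z\<close>, over which the induction generalizes.\<close>
  define t where "t = (\<lambda>I z p. if fst p \<in> I then (1 - of_real s) * y (fst p) ^ snd p + of_real s * x (fst p) ^ snd p else z (fst p) ^ snd p)"
  have "cmod (\<Sum>A\<in>freq_sets J q. c A * (\<Prod>p\<in>A. t I z p)) \<le> M"
    if "finite I" "I \<subseteq> J" "\<And>j. j \<in> J \<Longrightarrow> z j \<in> cyc q" for I z
    using that
  proof (induction I arbitrary: z rule: finite_induct)
    case empty
    have "(\<Sum>A\<in>freq_sets J q. c A * (\<Prod>p\<in>A. t {} z p)) = cyc_poly J q c z"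
      unfolding cyc_poly_def monom_at_def t_def by simp
    then show ?case using cyc_boundedD[OF b, of z] empty by simp
  next
    case (insert i I)
    have i: "i \<in> J" using insert by simp
    have split: "(\<Prod>p\<in>A. t (insert i I) z p) = (1 - of_real s) * (\<Prod>p\<in>A. t I (z(i := y i)) p) + of_real s * (\<Prod>p\<in>A. t I (z(i := x i)) p)"
      if A: "A \<in> freq_sets J q" for A
    proof -
      have other: "t I (z(i := w)) p = t (insert i I) z p" if "fst p \<noteq> i" for p w
        unfolding t_def using that by simp
      show ?thesis
      proof (cases "i \<in> fst ` A")
        case False
        have "(\<Prod>p\<in>A. t I (z(i := w)) p) = (\<Prod>p\<in>A. t (insert i I) z p)" for w
        proof (intro prod.cong refl other)
          fix p assume "p \<in> A" then show "fst p \<noteq> i" using False by auto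
        qed
        then show ?thesis by (simp only: ring_distribs(1)[symmetric]) (simp add: algebra_simps)
      next
        case True
        then obtain v where v: "(i, v) \<in> A" by auto
        have inj: "inj_on fst A" using A by (simp add: freq_sets_def)
        define R where "R = (\<Prod>p\<in>A - {(i, v)}. t (insert i I) z p)"
        have fst_ne: "fst p \<noteq> i" if "p \<in> A - {(i, v)}" for p
          using inj_onD[OF inj, of p "(i, v)"] v that by auto
        have rest: "(\<Prod>p\<in>A - {(i, v)}. t I (z(i := w)) p) = R" for w
          unfolding R_def by (intro prod.cong refl other fst_ne)
        have tw: "t I (z(i := w)) (i, v) = w ^ v" for w
          unfolding t_def using insert.hyps by simp
        have "(\<Prod>p\<in>A. t I (z(i := w)) p) = w ^ v * R" for w
          using prod.remove[OF freq_sets_finite[OF J A] v, of "t I (z(i := w))"] rest tw by simp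
        moreover have "(\<Prod>p\<in>A. t (insert i I) z p) = ((1 - of_real s) * y i ^ v + of_real s * x i ^ v) * R"
          using prod.remove[OF freq_sets_finite[OF J A] v, of "t (insert i I) z"] by (simp add: R_def t_def)
        ultimately show ?thesis by (simp add: algebra_simps)
      qed
    qed
    define F where "F = (\<lambda>w. \<Sum>A\<in>freq_sets J q. c A * (\<Prod>p\<in>A. t I (z(i := w)) p))"
    have 1: "(\<Sum>A\<in>freq_sets J q. c A * (\<Prod>p\<in>A. t (insert i I) z p)) = of_real (1 - s) * F (y i) + of_real s * F (x i)"
      unfolding F_def sum_distrib_left sum.distrib[symmetric]
      by (intro sum.cong refl) (simp add: split algebra_simps)
    have "cmod (F w) \<le> M" if "w \<in> cyc q" for w
      unfolding F_def by (rule insert.IH) (use insert.prems that in auto)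
    then have "(1 - s) * cmod (F (y i)) + s * cmod (F (x i)) \<le> (1 - s) * M + s * M"
      using s x[OF i] y[OF i] by (intro add_mono mult_left_mono) auto
    also have "(1 - s) * M + s * M = M" by (simp add: algebra_simps)
    finally have 2: "(1 - s) * cmod (F (y i)) + s * cmod (F (x i)) \<le> M" .
    have 3: "cmod (of_real (1 - s) * F (y i) + of_real s * F (x i)) \<le> (1 - s) * cmod (F (y i)) + s * cmod (F (x i))"
      using norm_triangle_ineq[of "of_real (1 - s) * F (y i)" "of_real s * F (x i)"] s
      by (simp only: norm_mult norm_of_real abs_of_nonneg diff_ge_0_iff_ge)
    show ?case unfolding 1 using 2 3 by linarith
  qed
  from this[of J x] have "cmod (\<Sum>A\<in>freq_sets J q. c A * (\<Prod>p\<in>A. t J x p)) \<le> M" using J x by simp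
  moreover have "(\<Prod>p\<in>A. t J x p) = (\<Prod>p\<in>A. (1 - of_real s) * y (fst p) ^ snd p + of_real s * x (fst p) ^ snd p)"
    if "A \<in> freq_sets J q" for A
    using that by (intro prod.cong refl) (auto simp: t_def freq_sets_def)
  ultimately show ?thesis by simp
qed

text \<open>The coefficient of \<open>s^k\<close> in \<open>s^b * (1 - s)^n\<close>, the probability
  that \<open>b\<close> given coordinates come from \<open>x\<close> and \<open>n\<close> others
  from \<open>y\<close>.\<close>

definition slice_weight :: "nat \<Rightarrow> nat \<Rightarrow> nat \<Rightarrow> complex" where
  "slice_weight k b n = coeff (monom 1 b * [:1, -1:] ^ n) k"

lemma slice_weight_gt: "b > k \<Longrightarrow> slice_weight k b n = 0"
  by (simp add: slice_weight_def coeff_monom_mult)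

lemma slice_weight_eq: "slice_weight k k n = 1"
  by (simp add: slice_weight_def coeff_monom_mult coeff_0_power)

lemma slice_weight_0: "slice_weight k b 0 = (if b = k then 1 else 0)"
  by (simp add: slice_weight_def)

text \<open>Coefficients, as a polynomial in \<open>x\<close>, of the \<open>s\<^sup>k\<close>-coefficient of the expectation of \<open>f\<close> at a random point
  whose coordinates are those of \<open>x\<close> with probability \<open>s\<close> and those of \<open>y\<close> otherwise. Those of top order \<open>k\<close>
  are the mixed derivatives \<open>D\<^sub>B f(y)\<close>.\<close>

definition slice :: "'i set \<Rightarrow> nat \<Rightarrow> nat \<Rightarrow> (('i \<times> nat) set \<Rightarrow> complex) \<Rightarrow> ('i \<Rightarrow> complex) \<Rightarrow> ('i \<times> nat) set \<Rightarrow> complex" where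
  "slice J q k c y B = (\<Sum>A\<in>{A\<in>freq_sets J q. B \<subseteq> A}. c A * monom_at (A - B) y * slice_weight k (card B) (card (A - B)))"

definition markov_const :: "nat \<Rightarrow> nat \<Rightarrow> real" where
  "markov_const d k = (2 * real d + 1) * exp (5 * real k) * (real d / real k) ^ (2 * k)"

lemma markov_const_nonneg: "markov_const d k \<ge> 0"
  by (simp add: markov_const_def)

lemma slice_bounded:
  assumes J: "finite J" and b: "cyc_bounded J q c M" and c: "\<And>A. A \<in> freq_sets J q \<Longrightarrow> c A \<noteq> 0 \<Longrightarrow> card A \<le> d"
    and k: "1 \<le> k" "k \<le> d" and y: "\<And>j. j \<in> J \<Longrightarrow> y j \<in> cyc q"
  shows "cyc_bounded J q (slice J q k c y) (markov_const d k * M)"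
  unfolding cyc_bounded_def
proof (intro allI impI)
  fix x assume x: "\<forall>j\<in>J. x j \<in> cyc q"
  \<comment> \<open>The expectation of the function at the random point, as a polynomial in the
    probability \<open>s\<close>.\<close>
  define Q where "Q = (\<Sum>A\<in>freq_sets J q. smult (c A) (\<Prod>p\<in>A. [:y (fst p) ^ snd p, x (fst p) ^ snd p - y (fst p) ^ snd p:]))"
  have "cmod (coeff Q k) \<le> (2 * real d + 1) * exp (5 * real k) * (real d / real k) ^ (2 * k) * M"
  proof (rule coeff_bound_of_unit_interval[OF _ _ k])
    show "degree Q \<le> d" unfolding Q_def
    proof (rule degree_sum_le)
      fix A assume A: "A \<in> freq_sets J q"
      show "degree (smult (c A) (\<Prod>p\<in>A. [:y (fst p) ^ snd p, x (fst p) ^ snd p - y (fst p) ^ snd p:])) \<le> d"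
      proof (cases "c A = 0")
        case False
        have "degree (\<Prod>p\<in>A. [:y (fst p) ^ snd p, x (fst p) ^ snd p - y (fst p) ^ snd p:])
            \<le> (\<Sum>p\<in>A. degree [:y (fst p) ^ snd p, x (fst p) ^ snd p - y (fst p) ^ snd p:])"
          using degree_prod_sum_le[OF freq_sets_finite[OF J A], of "\<lambda>p. [:y (fst p) ^ snd p, x (fst p) ^ snd p - y (fst p) ^ snd p:]"]
          by (simp add: o_def)
        also have "\<dots> \<le> (\<Sum>p\<in>A. 1)" by (intro sum_mono) simp
        also have "\<dots> \<le> d" using c[OF A False] by simp
        finally show ?thesis using degree_smult_le order_trans by blast
      qed simp
    qed (use J in simp)
    fix s :: real assume s: "0 \<le> s" "s \<le> 1"
    have "poly Q (of_real s) = (\<Sum>A\<in>freq_sets J q. c A * (\<Prod>p\<in>A. (1 - of_real s) * y (fst p) ^ snd p + of_real s * x (fst p) ^ snd p))"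
      unfolding Q_def poly_sum poly_smult poly_prod
      by (intro sum.cong arg_cong2[where f = "(*)"] prod.cong refl) (simp add: algebra_simps)
    then show "cmod (poly Q (of_real s)) \<le> M"
      using mixture_bounded[OF J b s, of x y] x y by simp
  qed
  moreover have "coeff Q k = cyc_poly J q (slice J q k c y) x"
  proof -
    have exp: "coeff (\<Prod>p\<in>A. [:y (fst p) ^ snd p, x (fst p) ^ snd p - y (fst p) ^ snd p:]) k
        = (\<Sum>B\<in>Pow A. monom_at B x * monom_at (A - B) y * slice_weight k (card B) (card (A - B)))"
      if A: "A \<in> freq_sets J q" for A
    proof -
      have fA: "finite A" by (rule freq_sets_finite[OF J A])
      \<comment> \<open>Each factor is rewritten as \<open>s\<close> times the value at
        \<open>x\<close> plus \<open>1 - s\<close> times the value at \<open>y\<close>; expanding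
        the product, \<open>B\<close> is the set of pairs taken from \<open>x\<close>.\<close>
      have "(\<Prod>p\<in>A. [:y (fst p) ^ snd p, x (fst p) ^ snd p - y (fst p) ^ snd p:])
          = (\<Prod>p\<in>A. smult (x (fst p) ^ snd p) (monom 1 1) + smult (y (fst p) ^ snd p) [:1, -1:])"
        by (intro prod.cong refl) (simp add: monom_altdef)
      also have "\<dots> = (\<Sum>B\<in>Pow A. (\<Prod>p\<in>B. smult (x (fst p) ^ snd p) (monom 1 1)) * (\<Prod>p\<in>A - B. smult (y (fst p) ^ snd p) [:1, -1:]))"
        by (rule prod_add[OF fA])
      also have "\<dots> = (\<Sum>B\<in>Pow A. smult (monom_at B x * monom_at (A - B) y) (monom 1 (card B) * [:1, -1:] ^ card (A - B)))"
      proof (intro sum.cong refl)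
        fix B
        have 1: "(\<Prod>p\<in>B. smult (x (fst p) ^ snd p) (monom (1::complex) 1)) = smult (monom_at B x) (monom 1 (card B))"
          by (simp only: prod_smult prod_constant monom_at_def monom_power power_one mult_1)
        have 2: "(\<Prod>p\<in>A - B. smult (y (fst p) ^ snd p) [:1, -1:]) = smult (monom_at (A - B) y) ([:1, -1:] ^ card (A - B))"
          by (simp only: prod_smult prod_constant monom_at_def)
        show "(\<Prod>p\<in>B. smult (x (fst p) ^ snd p) (monom 1 1)) * (\<Prod>p\<in>A - B. smult (y (fst p) ^ snd p) [:1, -1:])
          = smult (monom_at B x * monom_at (A - B) y) (monom 1 (card B) * [:1, -1:] ^ card (A - B))"
          unfolding 1 2 by (simp add: mult.commute)
      qed
      finally show ?thesis by (simp add: coeff_sum slice_weight_def)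
    qed
    have "coeff Q k = (\<Sum>A\<in>freq_sets J q. c A * (\<Sum>B\<in>Pow A. monom_at B x * monom_at (A - B) y * slice_weight k (card B) (card (A - B))))"
      unfolding Q_def coeff_sum coeff_smult by (intro sum.cong refl) (simp only: exp)
    also have "\<dots> = (\<Sum>A\<in>freq_sets J q. \<Sum>B\<in>{B\<in>freq_sets J q. B \<subseteq> A}. monom_at B x * (c A * monom_at (A - B) y * slice_weight k (card B) (card (A - B))))"
    proof (intro sum.cong refl)
      fix A assume A: "A \<in> freq_sets J q"
      have "{B\<in>freq_sets J q. B \<subseteq> A} = Pow A" using freq_sets_subset[OF A] by blast
      then show "c A * (\<Sum>B\<in>Pow A. monom_at B x * monom_at (A - B) y * slice_weight k (card B) (card (A - B)))
        = (\<Sum>B\<in>{B\<in>freq_sets J q. B \<subseteq> A}. monom_at B x * (c A * monom_at (A - B) y * slice_weight k (card B) (card (A - B))))"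
        by (simp add: sum_distrib_left mult_ac)
    qed
    also have "\<dots> = (\<Sum>B\<in>freq_sets J q. \<Sum>A\<in>{A\<in>freq_sets J q. B \<subseteq> A}. monom_at B x * (c A * monom_at (A - B) y * slice_weight k (card B) (card (A - B))))"
      by (rule sum.swap_restrict) (use J in simp_all)
    also have "\<dots> = cyc_poly J q (slice J q k c y) x"
      unfolding cyc_poly_def slice_def sum_distrib_right by (intro sum.cong refl) (simp only: mult_ac)
    finally show ?thesis .
  qed
  ultimately show "cmod (cyc_poly J q (slice J q k c y) x) \<le> markov_const d k * M"
    by (simp add: markov_const_def)
qed

lemma slice_gt: "card B > k \<Longrightarrow> slice J q k c y B = 0"
  by (simp add: slice_def slice_weight_gt)

lemma slice_eq: "card B = k \<Longrightarrow> slice J q k c y B = (\<Sum>A\<in>{A\<in>freq_sets J q. B \<subseteq> A}. c A * monom_at (A - B) y)"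
  by (simp add: slice_def slice_weight_eq)

lemma avg_monom:
  assumes q: "q \<ge> 1" and J: "finite J" and A: "A \<in> freq_sets J q"
  shows "avg J (cyc q) (monom_at A) = (if A = {} then 1 else 0)"
proof -
  have "{} \<in> freq_sets J q" by (simp add: freq_sets_def)
  from avg_monom_orthogonal[OF q J A this] show ?thesis by (simp add: monom_at_def[of "{}"])
qed

text \<open>Averaging over \<open>y\<close> removes every \<open>A\<close> that properly contains
  \<open>B\<close>, and for \<open>A = B\<close> the weight \<open>slice_weight k (card B) 0\<close>
  singles out order \<open>k\<close>.\<close>

lemma avg_slice:
  assumes q: "q \<ge> 1" and J: "finite J" and B: "B \<in> freq_sets J q"
  shows "avg J (cyc q) (\<lambda>y. slice J q k c y B) = (if card B = k then c B else 0)"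
proof -
  have "avg J (cyc q) (\<lambda>y. slice J q k c y B)
     = (\<Sum>A\<in>{A\<in>freq_sets J q. B \<subseteq> A}. (c A * slice_weight k (card B) (card (A - B))) * avg J (cyc q) (monom_at (A - B)))"
    unfolding slice_def avg_sum avg_cmult[symmetric] by (simp add: mult_ac)
  also have "\<dots> = (\<Sum>A\<in>{A\<in>freq_sets J q. B \<subseteq> A}. if A = B then (if card B = k then c B else 0) else 0)"
  proof (intro sum.cong refl)
    fix A assume A: "A \<in> {A\<in>freq_sets J q. B \<subseteq> A}"
    then have "A - B \<in> freq_sets J q" using freq_sets_subset[of A J q "A - B"] by blast
    moreover have "A - B = {} \<longleftrightarrow> A = B" using A by auto
    ultimately show "(c A * slice_weight k (card B) (card (A - B))) * avg J (cyc q) (monom_at (A - B))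
      = (if A = B then (if card B = k then c B else 0) else 0)"
      by (simp add: avg_monom[OF q J] slice_weight_0)
  qed
  also have "\<dots> = (if card B = k then c B else 0)"
    using B J by (simp add: sum.delta)
  finally show ?thesis .
qed

text \<open>By \<open>avg_slice\<close>, the part of order \<open>k\<close> is the average over
  \<open>y\<close> of the slices, so it inherits their bound. This treats the orders that are too
  small for Blei's inequality.\<close>

lemma homogeneous_part_bound:
  fixes J :: "nat set"
  assumes q: "q \<ge> 1" and J: "finite J" and b: "cyc_bounded J q c M"
    and c: "\<And>A. A \<in> freq_sets J q \<Longrightarrow> c A \<noteq> 0 \<Longrightarrow> card A \<le> d"
    and k: "1 \<le> k" "k \<le> d" and BH: "BH_poly_bound k q C"
  shows "(\<Sum>A\<in>{A\<in>freq_sets J q. card A = k}. cmod (c A) powr bh_exponent k) \<le> (C * (markov_const d k * M)) powr bh_exponent k"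
proof -
  define h where "h = (\<lambda>B. if card B = k then c B else 0)"
  have "cyc_bounded J q h (markov_const d k * M)"
    unfolding cyc_bounded_def
  proof (intro allI impI)
    fix x assume x: "\<forall>j\<in>J. x j \<in> cyc q"
    have "cyc_poly J q h x = avg J (cyc q) (\<lambda>y. cyc_poly J q (slice J q k c y) x)"
    proof -
      have "avg J (cyc q) (\<lambda>y. cyc_poly J q (slice J q k c y) x)
        = (\<Sum>A\<in>freq_sets J q. avg J (cyc q) (\<lambda>y. monom_at A x * slice J q k c y A))"
        unfolding cyc_poly_def avg_sum by (simp add: mult.commute)
      also have "\<dots> = cyc_poly J q h x"
        unfolding cyc_poly_def avg_cmult h_def
        by (intro sum.cong refl) (simp add: avg_slice[OF q J])
      finally show ?thesis by simp
    qed
    then have "cmod (cyc_poly J q h x) \<le> avg J (cyc q) (\<lambda>y. cmod (cyc_poly J q (slice J q k c y) x))"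
      by (simp only: norm_avg_le)
    also have "\<dots> \<le> avg J (cyc q) (\<lambda>y. markov_const d k * M)"
    proof (rule avg_mono)
      fix y assume "y \<in> PiE J (\<lambda>_. cyc q)"
      then have "\<And>j. j \<in> J \<Longrightarrow> y j \<in> cyc q" by (rule PiE_mem)
      from slice_bounded[OF J b c k this] show "cmod (cyc_poly J q (slice J q k c y) x) \<le> markov_const d k * M"
        using x by (simp add: cyc_bounded_def)
    qed
    also have "\<dots> = markov_const d k * M" using J q by (simp add: avg_const cyc_nonempty)
    finally show "cmod (cyc_poly J q h x) \<le> markov_const d k * M" .
  qed
  then have "(\<Sum>A\<in>freq_sets J q. cmod (h A) powr bh_exponent k) \<le> (C * (markov_const d k * M)) powr bh_exponent k"
    by (intro BH_poly_boundD[OF BH J]) (simp_all add: h_def split: if_splits)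
  moreover have "(\<Sum>A\<in>freq_sets J q. cmod (h A) powr bh_exponent k) = (\<Sum>A\<in>{A\<in>freq_sets J q. card A = k}. cmod (c A) powr bh_exponent k)"
    unfolding h_def using J by (intro sum.mono_neutral_cong_right) auto
  ultimately show ?thesis by simp
qed

section \<open>Orders at least \<open>k\<close>: mixed derivatives, hypercontractivity and Blei's
  inequality\<close>

lemma sum_supersets_reindex:
  assumes "T \<in> freq_sets J q"
  shows "(\<Sum>B\<in>{B\<in>freq_sets J q. B \<inter> T = {} \<and> B \<union> T \<in> freq_sets J q}. F (B \<union> T) B) = (\<Sum>A\<in>{A\<in>freq_sets J q. T \<subseteq> A}. F A (A - T))"
proof (rule sum.reindex_bij_witness[where i = "\<lambda>A. A - T" and j = "\<lambda>B. B \<union> T"])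
  fix B assume B: "B \<in> {B\<in>freq_sets J q. B \<inter> T = {} \<and> B \<union> T \<in> freq_sets J q}"
  then show e: "B \<union> T - T = B" by auto
  show "B \<union> T \<in> {A\<in>freq_sets J q. T \<subseteq> A}" using B by auto
  show "F (B \<union> T) (B \<union> T - T) = F (B \<union> T) B" unfolding e ..
next
  fix A assume A: "A \<in> {A\<in>freq_sets J q. T \<subseteq> A}"
  then show e: "A - T \<union> T = A" by auto
  show "A - T \<in> {B\<in>freq_sets J q. B \<inter> T = {} \<and> B \<union> T \<in> freq_sets J q}"
    unfolding mem_Collect_eq e using A freq_sets_subset[of A J q "A - T"] by auto
qed

text \<open>Hypercontractivity in \<open>y\<close> is used for each fixed \<open>T\<close>, the
  constant of order \<open>k\<close> in \<open>x\<close> for each fixed \<open>y\<close>. They fit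
  together because both use the exponent \<open>bh_exponent k\<close>, so the sum over
  \<open>T\<close> passes through the average over \<open>y\<close>.\<close>

lemma derivative_l2_bound:
  fixes J :: "nat set"
  assumes q: "q \<ge> 2" and J: "finite J" and K: "K \<ge> 2" "(1 - 2 / real q) * K = ln (real q - 1)"
    and b: "cyc_bounded J q c M"
    and c: "\<And>A. A \<in> freq_sets J q \<Longrightarrow> c A \<noteq> 0 \<Longrightarrow> card A \<le> d"
    and k: "1 \<le> k" "k \<le> d" and C: "C \<ge> 0" and BH: "BH_poly_bound k q C"
  shows "(\<Sum>T\<in>{T\<in>freq_sets J q. card T = k}. sqrt (\<Sum>A\<in>{A\<in>freq_sets J q. T \<subseteq> A}. (cmod (c A))^2) powr bh_exponent k)
    \<le> (exp (K * real d / (2 * real k)) * (C * (markov_const d k * M))) powr bh_exponent k"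
proof -
  have q1: "q \<ge> 1" using q by simp
  define pk where "pk = bh_exponent k"
  have pk: "0 < pk" "pk \<le> 2" "(2 - pk)/2 = 1 / (real k + 1)"
    unfolding pk_def bh_exponent_def using k by (auto simp: field_simps)
  define E where "E = exp (K * real d / (real k + 1))"
  define D where "D = (\<lambda>T y. \<Sum>A\<in>{A\<in>freq_sets J q. T \<subseteq> A}. c A * monom_at (A - T) y)"
  have hyp: "sqrt (\<Sum>A\<in>{A\<in>freq_sets J q. T \<subseteq> A}. (cmod (c A))^2) powr pk \<le> E * avg J (cyc q) (\<lambda>y. cmod (D T y) powr pk)"
    if T: "T \<in> freq_sets J q" for T
  proof -
    \<comment> \<open>The coefficients of \<open>D T\<close>, so that it becomes a
      \<open>cyc_poly\<close> itself. For \<open>card T = k\<close> its order is at most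
      \<open>d - k\<close>, but the cruder \<open>d\<close> raises the exponent by less than
      \<open>K\<close>.\<close>
    define e where "e = (\<lambda>B. if B \<inter> T = {} \<and> B \<union> T \<in> freq_sets J q then c (B \<union> T) else 0)"
    have "(\<Sum>B\<in>freq_sets J q. (cmod (e B))^2) = (\<Sum>B\<in>{B\<in>freq_sets J q. B \<inter> T = {} \<and> B \<union> T \<in> freq_sets J q}. (cmod (c (B \<union> T)))^2)"
      unfolding e_def using J by (intro sum.mono_neutral_cong_right) auto
    also have "\<dots> = (\<Sum>A\<in>{A\<in>freq_sets J q. T \<subseteq> A}. (cmod (c A))^2)"
      by (rule sum_supersets_reindex[OF T, of "\<lambda>A B. (cmod (c A))^2"])
    finally have s: "(\<Sum>B\<in>freq_sets J q. (cmod (e B))^2) = (\<Sum>A\<in>{A\<in>freq_sets J q. T \<subseteq> A}. (cmod (c A))^2)" .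
    have p: "cyc_poly J q e y = D T y" for y
    proof -
      have "cyc_poly J q e y = (\<Sum>B\<in>{B\<in>freq_sets J q. B \<inter> T = {} \<and> B \<union> T \<in> freq_sets J q}. c (B \<union> T) * monom_at B y)"
        unfolding e_def cyc_poly_def using J by (intro sum.mono_neutral_cong_right) auto
      also have "\<dots> = D T y" unfolding D_def
        by (rule sum_supersets_reindex[OF T, of "\<lambda>A B. c A * monom_at B y"])
      finally show ?thesis .
    qed
    have "(\<Sum>B\<in>freq_sets J q. (cmod (e B))^2) powr (pk/2)
      \<le> exp ((2-pk)/2 * (K * real d)) * avg J (cyc q) (\<lambda>y. cmod (cyc_poly J q e y) powr pk)"
    proof (rule hypercontractivity_cyc_poly[OF q J K _ pk(1,2)])
      fix B assume B: "B \<in> freq_sets J q" "e B \<noteq> 0"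
      then have BT: "B \<union> T \<in> freq_sets J q" "c (B \<union> T) \<noteq> 0" unfolding e_def by (auto split: if_splits)
      have "card B \<le> card (B \<union> T)" using freq_sets_finite[OF J BT(1)] by (intro card_mono) auto
      then show "card B \<le> d" using c[OF BT] by simp
    qed
    moreover have "(\<Sum>B\<in>freq_sets J q. (cmod (e B))^2) powr (pk/2) = sqrt (\<Sum>A\<in>{A\<in>freq_sets J q. T \<subseteq> A}. (cmod (c A))^2) powr pk"
      unfolding s by (simp add: powr_half_sqrt[symmetric] sum_nonneg powr_powr)
    ultimately show ?thesis unfolding p pk(3) E_def by simp
  qed
  have pt: "(\<Sum>T\<in>{T\<in>freq_sets J q. card T = k}. cmod (D T y) powr pk) \<le> (C * (markov_const d k * M)) powr pk"
    if "y \<in> PiE J (\<lambda>_. cyc q)" for y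
  proof -
    have y: "\<And>j. j \<in> J \<Longrightarrow> y j \<in> cyc q" using that by (rule PiE_mem)
    have "(\<Sum>T\<in>{T\<in>freq_sets J q. card T = k}. cmod (D T y) powr pk)
      = (\<Sum>T\<in>{T\<in>freq_sets J q. card T = k}. cmod (slice J q k c y T) powr pk)"
      by (intro sum.cong refl) (simp add: slice_eq D_def)
    also have "\<dots> \<le> (\<Sum>T\<in>freq_sets J q. cmod (slice J q k c y T) powr pk)"
      using J by (intro sum_mono2) auto
    also have "\<dots> \<le> (C * (markov_const d k * M)) powr pk"
      unfolding pk_def
    proof (rule BH_poly_boundD[OF BH J _ slice_bounded[OF J b c k y]])
      fix A assume "slice J q k c y A \<noteq> 0"
      then show "card A \<le> k" using slice_gt[of k A J q c y] by (cases "card A \<le> k") auto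
    qed
    finally show ?thesis .
  qed
  have "(\<Sum>T\<in>{T\<in>freq_sets J q. card T = k}. sqrt (\<Sum>A\<in>{A\<in>freq_sets J q. T \<subseteq> A}. (cmod (c A))^2) powr pk)
    \<le> (\<Sum>T\<in>{T\<in>freq_sets J q. card T = k}. E * avg J (cyc q) (\<lambda>y. cmod (D T y) powr pk))"
    by (intro sum_mono hyp) simp
  also have "\<dots> = E * avg J (cyc q) (\<lambda>y. \<Sum>T\<in>{T\<in>freq_sets J q. card T = k}. cmod (D T y) powr pk)"
    by (simp add: avg_sum sum_distrib_left)
  also have "\<dots> \<le> E * avg J (cyc q) (\<lambda>y. (C * (markov_const d k * M)) powr pk)"
    by (intro mult_left_mono avg_mono pt) (simp_all add: E_def)
  also have "\<dots> = E * (C * (markov_const d k * M)) powr pk"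
    using J q1 by (simp add: avg_const cyc_nonempty)
  also have "E = exp (K * real d / (2 * real k)) powr pk"
  proof -
    have "K * real d / (2 * real k) * pk = K * real d / (real k + 1)"
      unfolding pk_def bh_exponent_def using k by (simp add: field_simps)
    then show ?thesis unfolding E_def by (simp add: powr_def mult.commute)
  qed
  also have "exp (K * real d / (2 * real k)) powr pk * (C * (markov_const d k * M)) powr pk
      = (exp (K * real d / (2 * real k)) * (C * (markov_const d k * M))) powr pk"
    using C markov_const_nonneg cyc_bounded_nonneg[OF q1 b] by (simp add: powr_mult)
  finally show ?thesis unfolding pk_def .
qed

text \<open>Blei's inequality on the ground set of all pairs \<open>(j, v)\<close>. Subsets of this
  set need not be frequencies, since a coordinate may occur twice.\<close>

lemma high_level_bound:
  fixes J :: "nat set"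
  assumes q: "q \<ge> 2" and J: "finite J" and K: "K \<ge> 2" "(1 - 2 / real q) * K = ln (real q - 1)"
    and b: "cyc_bounded J q c M"
    and c: "\<And>A. A \<in> freq_sets J q \<Longrightarrow> c A \<noteq> 0 \<Longrightarrow> card A \<le> d"
    and k: "1 \<le> k" "k \<le> d" and C: "C \<ge> 0" and BH: "BH_poly_bound k q C" and m: "k \<le> m"
  shows "(\<Sum>A\<in>{A\<in>freq_sets J q. card A = m}. cmod (c A) powr bh_exponent m)
    \<le> (exp (K * real d / (2 * real k)) * (C * (markov_const d k * M))) powr bh_exponent m"
proof -
  define V where "V = J \<times> {1..<q}"
  have V: "finite V" using J by (simp add: V_def)
  have q1: "q \<ge> 1" using q by simp
  \<comment> \<open>Extension by zero is harmless: a set \<open>T\<close> that is no frequency has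
    no frequency above it, so it contributes nothing at level \<open>k\<close> either.\<close>
  define a where "a = (\<lambda>A. if A \<in> freq_sets J q then cmod (c A) else 0)"
  define L where "L = exp (K * real d / (2 * real k)) * (C * (markov_const d k * M))"
  have L: "L \<ge> 0" unfolding L_def using C markov_const_nonneg cyc_bounded_nonneg[OF q1 b] by simp
  have freq: "{A\<in>ksubsets V n. A \<in> freq_sets J q} = {A\<in>freq_sets J q. card A = n}" for n
    by (auto simp: ksubsets_def V_def freq_sets_def)
  have pk0: "bh_exponent k > 0" "bh_exponent m > 0" using k m by (auto intro: bh_exponent_pos)
  have "(\<Sum>A\<in>ksubsets V m. a A powr bh_exponent m) \<le> L powr bh_exponent m"
  proof (rule blei_ksubsets[OF V k(1) m _ L])
    show "a T \<ge> 0" for T by (simp add: a_def)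
    have "(\<Sum>T\<in>ksubsets V k. sqrt (\<Sum>A\<in>{A\<in>ksubsets V m. T \<subseteq> A}. (a A)^2) powr bh_exponent k)
      \<le> (\<Sum>T\<in>ksubsets V k. if T \<in> freq_sets J q then sqrt (\<Sum>A\<in>{A\<in>freq_sets J q. T \<subseteq> A}. (cmod (c A))^2) powr bh_exponent k else 0)"
    proof (rule sum_mono)
      fix T
      have e: "(\<Sum>A\<in>{A\<in>ksubsets V m. T \<subseteq> A}. (a A)^2) = (\<Sum>A\<in>{A\<in>ksubsets V m. T \<subseteq> A \<and> A \<in> freq_sets J q}. (cmod (c A))^2)"
        unfolding a_def using V by (intro sum.mono_neutral_cong_right) auto
      show "sqrt (\<Sum>A\<in>{A\<in>ksubsets V m. T \<subseteq> A}. (a A)^2) powr bh_exponent k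
        \<le> (if T \<in> freq_sets J q then sqrt (\<Sum>A\<in>{A\<in>freq_sets J q. T \<subseteq> A}. (cmod (c A))^2) powr bh_exponent k else 0)"
      proof (cases "T \<in> freq_sets J q")
        case True
        have "(\<Sum>A\<in>{A\<in>ksubsets V m. T \<subseteq> A}. (a A)^2) \<le> (\<Sum>A\<in>{A\<in>freq_sets J q. T \<subseteq> A}. (cmod (c A))^2)"
          unfolding e using J by (intro sum_mono2) auto
        then have "sqrt (\<Sum>A\<in>{A\<in>ksubsets V m. T \<subseteq> A}. (a A)^2) powr bh_exponent k \<le> sqrt (\<Sum>A\<in>{A\<in>freq_sets J q. T \<subseteq> A}. (cmod (c A))^2) powr bh_exponent k"
          using pk0 by (intro powr_mono2) (auto simp: sum_nonneg)
        then show ?thesis using True by simp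
      next
        case False
        have "{A\<in>ksubsets V m. T \<subseteq> A \<and> A \<in> freq_sets J q} = {}" using False freq_sets_subset by blast
        then show ?thesis unfolding e using False by (simp only: sum.empty real_sqrt_zero powr_0 if_False order_refl)
      qed
    qed
    also have "\<dots> = (\<Sum>T\<in>{T\<in>freq_sets J q. card T = k}. sqrt (\<Sum>A\<in>{A\<in>freq_sets J q. T \<subseteq> A}. (cmod (c A))^2) powr bh_exponent k)"
      unfolding freq[symmetric] using V by (simp add: sum.inter_filter)
    also have "\<dots> \<le> L powr bh_exponent k"
      unfolding L_def by (rule derivative_l2_bound[OF q J K b c k C BH])
    finally show "(\<Sum>T\<in>ksubsets V k. sqrt (\<Sum>A\<in>{A\<in>ksubsets V m. T \<subseteq> A}. (a A)^2) powr bh_exponent k) \<le> L powr bh_exponent k" .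
  qed
  moreover have "(\<Sum>A\<in>ksubsets V m. a A powr bh_exponent m) = (\<Sum>A\<in>{A\<in>freq_sets J q. card A = m}. cmod (c A) powr bh_exponent m)"
    unfolding freq[symmetric] a_def using V pk0 by (intro sum.mono_neutral_cong_right) auto
  ultimately show ?thesis unfolding L_def by simp
qed

section \<open>Assembling the orders into the recursion\<close>

lemma bh_exponent_mono: "m \<le> d \<Longrightarrow> bh_exponent m \<le> bh_exponent d"
  unfolding bh_exponent_def by (simp add: divide_simps) (simp add: algebra_simps)

text \<open>The norm of exponent \<open>r\<close> is at most that of exponent \<open>p\<close>. It
  moves the bound for order \<open>m\<close>, proved with \<open>bh_exponent m\<close>, to the
  common exponent \<open>bh_exponent d\<close>.\<close>

lemma sum_powr_exponent_mono:
  fixes f :: "'a \<Rightarrow> real"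
  assumes "finite S" "\<And>i. i \<in> S \<Longrightarrow> f i \<ge> 0" "t \<ge> 0" "0 < p" "p \<le> r" "(\<Sum>i\<in>S. f i powr p) \<le> t powr p"
  shows "(\<Sum>i\<in>S. f i powr r) \<le> t powr r"
proof -
  have le: "f i \<le> t" if i: "i \<in> S" for i
  proof (rule ccontr)
    assume "\<not> f i \<le> t"
    then have "t powr p < f i powr p" using assms by (intro powr_less_mono2) auto
    also have "\<dots> \<le> (\<Sum>i\<in>S. f i powr p)" using assms i by (intro member_le_sum) auto
    finally show False using assms by simp
  qed
  show ?thesis
  proof (cases "t = 0")
    case True
    then have "f i = 0" if "i \<in> S" for i using le[OF that] assms(2)[OF that] by simp
    then show ?thesis using True by simp
  next
    case False
    then have t: "t > 0" using assms by simp
    have "f i powr r \<le> t powr (r - p) * f i powr p" if i: "i \<in> S" for i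
    proof (cases "f i = 0")
      case True
      then show ?thesis by simp
    next
      case False
      then have "f i > 0" using assms(2)[OF i] by simp
      then have "f i powr r = f i powr (r - p) * f i powr p" by (simp flip: powr_add)
      also have "\<dots> \<le> t powr (r - p) * f i powr p"
        using le[OF i] \<open>f i > 0\<close> assms by (intro mult_right_mono powr_mono2) auto
      finally show ?thesis .
    qed
    then have "(\<Sum>i\<in>S. f i powr r) \<le> t powr (r - p) * (\<Sum>i\<in>S. f i powr p)"
      unfolding sum_distrib_left by (rule sum_mono)
    also have "\<dots> \<le> t powr (r - p) * t powr p" using assms by (intro mult_left_mono) auto
    also have "\<dots> = t powr r" using t by (simp flip: powr_add)
    finally show ?thesis .
  qed
qed

lemma norm_constant_coeff_le:
  assumes q: "q \<ge> 1" and J: "finite J" and b: "cyc_bounded J q c M"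
  shows "cmod (c {}) \<le> M"
proof -
  have "c {} = avg J (cyc q) (cyc_poly J q c)"
  proof -
    have "avg J (cyc q) (cyc_poly J q c) = (\<Sum>A\<in>freq_sets J q. c A * avg J (cyc q) (monom_at A))"
      unfolding cyc_poly_def[abs_def] avg_sum avg_cmult by simp
    also have "\<dots> = (\<Sum>A\<in>freq_sets J q. if A = {} then c {} else 0)"
      by (intro sum.cong refl) (simp add: avg_monom[OF q J])
    also have "\<dots> = c {}" using J by (simp add: freq_sets_def[of J q])
    finally show ?thesis by simp
  qed
  then have "cmod (c {}) \<le> avg J (cyc q) (\<lambda>x. cmod (cyc_poly J q c x))" by (simp only: norm_avg_le)
  also have "\<dots> \<le> avg J (cyc q) (\<lambda>x. M)"
    by (rule avg_mono) (rule cyc_boundedD[OF b], rule PiE_mem)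
  also have "\<dots> = M" using J q by (simp add: avg_const cyc_nonempty)
  finally show ?thesis .
qed

text \<open>Every order \<open>m \<le> d\<close> is bounded separately by \<open>L * M\<close>:
  orders up to \<open>k\<close> through their homogeneous part, which needs the constant of order
  \<open>m\<close> itself, and larger orders through level \<open>k\<close>. Adding the
  \<open>d + 1\<close> orders gives the prefactor.\<close>

lemma BH_recursion:
  assumes q: "q \<ge> 2" and K: "K \<ge> 2" "(1 - 2 / real q) * K = ln (real q - 1)"
    and k: "1 \<le> k" "k \<le> d"
    and C: "\<And>m. 1 \<le> m \<Longrightarrow> m \<le> k \<Longrightarrow> C m \<ge> 0" and BH: "\<And>m. 1 \<le> m \<Longrightarrow> m \<le> k \<Longrightarrow> BH_poly_bound m q (C m)"
    and L: "\<And>m. 1 \<le> m \<Longrightarrow> m \<le> k \<Longrightarrow> exp (K * real d / (2 * real k)) * (C m * markov_const d m) \<le> L" and L1: "L \<ge> 1"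
  shows "BH_poly_bound d q ((real d + 1) * L)"
  unfolding BH_poly_bound_def
proof (intro allI impI)
  fix J :: "nat set" and c and M :: real
  assume J: "finite J" and c0: "\<forall>A\<in>freq_sets J q. c A \<noteq> 0 \<longrightarrow> card A \<le> d" and b: "cyc_bounded J q c M"
  have c: "\<And>A. A \<in> freq_sets J q \<Longrightarrow> c A \<noteq> 0 \<Longrightarrow> card A \<le> d" using c0 by blast
  have q1: "q \<ge> 1" using q by simp
  have M: "M \<ge> 0" by (rule cyc_bounded_nonneg[OF q1 b])
  define t where "t = L * M"
  have t0: "t \<ge> 0" using L1 M by (simp add: t_def)
  have d: "d \<ge> 1" using k by simp
  define p where "p = bh_exponent d"
  have p: "p \<ge> 1" unfolding p_def bh_exponent_def using d by (simp add: field_simps)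
  have level: "(\<Sum>A\<in>{A\<in>freq_sets J q. card A = m}. cmod (c A) powr p) \<le> t powr p" if m: "m \<le> d" for m
  \<comment> \<open>The constant term is treated apart because
    \<open>bh_exponent 0 = 0\<close>.\<close>
  proof (cases "m = 0")
    case True
    have e: "{A\<in>freq_sets J q. card A = m} = {{}}"
      using True J by (auto simp: freq_sets_def dest: finite_subset)
    have "cmod (c {}) \<le> M" by (rule norm_constant_coeff_le[OF q1 J b])
    also have "\<dots> \<le> t" using L1 M by (simp add: t_def mult_le_cancel_right1)
    finally have "cmod (c {}) \<le> t" .
    then show ?thesis unfolding e using p by (simp add: powr_mono2)
  next
    case False
    then have m1: "m \<ge> 1" by simp
    have "(\<Sum>A\<in>{A\<in>freq_sets J q. card A = m}. cmod (c A) powr bh_exponent m) \<le> t powr bh_exponent m"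
    proof (cases "m \<le> k")
      case True
      have "(\<Sum>A\<in>{A\<in>freq_sets J q. card A = m}. cmod (c A) powr bh_exponent m) \<le> (C m * (markov_const d m * M)) powr bh_exponent m"
        by (rule homogeneous_part_bound[OF q1 J b c m1 m BH[OF m1 True]])
      also have "\<dots> \<le> t powr bh_exponent m"
      proof (intro powr_mono2)
        have "1 * (C m * markov_const d m) \<le> exp (K * real d / (2 * real k)) * (C m * markov_const d m)"
          using C[OF m1 True] markov_const_nonneg K by (intro mult_right_mono) auto
        then have "C m * markov_const d m \<le> L" using L[OF m1 True] by simp
        then show "C m * (markov_const d m * M) \<le> t"
          unfolding t_def mult.assoc[symmetric] using M by (rule mult_right_mono)
      qed (use bh_exponent_pos[OF m1] C[OF m1 True] markov_const_nonneg M in auto)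
      finally show ?thesis .
    next
      case False
      have kk: "1 \<le> k" "k \<le> k" using k by auto
      have "(\<Sum>A\<in>{A\<in>freq_sets J q. card A = m}. cmod (c A) powr bh_exponent m)
        \<le> (exp (K * real d / (2 * real k)) * (C k * (markov_const d k * M))) powr bh_exponent m"
        using high_level_bound[OF q J K b c k C[OF kk] BH[OF kk], of m] False by simp
      also have "\<dots> \<le> t powr bh_exponent m"
      proof (intro powr_mono2)
        show "exp (K * real d / (2 * real k)) * (C k * (markov_const d k * M)) \<le> t"
          using mult_right_mono[OF L[OF kk] M] by (simp add: t_def mult.assoc)
      qed (use bh_exponent_pos[OF m1] C[OF kk] markov_const_nonneg M in auto)
      finally show ?thesis .
    qed
    then show ?thesis unfolding p_def
      by (rule sum_powr_exponent_mono[rotated 5]) (use J t0 bh_exponent_pos[OF m1] bh_exponent_mono[OF m] in auto)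
  qed
  have "(\<Sum>A\<in>freq_sets J q. cmod (c A) powr p) = (\<Sum>A\<in>{A\<in>freq_sets J q. card A \<le> d}. cmod (c A) powr p)"
    using J c by (intro sum.mono_neutral_right) auto
  also have "\<dots> = (\<Sum>m\<le>d. \<Sum>A\<in>{A\<in>{A\<in>freq_sets J q. card A \<le> d}. card A = m}. cmod (c A) powr p)"
    using J by (intro sum.group[symmetric]) auto
  also have "\<dots> \<le> (\<Sum>m\<le>d. t powr p)"
  proof (rule sum_mono)
    fix m assume m: "m \<in> {..d}"
    then have "{A\<in>{A\<in>freq_sets J q. card A \<le> d}. card A = m} = {A\<in>freq_sets J q. card A = m}" by auto
    then show "(\<Sum>A\<in>{A\<in>{A\<in>freq_sets J q. card A \<le> d}. card A = m}. cmod (c A) powr p) \<le> t powr p"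
      using level[of m] m by simp
  qed
  also have "\<dots> = (real d + 1) * t powr p" by simp
  \<comment> \<open>As \<open>p \<ge> 1\<close>, the number of orders may be absorbed into the
    power.\<close>
  also have "\<dots> \<le> (real d + 1) powr p * t powr p"
  proof (intro mult_right_mono)
    have "(real d + 1) powr 1 \<le> (real d + 1) powr p" using p by (intro powr_mono) auto
    then show "real d + 1 \<le> (real d + 1) powr p" by simp
  qed simp
  also have "\<dots> = ((real d + 1) * L * M) powr p" using t0 by (simp add: powr_mult t_def mult.assoc)
  finally show "(\<Sum>A\<in>freq_sets J q. cmod (c A) powr bh_exponent d) \<le> ((real d + 1) * L * M) powr bh_exponent d"
    unfolding p_def .
qed

subsection \<open>The crude bound and the choice of the parameter\<close>

lemma BH_poly_bound_mono:
  assumes "BH_poly_bound d q C" "0 \<le> C" "C \<le> C'" "q \<ge> 1" "d \<ge> 1"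
  shows "BH_poly_bound d q C'"
  unfolding BH_poly_bound_def
proof (intro allI impI)
  fix J :: "nat set" and c and M :: real
  assume J: "finite J" and c: "\<forall>A\<in>freq_sets J q. c A \<noteq> 0 \<longrightarrow> card A \<le> d" and b: "cyc_bounded J q c M"
  have M: "M \<ge> 0" by (rule cyc_bounded_nonneg[OF assms(4) b])
  have "(\<Sum>A\<in>freq_sets J q. cmod (c A) powr bh_exponent d) \<le> (C * M) powr bh_exponent d"
    by (rule BH_poly_boundD[OF assms(1) J _ b]) (use c in blast)
  also have "\<dots> \<le> (C' * M) powr bh_exponent d"
    using assms M bh_exponent_pos[of d] by (intro powr_mono2 mult_right_mono) auto
  finally show "(\<Sum>A\<in>freq_sets J q. cmod (c A) powr bh_exponent d) \<le> (C' * M) powr bh_exponent d" .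
qed

section \<open>The constant of order one\<close>

lemma sum_freq_sets_le_1:
  fixes F :: "('i \<times> nat) set \<Rightarrow> 'b::comm_monoid_add"
  assumes J: "finite J" and F: "\<And>A. A \<in> freq_sets J q \<Longrightarrow> F A \<noteq> 0 \<Longrightarrow> card A \<le> 1"
  shows "(\<Sum>A\<in>freq_sets J q. F A) = F {} + (\<Sum>j\<in>J. \<Sum>v\<in>{1..<q}. F {(j, v)})"
proof -
  define S where "S = (\<lambda>p. {p}) ` (J \<times> {1..<q})"
  have "(\<Sum>A\<in>freq_sets J q. F A) = (\<Sum>A\<in>insert {} S. F A)"
  proof (rule sum.mono_neutral_right)
    show "insert {} S \<subseteq> freq_sets J q" by (auto simp: S_def freq_sets_def)
    show "\<forall>A\<in>freq_sets J q - insert {} S. F A = 0"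
    proof (rule ballI, rule ccontr)
      fix A assume A: "A \<in> freq_sets J q - insert {} S" and "F A \<noteq> 0"
      then have "card A \<le> 1" using F by blast
      moreover have "finite A" using A freq_sets_finite[OF J] by blast
      ultimately have "A = {} \<or> (\<exists>p. A = {p})"
        by (cases "card A = 0") (auto simp: card_1_singleton_iff le_Suc_eq)
      then show False using A by (auto simp: S_def freq_sets_def)
    qed
  qed (use J in simp)
  also have "\<dots> = F {} + (\<Sum>A\<in>S. F A)" using J by (subst sum.insert) (auto simp: S_def)
  also have "(\<Sum>A\<in>S. F A) = (\<Sum>p\<in>J \<times> {1..<q}. F {p})"
    unfolding S_def by (subst sum.reindex) (auto simp: inj_on_def)
  also have "\<dots> = (\<Sum>j\<in>J. \<Sum>v\<in>{1..<q}. F {(j, v)})"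
    by (simp add: sum.cartesian_product)
  finally show ?thesis .
qed

definition coord_part :: "nat \<Rightarrow> (('i \<times> nat) set \<Rightarrow> complex) \<Rightarrow> 'i \<Rightarrow> complex \<Rightarrow> complex" where
  "coord_part q c j w = (\<Sum>v\<in>{1..<q}. c {(j, v)} * w ^ v)"

text \<open>With order at most one the coordinates decouple, so all real parts can be maximized
  simultaneously at a single point of the group; \<open>2 * M\<close> accounts for removing the
  constant term.\<close>

lemma sum_max_Re_coord_part:
  assumes q: "q \<ge> 1" and J: "finite J" and b: "cyc_bounded J q c M"
    and c: "\<And>A. A \<in> freq_sets J q \<Longrightarrow> c A \<noteq> 0 \<Longrightarrow> card A \<le> 1"
  shows "(\<Sum>j\<in>J. Max ((\<lambda>w. Re (coord_part q c j w)) ` cyc q)) \<le> 2 * M"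
proof -
  have "\<exists>w. w \<in> cyc q \<and> Re (coord_part q c j w) = Max ((\<lambda>w. Re (coord_part q c j w)) ` cyc q)" for j
  proof -
    have "Max ((\<lambda>w. Re (coord_part q c j w)) ` cyc q) \<in> (\<lambda>w. Re (coord_part q c j w)) ` cyc q"
      using cyc_nonempty[OF q] by (intro Max_in) auto
    then show ?thesis by auto
  qed
  then obtain x where "\<forall>j. x j \<in> cyc q \<and> Re (coord_part q c j (x j)) = Max ((\<lambda>w. Re (coord_part q c j w)) ` cyc q)"
    using choice[of "\<lambda>j w. w \<in> cyc q \<and> Re (coord_part q c j w) = Max ((\<lambda>w. Re (coord_part q c j w)) ` cyc q)"] by blast
  then have x: "\<And>j. x j \<in> cyc q" "\<And>j. Re (coord_part q c j (x j)) = Max ((\<lambda>w. Re (coord_part q c j w)) ` cyc q)"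
    by blast+
  have ev: "cyc_poly J q c y = c {} + (\<Sum>j\<in>J. coord_part q c j (y j))" for y
  proof -
    have "cyc_poly J q c y = c {} * monom_at {} y + (\<Sum>j\<in>J. \<Sum>v\<in>{1..<q}. c {(j, v)} * monom_at {(j, v)} y)"
      unfolding cyc_poly_def by (rule sum_freq_sets_le_1[OF J]) (use c in auto)
    then show ?thesis by (simp add: coord_part_def monom_at_def)
  qed
  have empty: "cmod (c {}) \<le> M" by (rule norm_constant_coeff_le[OF q J b])
  have "(\<Sum>j\<in>J. Max ((\<lambda>w. Re (coord_part q c j w)) ` cyc q)) = Re (cyc_poly J q c x) - Re (c {})"
    unfolding ev by (simp add: x(2))
  also have "\<dots> \<le> M + M"
  proof -
    have "Re (cyc_poly J q c x) \<le> cmod (cyc_poly J q c x)" by (rule complex_Re_le_cmod)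
    also have "\<dots> \<le> M" by (rule cyc_boundedD[OF b]) (rule x(1))
    finally have "Re (cyc_poly J q c x) \<le> M" .
    moreover have "\<bar>Re (c {})\<bar> \<le> cmod (c {})" by (rule abs_Re_le_cmod)
    ultimately show ?thesis using empty by linarith
  qed
  finally show ?thesis by simp
qed

text \<open>Simultaneous maximization controls only one-sided maxima. A vanishing sum turns such a
  bound into a two-sided one, since a very negative value must be compensated by the other
  \<open>card \<Omega> - 1\<close> points.\<close>

lemma abs_le_card_mult_Max:
  fixes g :: "'a \<Rightarrow> real"
  assumes \<Omega>: "finite \<Omega>" "card \<Omega> \<ge> 2" and s: "(\<Sum>\<omega>\<in>\<Omega>. g \<omega>) = 0" and w: "\<omega> \<in> \<Omega>"
  shows "\<bar>g \<omega>\<bar> \<le> (real (card \<Omega>) - 1) * Max (g ` \<Omega>)"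
proof -
  define m where "m = Max (g ` \<Omega>)"
  have le: "g \<eta> \<le> m" if "\<eta> \<in> \<Omega>" for \<eta> unfolding m_def using \<Omega> that by (intro Max_ge) auto
  have "0 \<le> (\<Sum>\<eta>\<in>\<Omega>. m)" unfolding s[symmetric] by (intro sum_mono le)
  then have m0: "m \<ge> 0" using \<Omega> by (auto simp: zero_le_mult_iff)
  have "- g \<omega> = (\<Sum>\<eta>\<in>\<Omega> - {\<omega>}. g \<eta>)" using s sum.remove[OF \<Omega>(1) w, of g] by simp
  also have "\<dots> \<le> (\<Sum>\<eta>\<in>\<Omega> - {\<omega>}. m)" by (intro sum_mono le) auto
  also have "\<dots> = (real (card \<Omega>) - 1) * m" using \<Omega> w by (simp add: of_nat_diff)
  finally have "- g \<omega> \<le> (real (card \<Omega>) - 1) * m" .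
  moreover have "1 * m \<le> (real (card \<Omega>) - 1) * m" using \<Omega> m0 by (intro mult_right_mono) auto
  then have "g \<omega> \<le> (real (card \<Omega>) - 1) * m" using le[OF w] by simp
  ultimately show ?thesis unfolding m_def by linarith
qed

text \<open>The exponent is 1, so absolute sums are needed. In the constant, 1 is the constant term;
  one factor \<open>q - 1\<close> is the loss from one-sided to two-sided bounds, the other counts
  the exponents \<open>v\<close>; and 4 is twice the \<open>2 * M\<close> of
  \<open>sum_max_Re_coord_part\<close>, for real and imaginary parts.\<close>

lemma BH_poly_bound_1:
  assumes q: "q \<ge> 2"
  shows "BH_poly_bound 1 q (1 + 4 * (real q - 1)^2)"
  unfolding BH_poly_bound_def
proof (intro allI impI)
  fix J :: "nat set" and c and M :: real
  assume J: "finite J" and c0: "\<forall>A\<in>freq_sets J q. c A \<noteq> 0 \<longrightarrow> card A \<le> 1" and b: "cyc_bounded J q c M"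
  have c: "\<And>A. A \<in> freq_sets J q \<Longrightarrow> c A \<noteq> 0 \<Longrightarrow> card A \<le> 1" using c0 by blast
  have q1: "q \<ge> 1" using q by simp
  have M: "M \<ge> 0" by (rule cyc_bounded_nonneg[OF q1 b])
  define Q where "Q = real q - 1"
  have Q: "Q \<ge> 1" using q by (simp add: Q_def)
  \<comment> \<open>Rotation by \<open>- \<i>\<close> turns imaginary parts into real parts, so the
    one-sided argument covers both.\<close>
  define c' where "c' = (\<lambda>A. - \<i> * c A)"
  have cp': "coord_part q c' j w = - \<i> * coord_part q c j w" for j w
    unfolding coord_part_def c'_def by (simp add: sum_distrib_left sum_negf mult_ac)
  have b': "cyc_bounded J q c' M"
  proof -
    have "cyc_poly J q c' x = - \<i> * cyc_poly J q c x" for x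
      unfolding cyc_poly_def c'_def by (simp add: sum_distrib_left sum_negf mult_ac)
    then show ?thesis using b by (simp add: cyc_bounded_def norm_mult)
  qed
  have c1: "\<And>A. A \<in> freq_sets J q \<Longrightarrow> c' A \<noteq> 0 \<Longrightarrow> card A \<le> 1" using c by (simp add: c'_def)
  define r where "r = (\<lambda>(c :: (nat \<times> nat) set \<Rightarrow> complex) j. Max ((\<lambda>w. Re (coord_part q c j w)) ` cyc q))"
  have zero: "(\<Sum>w\<in>cyc q. coord_part q c j w) = 0" for c :: "(nat \<times> nat) set \<Rightarrow> complex" and j
  proof -
    have "mean (cyc q) (\<lambda>w. coord_part q c j w) = (\<Sum>v\<in>{1..<q}. c {(j, v)} * mean (cyc q) (\<lambda>w. w ^ v))"
      unfolding coord_part_def mean_sum mean_cmult ..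
    also have "\<dots> = 0"
    proof (rule sum.neutral, rule ballI)
      fix v assume "v \<in> {1..<q}"
      then show "c {(j, v)} * mean (cyc q) (\<lambda>w. w ^ v) = 0"
        using mean_cyc_orthogonal[OF q1, of v 0] by simp
    qed
    finally show ?thesis using q by (simp add: mean_def card_cyc)
  qed
  have Re_le: "\<bar>Re (coord_part q c j w)\<bar> \<le> Q * r c j" if "w \<in> cyc q" for c :: "(nat \<times> nat) set \<Rightarrow> complex" and j w
  proof -
    have "(\<Sum>w\<in>cyc q. Re (coord_part q c j w)) = 0"
      using arg_cong[OF zero[of c j], of Re] by simp
    from abs_le_card_mult_Max[OF finite_cyc _ this that] show ?thesis
      using q by (simp add: card_cyc r_def Q_def)
  qed
  have cp_le: "cmod (coord_part q c j w) \<le> Q * (r c j + r c' j)" if w: "w \<in> cyc q" for j w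
  proof -
    have "cmod (coord_part q c j w) \<le> \<bar>Re (coord_part q c j w)\<bar> + \<bar>Im (coord_part q c j w)\<bar>" by (rule cmod_le)
    also have "Im (coord_part q c j w) = Re (coord_part q c' j w)" unfolding cp' by simp
    finally show ?thesis using Re_le[OF w, of c j] Re_le[OF w, of c' j] by (simp add: distrib_left)
  qed
  have coeff_le: "cmod (c {(j, v)}) \<le> Q * (r c j + r c' j)" if v: "v \<in> {1..<q}" for j v
  proof -
    have "mean (cyc q) (\<lambda>w. coord_part q c j w * cnj (w ^ v)) = mean (cyc q) (\<lambda>w. \<Sum>u\<in>{1..<q}. c {(j, u)} * (w ^ u * cnj (w ^ v)))"
      unfolding coord_part_def by (simp only: sum_distrib_right mult.assoc)
    also have "\<dots> = (\<Sum>u\<in>{1..<q}. c {(j, u)} * mean (cyc q) (\<lambda>w. w ^ u * cnj (w ^ v)))"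
      unfolding mean_sum mean_cmult ..
    also have "\<dots> = (\<Sum>u\<in>{1..<q}. if u = v then c {(j, v)} else 0)"
    proof (intro sum.cong refl)
      fix u assume "u \<in> {1..<q}"
      then show "c {(j, u)} * mean (cyc q) (\<lambda>w. w ^ u * cnj (w ^ v)) = (if u = v then c {(j, v)} else 0)"
        using mean_cyc_orthogonal[OF q1, of u v] v by simp
    qed
    also have "\<dots> = c {(j, v)}" using v by simp
    finally have eq: "mean (cyc q) (\<lambda>w. coord_part q c j w * cnj (w ^ v)) = c {(j, v)}" .
    have "cmod (c {(j, v)}) \<le> mean (cyc q) (\<lambda>w. cmod (coord_part q c j w * cnj (w ^ v)))"
      unfolding eq[symmetric] by (rule norm_mean_le)
    also have "\<dots> \<le> mean (cyc q) (\<lambda>w. Q * (r c j + r c' j))"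
      by (rule mean_mono) (simp add: norm_mult norm_power norm_cyc cp_le)
    also have "\<dots> = Q * (r c j + r c' j)" using q1 by (intro mean_const cyc_nonempty) simp_all
    finally show ?thesis .
  qed
  have "(\<Sum>A\<in>freq_sets J q. cmod (c A)) = cmod (c {}) + (\<Sum>j\<in>J. \<Sum>v\<in>{1..<q}. cmod (c {(j, v)}))"
    by (rule sum_freq_sets_le_1[OF J]) (use c in simp)
  also have "\<dots> \<le> M + (\<Sum>j\<in>J. \<Sum>v\<in>{1..<q}. Q * (r c j + r c' j))"
    by (intro add_mono sum_mono coeff_le norm_constant_coeff_le[OF q1 J b])
  also have "\<dots> = M + Q\<^sup>2 * ((\<Sum>j\<in>J. r c j) + (\<Sum>j\<in>J. r c' j))"
  proof -
    have "real (card {1..<q}) = Q" using q by (simp add: Q_def of_nat_diff)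
    then show ?thesis by (simp add: sum_distrib_left sum.distrib distrib_left power2_eq_square mult.assoc)
  qed
  also have "\<dots> \<le> M + Q\<^sup>2 * (2 * M + 2 * M)"
    using sum_max_Re_coord_part[OF q1 J b c] sum_max_Re_coord_part[OF q1 J b' c1]
    unfolding r_def by (intro add_left_mono mult_left_mono add_mono) simp_all
  also have "\<dots> = (1 + 4 * (real q - 1)^2) * M" by (simp add: Q_def algebra_simps)
  finally have "(\<Sum>A\<in>freq_sets J q. cmod (c A)) \<le> (1 + 4 * (real q - 1)^2) * M" .
  moreover have "bh_exponent 1 = 1" by (simp add: bh_exponent_def)
  ultimately show "(\<Sum>A\<in>freq_sets J q. cmod (c A) powr bh_exponent 1) \<le> ((1 + 4 * (real q - 1)^2) * M) powr bh_exponent 1"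
    using M by simp
qed

text \<open>With \<open>k = d div 2\<close> the ratio \<open>d/k\<close> is bounded and the
  inherited exponent is at most \<open>C * d / 2\<close>. The other half of \<open>C * d\<close> has
  to absorb all new losses, which are linear in \<open>d\<close>.\<close>

lemma BH_poly_bound_exponential:
  assumes q: "q \<ge> 2" and K: "K \<ge> 2" "(1 - 2 / real q) * K = ln (real q - 1)"
  obtains C where "C \<ge> 0" "\<And>d. d \<ge> 1 \<Longrightarrow> BH_poly_bound d q (exp (C * real d))"
proof -
  \<comment> \<open>The logarithm covers \<open>d = 1\<close>. The rest is twice the new loss
    \<open>10 * d + 3 * K / 2\<close>, made up of 9 from \<open>markov_const\<close> (2 + 5 + 2), 1
    from the prefactor \<open>d + 1\<close>, and the hypercontractive term with
    \<open>d \<le> 3 * k\<close>.\<close>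
  define C where "C = ln (1 + 4 * (real q - 1)^2) + 20 + 3 * K"
  have l0: "ln (1 + 4 * (real q - 1)^2) \<ge> 0" by (intro ln_ge_zero) simp
  have C: "C \<ge> 20 + 3 * K" "C \<ge> 0" using l0 K by (simp_all add: C_def)
  have "BH_poly_bound d q (exp (C * real d))" if "d \<ge> 1" for d
    using that
  proof (induction d rule: less_induct)
    case (less d)
    show ?case
    proof (cases "d = 1")
      case True
      have "1 + 4 * (real q - 1)^2 = exp (ln (1 + 4 * (real q - 1)^2))"
        by (rule exp_ln[symmetric]) (simp add: add_pos_nonneg)
      also have "\<dots> \<le> exp (C * real d)" using True K by (simp add: C_def)
      finally show ?thesis
        using BH_poly_bound_mono[OF BH_poly_bound_1[OF q]] True q by simp
    next
      case False
      define k where "k = d div 2"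
      have k: "1 \<le> k" "k < d" "2 * k \<le> d" "d \<le> 3 * k" using False less.prems by (auto simp: k_def)
      define L where "L = exp (C * real d / 2 + 9 * real d + 3 * K / 2)"
      have 6: "BH_poly_bound d q ((real d + 1) * L)"
      proof (rule BH_recursion[OF q K k(1) less_imp_le[OF k(2)], where C = "\<lambda>m. exp (C * real m)"])
        fix m assume m: "1 \<le> m" "m \<le> k"
        show "BH_poly_bound m q (exp (C * real m))" using less.IH[of m] m k by simp
        show "exp (C * real m) \<ge> 0" by simp
        have 1: "K * real d / (2 * real k) \<le> 3 * K / 2"
        proof -
          have "K * real d \<le> K * (3 * real k)" using k K by (intro mult_left_mono) auto
          then show ?thesis using k by (simp add: divide_le_eq)
        qed
        have 2: "C * real m \<le> C * real d / 2"
          using mult_left_mono[of "2 * real m" "real d" C] m k C by simp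
        have 3: "(real d / real m) ^ (2 * m) \<le> exp (2 * real d)"
        proof -
          have "(real d / real m) ^ (2 * m) \<le> exp (real d / real m) ^ (2 * m)"
          proof (rule power_mono)
            show "real d / real m \<le> exp (real d / real m)"
              using exp_ge_add_one_self[of "real d / real m"] by linarith
          qed simp
          also have "\<dots> = exp (real (2 * m) * (real d / real m))" by (rule exp_of_nat_mult[symmetric])
          also have "real (2 * m) * (real d / real m) = 2 * real d" using m by simp
          finally show ?thesis .
        qed
        have 4: "2 * real d + 1 \<le> exp (2 * real d)" using exp_ge_add_one_self[of "2 * real d"] by linarith
        have 5: "exp (5 * real m) \<le> exp (5 * real d)" using m k by simp
        have "markov_const d m \<le> exp (2 * real d) * exp (5 * real d) * exp (2 * real d)"
          unfolding markov_const_def using 3 4 5 by (intro mult_mono) auto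
        also have "\<dots> = exp (9 * real d)" by (simp flip: exp_add)
        finally have "exp (K * real d / (2 * real k)) * (exp (C * real m) * markov_const d m)
            \<le> exp (3 * K / 2) * (exp (C * real d / 2) * exp (9 * real d))"
          using 1 2 markov_const_nonneg by (intro mult_mono) auto
        also have "\<dots> = L" by (simp add: L_def add_ac flip: exp_add)
        finally show "exp (K * real d / (2 * real k)) * (exp (C * real m) * markov_const d m) \<le> L" .
      next
        show "1 \<le> L" using C K by (simp add: L_def)
      qed
      have 7: "(real d + 1) * L \<le> exp (C * real d)"
      proof -
        have "(real d + 1) * L \<le> exp (real d) * L"
          using exp_ge_add_one_self[of "real d"] by (intro mult_right_mono) (simp_all add: L_def add.commute)
        also have "\<dots> = exp (C * real d / 2 + 10 * real d + 3 * K / 2)" by (simp add: L_def flip: exp_add)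
        also have "\<dots> \<le> exp (C * real d)"
        proof -
          have "20 * real d + 3 * K \<le> (20 + 3 * K) * real d"
            using less.prems K by (simp add: distrib_right)
          also have "\<dots> \<le> C * real d" using C by (intro mult_right_mono) auto
          finally show ?thesis by simp
        qed
        finally show ?thesis .
      qed
      show ?thesis by (rule BH_poly_bound_mono[OF 6 _ 7]) (use q less.prems in \<open>auto simp: L_def\<close>)
    qed
  qed
  then show ?thesis using that C(2) by blast
qed

text \<open>The function \<open>x * ln (d/x)\<close> increases up to \<open>d / exp 1\<close>. Hence
  the Markov losses of all orders \<open>m \<le> \<kappa>\<close> are dominated by the one at
  \<open>\<kappa>\<close>.\<close>

lemma mult_ln_ratio_mono:
  fixes d m \<kappa> :: real
  assumes "0 < m" "m \<le> \<kappa>" "\<kappa> * exp 1 \<le> d"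
  shows "m * ln (d / m) \<le> \<kappa> * ln (d / \<kappa>)"
proof -
  have k: "\<kappa> > 0" using assms by simp
  have "0 < \<kappa> * exp 1" using k by simp
  then have d: "d > 0" using assms by linarith
  have "exp 1 \<le> d / \<kappa>" using assms k by (simp add: le_divide_eq mult.commute)
  then have l: "ln (d / \<kappa>) \<ge> 1" using ln_ge_iff[of "d / \<kappa>" 1] d k by simp
  have "m * ln (\<kappa> / m) \<le> m * (\<kappa> / m - 1)"
    using assms k by (intro mult_left_mono ln_le_minus_one) auto
  also have "\<dots> = \<kappa> - m" using assms by (simp add: algebra_simps)
  also have "\<dots> \<le> (\<kappa> - m) * ln (d / \<kappa>)"
    using mult_left_mono[OF l, of "\<kappa> - m"] assms by simp
  finally have "m * ln (\<kappa> / m) \<le> (\<kappa> - m) * ln (d / \<kappa>)" .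
  moreover have "ln (d / m) = ln (d / \<kappa>) + ln (\<kappa> / m)" using d k assms by (simp add: ln_div)
  ultimately show ?thesis by (simp add: algebra_simps)
qed

text \<open>The recursion with the crude bound inserted for the orders up to \<open>k\<close>. In
  \<open>C + 5\<close>, the 5 comes from the factor \<open>exp (5 * m)\<close> of
  \<open>markov_const\<close>.\<close>

lemma BH_poly_bound_optimized:
  assumes q: "q \<ge> 2" and K: "K \<ge> 2" "(1 - 2 / real q) * K = ln (real q - 1)"
    and C: "C \<ge> 0" "\<And>d. d \<ge> 1 \<Longrightarrow> BH_poly_bound d q (exp (C * real d))"
    and \<kappa>: "\<kappa> \<ge> 2" "\<kappa> * exp 1 \<le> real d"
  shows "BH_poly_bound d q (exp (ln ((real d + 1) * (2 * real d + 1)) + K / 2 * real d / (\<kappa> - 1)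
    + (C + 5) * \<kappa> + 2 * \<kappa> * ln (real d / \<kappa>)))"
proof -
  \<comment> \<open>The parameter \<open>\<kappa>\<close> stays real for the asymptotic analysis;
    rounding down is the reason for the denominator \<open>\<kappa> - 1\<close>.\<close>
  define k where "k = nat \<lfloor>\<kappa>\<rfloor>"
  have k: "real k \<le> \<kappa>" "\<kappa> - 1 \<le> real k" "1 \<le> k" using \<kappa>(1) unfolding k_def by linarith+
  have "\<kappa> * 1 \<le> \<kappa> * exp 1" using \<kappa> by (intro mult_left_mono) auto
  then have \<kappa>d: "\<kappa> \<le> real d" using \<kappa> by linarith
  then have kd: "k \<le> d" using k by simp
  define X where "X = K / 2 * real d / (\<kappa> - 1) + (C + 5) * \<kappa> + 2 * \<kappa> * ln (real d / \<kappa>)"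
  have "ln (real d / \<kappa>) \<ge> 0" using \<kappa>d \<kappa> by (intro ln_ge_zero) simp
  then have X0: "X \<ge> 0" unfolding X_def using \<kappa> K C by (intro add_nonneg_nonneg mult_nonneg_nonneg divide_nonneg_nonneg) auto
  define L where "L = (2 * real d + 1) * exp X"
  have "BH_poly_bound d q ((real d + 1) * L)"
  proof (rule BH_recursion[OF q K k(3) kd, where C = "\<lambda>m. exp (C * real m)"])
    fix m assume m: "1 \<le> m" "m \<le> k"
    have mk: "real m \<le> \<kappa>" "real m > 0" using m k by auto
    show "BH_poly_bound m q (exp (C * real m))" using C m by simp
    show "exp (C * real m) \<ge> 0" by simp
    have 1: "K * real d / (2 * real k) \<le> K / 2 * real d / (\<kappa> - 1)"
    proof -
      have "K / 2 * real d / real k \<le> K / 2 * real d / (\<kappa> - 1)"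
        using k \<kappa> K by (intro divide_left_mono mult_nonneg_nonneg) auto
      then show ?thesis by simp
    qed
    have 2: "(C + 5) * real m \<le> (C + 5) * \<kappa>" using mk C by (intro mult_left_mono) auto
    have dm: "real d / real m > 0" using m kd by simp
    have "(real d / real m) ^ (2 * m) = (real d / real m) powr real (2 * m)" by (rule powr_realpow[symmetric, OF dm])
    also have "\<dots> = exp (2 * (real m * ln (real d / real m)))" using m kd by (simp add: powr_def)
    also have "\<dots> \<le> exp (2 * (\<kappa> * ln (real d / \<kappa>)))" using mult_ln_ratio_mono[OF mk(2,1) \<kappa>(2)] by simp
    finally have 3: "(real d / real m) ^ (2 * m) \<le> exp (2 * \<kappa> * ln (real d / \<kappa>))" by (simp only: mult.assoc)
    have e: "exp ((C + 5) * real m) = exp (C * real m) * exp (5 * real m)" by (simp add: distrib_right exp_add)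
    have "exp (K * real d / (2 * real k)) * (exp (C * real m) * markov_const d m)
      = (2 * real d + 1) * (exp (K * real d / (2 * real k)) * exp ((C + 5) * real m) * (real d / real m) ^ (2 * m))"
      unfolding markov_const_def e by (simp only: mult_ac)
    also have "\<dots> \<le> (2 * real d + 1) * (exp (K / 2 * real d / (\<kappa> - 1)) * exp ((C + 5) * \<kappa>) * exp (2 * \<kappa> * ln (real d / \<kappa>)))"
      using 1 2 3 by (intro mult_left_mono mult_mono) auto
    also have "\<dots> = L" by (simp only: L_def X_def exp_add)
    finally show "exp (K * real d / (2 * real k)) * (exp (C * real m) * markov_const d m) \<le> L" .
  next
    have "1 * 1 \<le> (2 * real d + 1) * exp X" using X0 by (intro mult_mono) auto
    then show "1 \<le> L" by (simp add: L_def)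
  qed
  moreover have "(real d + 1) * L = exp (ln ((real d + 1) * (2 * real d + 1)) + X)"
    unfolding exp_add by (subst exp_ln) (simp_all add: L_def)
  ultimately show ?thesis by (simp add: X_def add.assoc)
qed

subsection \<open>Fourier expansion\<close>

definition freq_graph :: "nat \<Rightarrow> (nat \<Rightarrow> nat) \<Rightarrow> (nat \<times> nat) set" where
  "freq_graph N \<alpha> = (\<lambda>j. (j, \<alpha> j)) ` {j\<in>{1..N}. \<alpha> j \<noteq> 0}"

lemma freq_graph_mem: "\<alpha> \<in> freqs q N \<Longrightarrow> freq_graph N \<alpha> \<in> freq_sets {1..N} q"
  unfolding freq_graph_def freq_sets_def freqs_def by (auto simp: inj_on_def PiE_def Pi_def Suc_le_eq)

lemma expo_freq_graph:
  assumes "\<alpha> \<in> freqs q N" "j \<in> {1..N}"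
  shows "expo (freq_graph N \<alpha>) j = \<alpha> j"
proof (cases "\<alpha> j = 0")
  case True
  then show ?thesis by (simp add: expo_not_mem freq_graph_def image_iff)
next
  case False
  then have "(j, \<alpha> j) \<in> freq_graph N \<alpha>" using assms by (auto simp: freq_graph_def)
  then show ?thesis by (rule expo_mem[OF freq_graph_mem[OF assms(1)]])
qed

lemma bij_betw_freq_graph:
  assumes q: "q \<ge> 1"
  shows "bij_betw (freq_graph N) (freqs q N) (freq_sets {1..N} q)"
proof (rule bij_betw_byWitness[where f' = "\<lambda>A. restrict (expo A) {1..N}"])
  show "\<forall>\<alpha>\<in>freqs q N. restrict (expo (freq_graph N \<alpha>)) {1..N} = \<alpha>"
  proof
    fix \<alpha> assume a: "\<alpha> \<in> freqs q N"
    show "restrict (expo (freq_graph N \<alpha>)) {1..N} = \<alpha>"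
    proof
      fix j
      show "restrict (expo (freq_graph N \<alpha>)) {1..N} j = \<alpha> j"
        using expo_freq_graph[OF a, of j] a by (cases "j \<in> {1..N}") (auto simp: freqs_def PiE_def extensional_def)
    qed
  qed
  have r: "restrict (expo A) {1..N} \<in> freqs q N" if "A \<in> freq_sets {1..N} q" for A
    unfolding freqs_def using expo_less[OF q that] by (intro restrict_PiE_iff[THEN iffD2]) simp
  show "\<forall>A\<in>freq_sets {1..N} q. freq_graph N (restrict (expo A) {1..N}) = A"
  proof
    fix A assume A: "A \<in> freq_sets {1..N} q"
    show "freq_graph N (restrict (expo A) {1..N}) = A"
    proof (rule freq_sets_eqI[OF freq_graph_mem[OF r[OF A]] A])
      fix j assume j: "j \<in> {1..N}"
      show "expo (freq_graph N (restrict (expo A) {1..N})) j = expo A j"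
        by (simp only: expo_freq_graph[OF r[OF A] j] restrict_apply j if_True)
    qed
  qed
  show "freq_graph N ` freqs q N \<subseteq> freq_sets {1..N} q" using freq_graph_mem by blast
  show "(\<lambda>A. restrict (expo A) {1..N}) ` freq_sets {1..N} q \<subseteq> freqs q N" using r by blast
qed

lemma card_freq_graph: "card (freq_graph N \<alpha>) = int_order N \<alpha>"
  unfolding freq_graph_def int_order_def by (intro card_image) (auto simp: inj_on_def)

lemma monom_at_freq_graph:
  assumes "\<alpha> \<in> freqs q N"
  shows "monom_at (freq_graph N \<alpha>) x = char_q N \<alpha> x"
  unfolding monom_at_eq_prod[OF finite_atLeastAtMost freq_graph_mem[OF assms]] char_q_def
  by (intro prod.cong refl) (simp add: expo_freq_graph[OF assms])

text \<open>The dual orthogonality relation, summed over frequencies instead of points; it yields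
  the kernel of Fourier inversion.\<close>

lemma sum_powers_cyc:
  assumes q: "q \<ge> 1" and x: "x \<in> cyc q" and y: "y \<in> cyc q"
  shows "(\<Sum>v<q. x ^ v * cnj (y ^ v)) = (if x = y then of_nat q else 0)"
proof -
  define z where "z = x * cnj y"
  have pow: "w ^ q = 1" if w: "w \<in> cyc q" for w
  proof -
    obtain k where "w = root_q q ^ k" using w unfolding cyc_def by blast
    then have "w ^ q = (root_q q ^ q) ^ k" by (simp add: mult.commute flip: power_mult)
    then show ?thesis using root_q_power_eq_1_iff[OF q, of q] by simp
  qed
  have yy: "y * cnj y = 1" using complex_norm_square[of y] norm_cyc[OF y] by simp
  have "z = 1 \<longleftrightarrow> x = y"
  proof
    assume "z = 1"
    then have "x * (y * cnj y) = y" by (simp add: z_def mult.assoc mult.left_commute)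
    then show "x = y" by (simp only: yy mult_1_right)
  next
    assume "x = y" then show "z = 1" using yy by (simp add: z_def)
  qed
  moreover have "z ^ q = 1"
    using pow[OF x] pow[OF y] by (simp add: z_def power_mult_distrib flip: complex_cnj_power)
  moreover have "(\<Sum>v<q. x ^ v * cnj (y ^ v)) = (\<Sum>v<q. z ^ v)"
    by (simp add: z_def power_mult_distrib)
  ultimately show ?thesis by (cases "x = y") (simp_all add: geometric_sum)
qed

lemma fourier_inversion:
  assumes q: "q \<ge> 1" and x: "x \<in> cyc_pow q N"
  shows "(\<Sum>\<alpha>\<in>freqs q N. fourier_coeff q N f \<alpha> * char_q N \<alpha> x) = f x"
proof -
  have fin: "finite (cyc_pow q N)" unfolding cyc_pow_def by (intro finite_PiE) auto
  have kernel: "(\<Sum>\<alpha>\<in>freqs q N. char_q N \<alpha> x * cnj (char_q N \<alpha> y)) = (if y = x then of_nat q ^ N else 0)"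
    if y: "y \<in> cyc_pow q N" for y
  proof -
    have "(\<Sum>\<alpha>\<in>freqs q N. char_q N \<alpha> x * cnj (char_q N \<alpha> y))
      = (\<Sum>\<alpha>\<in>freqs q N. \<Prod>j\<in>{1..N}. x j ^ \<alpha> j * cnj (y j ^ \<alpha> j))"
      unfolding char_q_def by (simp add: prod.distrib)
    also have "\<dots> = (\<Prod>j\<in>{1..N}. \<Sum>v\<in>{..<q}. x j ^ v * cnj (y j ^ v))"
      unfolding freqs_def by (rule prod_sum_PiE[symmetric]) auto
    also have "\<dots> = (\<Prod>j\<in>{1..N}. if x j = y j then of_nat q else 0)"
      by (intro prod.cong refl sum_powers_cyc q) (use x y in \<open>auto simp: cyc_pow_def PiE_def Pi_def\<close>)
    also have "\<dots> = (if y = x then of_nat q ^ N else 0)"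
    proof (cases "y = x")
      case False
      then have "\<not> (\<forall>j\<in>{1..N}. x j = y j)"
        using PiE_ext[OF x[unfolded cyc_pow_def] y[unfolded cyc_pow_def]] by blast
      then obtain j where "j \<in> {1..N}" "x j \<noteq> y j" by blast
      then show ?thesis using False by (auto intro: prod_zero)
    qed simp
    finally show ?thesis .
  qed
  have "(\<Sum>\<alpha>\<in>freqs q N. fourier_coeff q N f \<alpha> * char_q N \<alpha> x)
    = (\<Sum>\<alpha>\<in>freqs q N. \<Sum>y\<in>cyc_pow q N. f y / of_nat q ^ N * (char_q N \<alpha> x * cnj (char_q N \<alpha> y)))"
    unfolding fourier_coeff_def by (simp add: sum_divide_distrib sum_distrib_right sum_distrib_left mult_ac)
  also have "\<dots> = (\<Sum>y\<in>cyc_pow q N. f y / of_nat q ^ N * (\<Sum>\<alpha>\<in>freqs q N. char_q N \<alpha> x * cnj (char_q N \<alpha> y)))"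
    by (subst sum.swap) (simp add: sum_distrib_left)
  also have "\<dots> = (\<Sum>y\<in>cyc_pow q N. if y = x then f x else 0)"
    using q by (intro sum.cong refl) (simp add: kernel)
  also have "\<dots> = f x" using fin x by simp
  finally show ?thesis .
qed

lemma BH_int_bound_of_poly:
  assumes q: "q \<ge> 1" and d: "d \<ge> 1" and C: "C \<ge> 0" and BH: "BH_poly_bound d q C"
  shows "BH_int_bound d q C"
  unfolding BH_int_bound_def
proof (intro allI impI)
  fix N :: nat and f :: "(nat \<Rightarrow> complex) \<Rightarrow> complex"
  assume f: "\<forall>\<alpha>\<in>freqs q N. int_order N \<alpha> > d \<longrightarrow> fourier_coeff q N f \<alpha> = 0"
  define J where "J = {1..N}"
  have J: "finite J" by (simp add: J_def)
  define M where "M = sup_norm q N f"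
  define c where "c = (\<lambda>A. fourier_coeff q N f (the_inv_into (freqs q N) (freq_graph N) A))"
  note bij = bij_betw_freq_graph[OF q, of N]
  have c_graph: "c (freq_graph N \<alpha>) = fourier_coeff q N f \<alpha>" if "\<alpha> \<in> freqs q N" for \<alpha>
    unfolding c_def using the_inv_into_f_f[OF bij_betw_imp_inj_on[OF bij] that] by simp
  have transfer: "(\<Sum>A\<in>freq_sets J q. F A) = (\<Sum>\<alpha>\<in>freqs q N. F (freq_graph N \<alpha>))" for F :: "(nat \<times> nat) set \<Rightarrow> 'b::comm_monoid_add"
    unfolding J_def by (rule sum.reindex_bij_betw[OF bij, symmetric])
  have c0: "card A \<le> d" if A: "A \<in> freq_sets J q" "c A \<noteq> 0" for A
  proof -
    obtain \<alpha> where a: "\<alpha> \<in> freqs q N" "A = freq_graph N \<alpha>"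
      using bij_betw_imp_surj_on[OF bij] A unfolding J_def by blast
    then have "fourier_coeff q N f \<alpha> \<noteq> 0" using A c_graph by simp
    then show ?thesis unfolding a(2) card_freq_graph using f a(1) by (meson not_le)
  qed
  have b: "cyc_bounded J q c M"
    unfolding cyc_bounded_def
  proof (intro allI impI)
    fix x assume x: "\<forall>j\<in>J. x j \<in> cyc q"
    \<comment> \<open>\<open>cyc_bounded\<close> ranges over all functions with values in the group
      on \<open>J\<close>, whereas \<open>cyc_pow\<close> has only extensional ones; the polynomial
      does not see the difference.\<close>
    define x' where "x' = restrict x J"
    have x': "x' \<in> cyc_pow q N" using x by (auto simp: x'_def cyc_pow_def J_def)
    have "cyc_poly J q c x = cyc_poly J q c x'"
      unfolding cyc_poly_def
    proof (intro sum.cong refl arg_cong2[where f = "(*)"])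
      fix A assume "A \<in> freq_sets J q"
      then show "monom_at A x = monom_at A x'"
        unfolding monom_at_def by (intro prod.cong refl) (auto simp: x'_def freq_sets_def)
    qed
    also have "\<dots> = (\<Sum>\<alpha>\<in>freqs q N. fourier_coeff q N f \<alpha> * char_q N \<alpha> x')"
      unfolding cyc_poly_def transfer by (intro sum.cong refl) (simp add: c_graph monom_at_freq_graph)
    also have "\<dots> = f x'" by (rule fourier_inversion[OF q x'])
    finally have "cmod (cyc_poly J q c x) = cmod (f x')" by simp
    also have "\<dots> \<le> M" unfolding M_def sup_norm_def
    proof (rule Max_ge)
      show "finite ((\<lambda>x. cmod (f x)) ` cyc_pow q N)" unfolding cyc_pow_def by (intro finite_imageI finite_PiE) auto
    qed (use x' in simp)
    finally show "cmod (cyc_poly J q c x) \<le> M" .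
  qed
  have M0: "M \<ge> 0" by (rule cyc_bounded_nonneg[OF q b])
  have p: "bh_exponent d > 0" by (rule bh_exponent_pos[OF d])
  have "(\<Sum>\<alpha>\<in>{\<alpha>\<in>freqs q N. int_order N \<alpha> \<le> d}. cmod (fourier_coeff q N f \<alpha>) powr bh_exponent d)
      \<le> (\<Sum>\<alpha>\<in>freqs q N. cmod (fourier_coeff q N f \<alpha>) powr bh_exponent d)"
    by (intro sum_mono2) (auto simp: freqs_def intro!: finite_PiE)
  also have "\<dots> = (\<Sum>A\<in>freq_sets J q. cmod (c A) powr bh_exponent d)"
    unfolding transfer by (intro sum.cong refl) (simp add: c_graph)
  also have "\<dots> \<le> (C * M) powr bh_exponent d"
    by (rule BH_poly_boundD[OF BH J c0 b])
  finally have "(\<Sum>\<alpha>\<in>{\<alpha>\<in>freqs q N. int_order N \<alpha> \<le> d}. cmod (fourier_coeff q N f \<alpha>) powr bh_exponent d) powr (1 / bh_exponent d)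
      \<le> ((C * M) powr bh_exponent d) powr (1 / bh_exponent d)"
    using p by (intro powr_mono2) (auto intro!: sum_nonneg)
  also have "\<dots> = C * M" using p C M0 by (simp add: powr_powr)
  finally show "(\<Sum>\<alpha>\<in>{\<alpha>\<in>freqs q N. int_order N \<alpha> \<le> d}. cmod (fourier_coeff q N f \<alpha>) powr bh_exponent d) powr (1 / bh_exponent d)
      \<le> C * sup_norm q N f" unfolding M_def .
qed

section \<open>The logarithmic Sobolev constant and the remainder term\<close>

lemma four_gamma_q:
  assumes "q \<ge> 2"
  shows "4 * gamma_q q \<ge> 2" "(1 - 2 / real q) * (4 * gamma_q q) = ln (real q - 1)"
proof -
  have "4 * gamma_q q \<ge> 2 \<and> (1 - 2 / real q) * (4 * gamma_q q) = ln (real q - 1)"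
  proof (cases "q = 2")
    \<comment> \<open>Here the equation reads \<open>0 = 0\<close>, so \<open>K \<ge> 2\<close>
      alone decides; \<open>gamma_q\<close> attains it with equality.\<close>
    case True
    then show ?thesis by (simp add: gamma_q_def)
  next
    case False
    then have q: "real q \<ge> 3" using assms by simp
    have g: "4 * gamma_q q = real q * ln (real q - 1) / (real q - 2)"
      using False q unfolding gamma_q_def by (simp add: divide_simps)
    have "ln (real q - 1) \<ge> 2 * (real q - 1 - 1) / (real q - 1 + 1)"
      by (rule ln_ge_two_diff_over_sum) (use q in simp)
    then have "real q * ln (real q - 1) \<ge> 2 * (real q - 2)" using q by (simp add: divide_le_eq mult.commute)
    then have "4 * gamma_q q \<ge> 2" unfolding g using q by (simp add: le_divide_eq)
    moreover have "(1 - 2 / real q) * (4 * gamma_q q) = ln (real q - 1)"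
      unfolding g using q by (simp add: field_simps)
    ultimately show ?thesis by simp
  qed
  then show "4 * gamma_q q \<ge> 2" "(1 - 2 / real q) * (4 * gamma_q q) = ln (real q - 1)" by auto
qed

text \<open>By definition \<open>a^2 * d = \<kappa>^2 * ln d\<close>, so the hypercontractive term
  equals \<open>\<kappa> * ln d\<close> plus \<open>\<kappa> * ln d / (\<kappa> - 1)\<close>, the
  cost of rounding. The first summand is \<open>a * sqrt (d * ln d)\<close>, half of the main term;
  the Markov term supplies the other half.\<close>

lemma remainder_asymptotics:
  fixes a C :: real
  assumes a: "a > 0"
  defines "\<kappa> \<equiv> \<lambda>d::nat. a * sqrt (real d / ln (real d))"
  shows "(\<lambda>d. ln ((real d + 1) * (2 * real d + 1)) + a\<^sup>2 * real d / (\<kappa> d - 1) + (C + 5) * \<kappa> d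
      + 2 * \<kappa> d * ln (real d / \<kappa> d) - 2 * a * sqrt (real d * ln (real d)))
    \<in> O(\<lambda>d. sqrt (real d / ln (real d)) * ln (ln (real d)))" (is "?E \<in> O(?g)")
proof -
  have 1: "(\<lambda>d::nat. ln ((real d + 1) * (2 * real d + 1))) \<in> O(?g)" by real_asymp
  have 2: "(\<lambda>d::nat. a * sqrt (real d / ln (real d)) * ln (real d) / (a * sqrt (real d / ln (real d)) - 1)) \<in> O(?g)"
    using a by real_asymp
  have 3: "(\<lambda>d::nat. D * (a * sqrt (real d / ln (real d)))) \<in> O(?g)" for D using a by real_asymp
  \<comment> \<open>Here \<open>2 * ln (d/\<kappa>) = ln d + ln (ln d) - 2 * ln a\<close>; the
    middle term is what determines the size of the whole remainder.\<close>
  have 4: "(\<lambda>d::nat. 2 * (a * sqrt (real d / ln (real d))) * ln (real d / (a * sqrt (real d / ln (real d))))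
      - a * sqrt (real d * ln (real d))) \<in> O(?g)"
    using a by real_asymp
  define F where "F = (\<lambda>d. ln ((real d + 1) * (2 * real d + 1)) + \<kappa> d * ln (real d) / (\<kappa> d - 1) + (C + 5) * \<kappa> d
      + (2 * \<kappa> d * ln (real d / \<kappa> d) - a * sqrt (real d * ln (real d))))"
  have "F \<in> O(?g)" unfolding F_def \<kappa>_def
    by (intro sum_in_bigo 1 2 3 4)
  moreover have ev: "eventually (\<lambda>d. F d = ?E d) sequentially"
  proof -
    have "eventually (\<lambda>d::nat. a * sqrt (real d / ln (real d)) \<ge> 2) sequentially" using a by real_asymp
    moreover have "eventually (\<lambda>d::nat. d > 1) sequentially" by (rule eventually_gt_at_top)
    ultimately show ?thesis
    proof eventually_elim
      case (elim d)
      define L where "L = ln (real d)"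
      have L: "L > 0" using elim by (simp add: L_def)
      have kd: "\<kappa> d \<ge> 2" using elim by (simp add: \<kappa>_def)
      have "(\<kappa> d)^2 * L = a\<^sup>2 * real d"
        using L by (simp add: \<kappa>_def power_mult_distrib L_def)
      moreover have s: "a * sqrt (real d * L) = \<kappa> d * L"
      proof -
        have "sqrt (real d * L) = sqrt (real d / L * L\<^sup>2)" using L by (simp add: power2_eq_square)
        also have "\<dots> = sqrt (real d / L) * L" using L by (simp only: real_sqrt_mult real_sqrt_abs abs_of_pos)
        finally show ?thesis by (simp add: \<kappa>_def L_def)
      qed
      ultimately have "a\<^sup>2 * real d / (\<kappa> d - 1) = (\<kappa> d)^2 * L / (\<kappa> d - 1)" by simp
      also have "\<dots> = \<kappa> d * L / (\<kappa> d - 1) + \<kappa> d * L"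
        using kd by (simp add: field_simps power2_eq_square)
      finally have "a\<^sup>2 * real d / (\<kappa> d - 1) = \<kappa> d * L / (\<kappa> d - 1) + a * sqrt (real d * L)" using s by simp
      then show ?case unfolding F_def L_def by linarith
    qed
  qed
  ultimately show ?thesis using landau_o.big.in_cong[OF ev] by blast
qed

theorem theorem1:
  fixes q :: nat
  assumes "q \<ge> 2"
  shows "\<exists>r :: nat \<Rightarrow> real.
           r \<in> O(\<lambda>d. sqrt (real d / ln (real d)) * ln (ln (real d))) \<and>
           (\<forall>\<^sub>F d in sequentially.
              BH_int d q \<le> ereal (exp (c_q q * sqrt (real d * ln (real d)) + r d)))"
proof -
  define K where "K = 4 * gamma_q q"
  note K = four_gamma_q[OF assms, folded K_def]
  obtain C where C: "C \<ge> 0" "\<And>d. d \<ge> 1 \<Longrightarrow> BH_poly_bound d q (exp (C * real d))"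
    by (rule BH_poly_bound_exponential[OF assms K]) blast
  \<comment> \<open>The minimizer of \<open>K * d / (2 * \<kappa>) + \<kappa> * ln d\<close> over
    \<open>\<kappa> = a * sqrt (d / ln d)\<close>, where both summands equal
    \<open>a * sqrt (d * ln d)\<close>.\<close>
  define a where "a = sqrt (K / 2)"
  have a: "a > 0" "a\<^sup>2 = K / 2" using K by (simp_all add: a_def)
  have cq: "c_q q = 2 * a" by (simp add: c_q_def a_def K_def)
  define \<kappa> where "\<kappa> = (\<lambda>d::nat. a * sqrt (real d / ln (real d)))"
  define E where "E = (\<lambda>d. ln ((real d + 1) * (2 * real d + 1)) + a\<^sup>2 * real d / (\<kappa> d - 1) + (C + 5) * \<kappa> d
      + 2 * \<kappa> d * ln (real d / \<kappa> d))"
  define r where "r = (\<lambda>d. E d - c_q q * sqrt (real d * ln (real d)))"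
  have "r \<in> O(\<lambda>d. sqrt (real d / ln (real d)) * ln (ln (real d)))"
    unfolding r_def E_def cq \<kappa>_def by (rule remainder_asymptotics[OF a(1)])
  moreover have "\<forall>\<^sub>F d in sequentially. BH_int d q \<le> ereal (exp (c_q q * sqrt (real d * ln (real d)) + r d))"
  proof -
    have "eventually (\<lambda>d. \<kappa> d \<ge> 2) sequentially" unfolding \<kappa>_def using a(1) by real_asymp
    moreover have "eventually (\<lambda>d. \<kappa> d \<le> real d / exp 1) sequentially" unfolding \<kappa>_def using a(1) by real_asymp
    moreover have "eventually (\<lambda>d::nat. d \<ge> 1) sequentially" by (rule eventually_ge_at_top)
    ultimately show ?thesis
    proof eventually_elim
      case (elim d)
      have "\<kappa> d * exp 1 \<le> real d" using elim by (simp add: le_divide_eq)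
      then have "BH_poly_bound d q (exp (E d))"
        using BH_poly_bound_optimized[OF assms K C elim(1)] unfolding E_def a(2) by blast
      then have "BH_int_bound d q (exp (E d))" using assms elim by (intro BH_int_bound_of_poly) auto
      then have "BH_int d q \<le> ereal (exp (E d))" unfolding BH_int_def by (intro INF_lower) simp
      then show ?case by (simp add: r_def)
    qed
  qed
  ultimately show ?thesis by blast
qed

end
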